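(* Let $m,p,d\ge 1$ be integers with $r:=p-m\ge 0$ and $s:=d-p-m\ge 0$, let $t>0$ and let $0<\rho\le 1$. Let $J_t$ be the $m\times m$ Hermitian Jacobi process of parameters $(p,d-p)$ at time $t$, and let $$C_t(m,p,d,\rho)=\mathbb{E}\left[\log\det\left(\mathrm{Id}_{m\times m}+\rho J_t\right)\right]$$ be the Shannon capacity of the associated MIMO channel. Then $$C_t(m, p, d, \rho)=\sum_{n=1}^{\infty}\frac{(-1)^{n-1}\rho^n}{n}M_n(t)$$ and $$C_t(m,p,d,\rho) = C_{\infty} (m, p, d, \rho) + \sum_{n=1}^\infty\ \sum_{\substack{\alpha \text{ hook},\ |\alpha|=n \\ 1 \leq l(\alpha) \leq m}}\ \sum_{\substack{\tau \subseteq \alpha \\ \tau \neq \emptyset}} \frac{(-1)^{\alpha_1-1}\rho^{|\alpha|}}{|\alpha|}\, \frac{e^{-\nu_\tau t} \, \tilde{V}_{\alpha_1, \tau_1}^{r,s,m} \, U_{l(\alpha), l(\tau)}^{r,s,m} }{(r+s+\tau_1+2m-l(\tau)) (\tau_1+l(\tau)-1)},$$ where $$\tilde{V}_{\alpha_1, \tau_1}^{r,s,m} = \frac{(r+s+2\tau_1+2m-1)\,\Gamma(\tau_1+2m+r+s)\,\Gamma(\alpha_1+m)\,\Gamma(r+\alpha_1+m)\,\Gamma(\tau_1+m+s)}{(\alpha_1-\tau_1)!\,(\tau_1-1)!\,\Gamma(r+s+\alpha_1+\tau_1+2m)\,\Gamma(r+\tau_1+m)}$$ and $$U_{l(\alpha),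 l(\tau)}^{r,s,m} = \frac{(2m+r+s+1-2l(\tau))\,\Gamma(r+m-l(\tau)+1)\,\Gamma(r+s+2m-l(\alpha)-l(\tau)+1)}{(l(\alpha)- l(\tau))!\,(l(\tau)-1)!\,\Gamma(m-l(\alpha)+1)\,\Gamma(r+m-l(\alpha)+1)\,\Gamma(m+s-l(\tau)+1)\,\Gamma(2m+r+s-l(\tau)+1)}.$$
   Context: **Partitions.** A partition $\tau=(\tau_1\ge\tau_2\ge\cdots\ge 0)$ has weight $|\tau|=\sum_i\tau_i$ and length $l(\tau)$, the number of nonzero parts; it is padded by zeros when needed. A hook of weight $n$ is a partition $\alpha=(n-k,1^k)$, $0\le k\le n-1$. $\tau\subseteq\alpha$ means $\tau_i\le\alpha_i$ for all $i$. For a partition $\tau$ with $l(\tau)\le m$, $$\nu_{\tau}=\sum_{i=1}^m\tau_i(\tau_i+r+s+1+2(m-i)).$$ **Hermitian Jacobi process.** Let $Y=(Y_t)_{t\ge 0}$ be the Brownian motion on the unitary group $U(d)$ started at the identity, and let $X_t$ be the upper left $m\times p$ corner of $Y_t$. Then $J_t=X_tX_t^*$ is the Hermitian Jacobi process of size $m\times m$ and parameters $(p,q)$, $q=d-p$. With $r=p-m\ge0$ and $s=d-p-m\ge 0$, the Brownian motion is normalized so that for $t>0$ the eigenvalues of $J_t$, in decreasing order, have (this is a known fact which may be taken as the definition of the law involved) the density on $\{0<y_m<\cdots<y_1<1\}$ $$G_t^{r,s,m}(1^m,y)=\sum_{\tau:\ l(\tau)\le m}e^{-\nu_\tau t}\Big(\prod_{j=1}^m\frac{1}{\|\tilde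 P^{r,s}_{\tau_j+m-j}\|_2^2}\Big)\tilde P_\tau^{r,s,m}(1^m)\,\tilde P_\tau^{r,s,m}(y)\,W^{r,s,m}(y),$$ an absolutely convergent series. Here $1^m=(1,\dots,1)$ ($m$ times); $$\tilde{P}_k^{r,s}(u)=\frac{(r+1)_k}{k!}\,{}_2F_1(-k,k+r+s+1;r+1;u)$$ are the Jacobi polynomials orthogonal for the weight $u^r(1-u)^s$ on $[0,1]$, and $\|\cdot\|_2$ is the norm of $L^2([0,1],u^r(1-u)^sdu)$; $$\tilde P_\tau^{r,s,m}(x)=\frac{\det(\tilde P^{r,s}_{\tau_i-i+m}(x_j))_{1\le i,j\le m}}{V(x)},\qquad V(x)=\prod_{1\le i<j\le m}(x_i-x_j)$$ (a symmetric polynomial, extended by continuity to coinciding coordinates); and $$W^{r,s,m}(y)=V(y)^2\prod_{i=1}^my_i^r(1-y_i)^s\,\mathbf 1_{0<y_m<\cdots<y_1<1}.$$ Thus $M_n(t)=\mathbb{E}(\mathrm{tr}(J_t^n))=\int\big(\sum_{i=1}^my_i^n\big)G_t^{r,s,m}(1^m,y)\,dy$ and $C_t(m,p,d,\rho)=\int\big(\sum_{i=1}^m\log(1+\rho y_i)\big)G_t^{r,s,m}(1^m,y)\,dy$. (In the application $\rho=\mathcal{P}/p$, with $\mathcal{P}$ the total power at the transmitter.) **Stationary capacity.** $$C_\infty(m,p,d,\rho)=\frac{1}{Z^{r,s,m}}\int\Big(\sum_{i=1}^m\log(1+\rho y_i)\Big)W^{r,s,m}(y)\,dy,\qquad Z^{r,s,m}=\int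 W^{r,s,m}(y)\,dy,$$ the capacity of the channel drawn from the Jacobi unitary ensemble. *)

theory Defs
  imports "HOL-Probability.Probability" "Jordan_Normal_Form.Schur_Decomposition"
begin

text \<open>
  Indices of parts, of coordinates and of matrix entries start at 0, so that the usual
  \<open>\<tau>\<^sub>i\<close>, \<open>y\<^sub>i\<close> (\<open>1 \<le> i \<le> m\<close>) are \<open>part \<tau> (i - 1)\<close> and \<open>y (i - 1)\<close>.
  In particular an expression \<open>m - i\<close> becomes \<open>m - 1 - i\<close>.
\<close>

text \<open>A partition is the list of its nonzero parts; its length is the length of the list.\<close>

definition partitions :: "nat list set" where
  "partitions = {\<tau>. sorted_wrt (\<ge>) \<tau> \<and> 0 \<notin> set \<tau>}"

definition part :: "nat list \<Rightarrow> nat \<Rightarrow> nat" where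
  "part \<tau> i = (if i < length \<tau> then \<tau> ! i else 0)"

definition weight :: "nat list \<Rightarrow> nat" where
  "weight \<tau> = sum_list \<tau>"

definition contained :: "nat list \<Rightarrow> nat list \<Rightarrow> bool" where
  "contained \<tau> \<alpha> \<longleftrightarrow> (\<forall>i. part \<tau> i \<le> part \<alpha> i)"

definition hooks :: "nat \<Rightarrow> nat list set" where
  "hooks n = {(n - k) # replicate k 1 | k. k < n}"

definition nu :: "nat \<Rightarrow> nat \<Rightarrow> nat \<Rightarrow> nat list \<Rightarrow> nat" where
  "nu r s m \<tau> = (\<Sum>i<m. part \<tau> i * (part \<tau> i + r + s + 1 + 2 * (m - 1 - i)))"

definition hyp2F1 :: "real \<Rightarrow> real \<Rightarrow> real \<Rightarrow> real \<Rightarrow> real" where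
  "hyp2F1 a b c u = (\<Sum>j. pochhammer a j * pochhammer b j / (pochhammer c j * fact j) * u ^ j)"

definition jacobi :: "nat \<Rightarrow> nat \<Rightarrow> nat \<Rightarrow> real \<Rightarrow> real" where
  "jacobi r s k u =
     pochhammer (real r + 1) k / fact k * hyp2F1 (- real k) (real (k + r + s + 1)) (real (r + 1)) u"

definition jacobi_norm_sq :: "nat \<Rightarrow> nat \<Rightarrow> nat \<Rightarrow> real" where
  "jacobi_norm_sq r s k =
     (LINT u:{0..1}|lborel. (jacobi r s k u)\<^sup>2 * (u ^ r * (1 - u) ^ s))"

definition vandermonde :: "nat \<Rightarrow> (nat \<Rightarrow> real) \<Rightarrow> real" where
  "vandermonde m x = (\<Prod>j<m. \<Prod>i<j. x i - x j)"

definition jacobi_quotient :: "nat \<Rightarrow> nat \<Rightarrow> nat \<Rightarrow> nat list \<Rightarrow> (nat \<Rightarrow> real) \<Rightarrow> real" where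
  "jacobi_quotient r s m \<tau> x =
     Determinant.det (Matrix.mat m m (\<lambda>(i, j). jacobi r s (part \<tau> i + (m - 1 - i)) (x j)))
       / vandermonde m x"

definition multi_jacobi :: "nat \<Rightarrow> nat \<Rightarrow> nat \<Rightarrow> nat list \<Rightarrow> (nat \<Rightarrow> real) \<Rightarrow> real" where
  "multi_jacobi r s m \<tau> x =
     (if vandermonde m x \<noteq> 0 then jacobi_quotient r s m \<tau> x
      else Lim (at x within {z. vandermonde m z \<noteq> 0}) (jacobi_quotient r s m \<tau>))"

definition jacobi_weight :: "nat \<Rightarrow> nat \<Rightarrow> nat \<Rightarrow> (nat \<Rightarrow> real) \<Rightarrow> real" where
  "jacobi_weight r s m y =
     (vandermonde m y)\<^sup>2 * (\<Prod>i<m. y i ^ r * (1 - y i) ^ s)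
       * (if (\<forall>i<m. 0 < y i \<and> y i < 1) \<and> (\<forall>j<m. \<forall>i<j. y j < y i) then 1 else 0)"

abbreviation lebesgue_pi :: "nat \<Rightarrow> (nat \<Rightarrow> real) measure" where
  "lebesgue_pi m \<equiv> PiM {..<m} (\<lambda>_. lborel)"

definition jacobi_density :: "nat \<Rightarrow> nat \<Rightarrow> nat \<Rightarrow> real \<Rightarrow> (nat \<Rightarrow> real) \<Rightarrow> real" where
  "jacobi_density r s m t y =
     (\<Sum>\<^sub>\<infinity>\<tau>\<in>{\<tau> \<in> partitions. length \<tau> \<le> m}.
        exp (- real (nu r s m \<tau>) * t)
        * (\<Prod>j<m. 1 / jacobi_norm_sq r s (part \<tau> j + (m - 1 - j)))
        * multi_jacobi r s m \<tau> (\<lambda>_. 1) * multi_jacobi r s m \<tau> y * jacobi_weight r s m y)"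

definition ordered_eigenvalues :: "nat \<Rightarrow> complex mat \<Rightarrow> (nat \<Rightarrow> real) \<Rightarrow> bool" where
  "ordered_eigenvalues m A y \<longleftrightarrow>
     char_poly A = (\<Prod>i<m. [:- complex_of_real (y i), 1:]) \<and> (\<forall>j<m. \<forall>i<j. y j \<le> y i)"

text \<open>
  \<open>J\<close> is a random Hermitian \<open>m \<times> m\<close> matrix whose ordered eigenvalues have the density of those of
  \<open>X\<^sub>t X\<^sub>t\<^sup>*\<close>, where \<open>X\<^sub>t\<close> is the upper left \<open>m \<times> p\<close> corner of Brownian motion on \<open>U(d)\<close> started
  at the identity. This known density is taken as the definition of the law.
\<close>

definition hermitian_jacobi ::
    "'a measure \<Rightarrow> nat \<Rightarrow> nat \<Rightarrow> nat \<Rightarrow> real \<Rightarrow> ('a \<Rightarrow> complex mat) \<Rightarrow> bool" where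
  "hermitian_jacobi M m p d t J \<longleftrightarrow>
     (\<forall>\<omega>\<in>space M. J \<omega> \<in> carrier_mat m m \<and> mat_adjoint (J \<omega>) = J \<omega>) \<and>
     (\<forall>i<m. \<forall>j<m. (\<lambda>\<omega>. J \<omega> $$ (i, j)) \<in> borel_measurable M) \<and>
     (\<exists>Y. (\<forall>\<omega>\<in>space M. ordered_eigenvalues m (J \<omega>) (Y \<omega>)) \<and>
          distributed M (lebesgue_pi m) Y (\<lambda>y. ennreal (jacobi_density (p - m) (d - p - m) m t y)))"

definition moment :: "'a measure \<Rightarrow> nat \<Rightarrow> ('a \<Rightarrow> complex mat) \<Rightarrow> nat \<Rightarrow> real" where
  "moment M m J n = (LINT \<omega>|M. Re (\<Sum>i<m. (J \<omega> ^\<^sub>m n) $$ (i, i)))"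

definition capacity :: "'a measure \<Rightarrow> nat \<Rightarrow> ('a \<Rightarrow> complex mat) \<Rightarrow> real \<Rightarrow> real" where
  "capacity M m J \<rho> =
     (LINT \<omega>|M. ln (Re (Determinant.det (1\<^sub>m m + complex_of_real \<rho> \<cdot>\<^sub>m J \<omega>))))"

definition jacobi_const :: "nat \<Rightarrow> nat \<Rightarrow> nat \<Rightarrow> real" where
  "jacobi_const r s m = (LINT y|lebesgue_pi m. jacobi_weight r s m y)"

definition capacity_infinity :: "nat \<Rightarrow> nat \<Rightarrow> nat \<Rightarrow> real \<Rightarrow> real" where
  "capacity_infinity m p d \<rho> =
     (let r = p - m; s = d - p - m in
      1 / jacobi_const r s m * (LINT y|lebesgue_pi m. (\<Sum>i<m. ln (1 + \<rho> * y i)) * jacobi_weight r s m y))"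

definition V_coeff :: "nat \<Rightarrow> nat \<Rightarrow> nat \<Rightarrow> nat \<Rightarrow> nat \<Rightarrow> real" where
  "V_coeff r s m a b =
     real (r + s + 2 * b + 2 * m - 1) * Gamma (real (b + 2 * m + r + s)) * Gamma (real (a + m))
       * Gamma (real (r + a + m)) * Gamma (real (b + m + s))
     / (fact (a - b) * fact (b - 1) * Gamma (real (r + s + a + b + 2 * m)) * Gamma (real (r + b + m)))"

definition U_coeff :: "nat \<Rightarrow> nat \<Rightarrow> nat \<Rightarrow> nat \<Rightarrow> nat \<Rightarrow> real" where
  "U_coeff r s m a b =
     (2 * real m + real r + real s + 1 - 2 * real b) * Gamma (real r + real m - real b + 1)
       * Gamma (real r + real s + 2 * real m - real a - real b + 1)
     / (fact (a - b) * fact (b - 1) * Gamma (real m - real a + 1) * Gamma (real r + real m - real a + 1)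
        * Gamma (real m + real s - real b + 1) * Gamma (2 * real m + real r + real s - real b + 1))"

end

(* Write the power sum times the Vandermonde determinant as a sum of alternants of Jacobi
   polynomials: multiplying one row of the staircase alternant by x^n and expanding it in Jacobi
   polynomials replaces one degree m - 1 - i of the staircase by some k. Only k = m - 1 - i and
   k >= m survive, and the latter alternants belong to hooks. By the orthogonality of alternants,
   the n-th moment of the density is therefore a finite sum over hooks, whose stationary part is
   the diagonal part. The value of the multivariate Jacobi polynomial at (1, ..., 1) is a Vandermonde
   product in the eigenvalues k (k + r + s + 1), so the ratio of two such values is a Lagrange basis
   polynomial; the connection coefficients follow from the Chu-Vandermonde identity. The density is
   nonnegative almost everywhere, because its integral and that of its positive part are both 1.
   The capacity is obtained from the moments by expanding the logarithm, where the alternating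
   partial sums are bounded by 1, which covers the endpoint rho = 1. *)
theory Submission
  imports Defs
begin

section \<open>Alternants\<close>

text \<open>The connection coefficient of row i is kept as a sum over the powers u^(m-1-h) in the
  polynomial of degree m-1-i, because each summand is a product of factorials. Such a power belongs
  to the hook \<alpha> = (n-h, 1^h), while the new degree m+b in row i belongs to \<tau> = (b+1,
  1^i). Containment of \<tau> in \<alpha> is then a matter of degrees: the power occurs only for i
  \<le> h, and the moment of u^(n+m-1-h) against degree m+b vanishes unless b < n-h. For m \<ge> 2
  the Vandermonde product vanishes at (1, ..., 1), so the value there is a limit. A quotient made of
  divided differences, continuous at coinciding nodes, provides it. Polynomials are normalised at u
  = 1 because their normalisation cancels from each term of the density. Nonnegativity of the
  density is an issue because the law is given through \<open>ennreal\<close>, which replaces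
  negative values by 0.\<close>

definition alternant :: "nat \<Rightarrow> (nat \<Rightarrow> 'a \<Rightarrow> real) \<Rightarrow> (nat \<Rightarrow> 'a) \<Rightarrow> real" where
  "alternant m F y = (\<Sum>p | p permutes {..<m}. of_int (sign p) * (\<Prod>j<m. F (p j) (y j)))"

lemma sign_permutes_comp:
  "p permutes {..<m} \<Longrightarrow> q permutes {..<m::nat} \<Longrightarrow> sign (p \<circ> q) = sign p * sign q"
  by (intro sign_compose) (auto intro: permutes_imp_permutation)

lemma det_eq_alternant: "Determinant.det (mat m m (\<lambda>(i, j). F i (y j))) = alternant m F y"
proof -
  have "Determinant.det (mat m m (\<lambda>(i, j). F i (y j))) = Determinant.det (mat m m (\<lambda>(j, i). F i (y j)))"
    by (subst det_transpose[symmetric, of _ m], simp, rule arg_cong[of _ _ Determinant.det], rule eq_matI) auto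
  also have "\<dots> = alternant m F y"
    unfolding alternant_def
    by (subst det_def'[of _ m], simp, unfold lessThan_atLeast0, intro sum.cong refl arg_cong2[of _ _ _ _ "(*)"] prod.cong)
      (auto dest: permutes_in_image)
  finally show ?thesis .
qed

lemma alternant_cong:
  assumes "\<And>i j. i < m \<Longrightarrow> j < m \<Longrightarrow> F i (y j) = G i (z j)"
  shows "alternant m F y = alternant m G z"
  unfolding alternant_def
  by (intro sum.cong refl arg_cong2[of _ _ _ _ "(*)"] prod.cong assms) (auto dest: permutes_in_image)

lemma alternant_permute_rows:
  assumes p: "p permutes {..<m}"
  shows "alternant m (\<lambda>i. F (p i)) y = of_int (sign p) * alternant m F y"
proof -
  have "of_int (sign p) * alternant m F y
      = (\<Sum>q | q permutes {..<m}. of_int (sign p) * (of_int (sign (p \<circ> q)) * (\<Prod>j<m. F ((p \<circ> q) j) (y j))))"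
    unfolding alternant_def sum_distrib_left
  proof (rule sum.reindex_bij_witness[of _ "\<lambda>q. p \<circ> q" "\<lambda>q. inv_into UNIV p \<circ> q"])
    fix q assume "q \<in> {q. q permutes {..<m}}"
    then show "inv_into UNIV p \<circ> q \<in> {q. q permutes {..<m}}" "p \<circ> q \<in> {q. q permutes {..<m}}"
      using permutes_compose p permutes_inv[OF p] by blast+
  qed (simp_all add: o_assoc permutes_inv_o[OF p] permutes_inverses[OF p])
  also have "\<dots> = alternant m (\<lambda>i. F (p i)) y"
    unfolding alternant_def
    by (intro sum.cong refl) (simp add: sign_permutes_comp[OF p] flip: of_int_mult mult.assoc)
  finally show ?thesis ..
qed

lemma alternant_permute_args:
  assumes p: "p permutes {..<m}"
  shows "alternant m F (\<lambda>i. y (p i)) = of_int (sign p) * alternant m F y"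
proof -
  have "alternant m F (\<lambda>i. y (p i))
      = (\<Sum>q | q permutes {..<m}. of_int (sign (q \<circ> p)) * (\<Prod>j<m. F ((q \<circ> p) j) (y (p j))))"
    unfolding alternant_def by (rule sum_permutations_compose_right[OF p])
  also have "\<dots> = (\<Sum>q | q permutes {..<m}. of_int (sign p) * (of_int (sign q) * (\<Prod>j<m. F (q j) (y j))))"
  proof (intro sum.cong refl)
    fix q assume "q \<in> {q. q permutes {..<m}}"
    moreover have "(\<Prod>j<m. F ((q \<circ> p) j) (y (p j))) = (\<Prod>j<m. F (q j) (y j))"
      using prod.permute[OF p, of "\<lambda>j. F (q j) (y j)"] by (simp add: o_def)
    ultimately show "of_int (sign (q \<circ> p)) * (\<Prod>j<m. F ((q \<circ> p) j) (y (p j)))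
        = of_int (sign p) * (of_int (sign q) * (\<Prod>j<m. F (q j) (y j)))"
      by (simp add: sign_permutes_comp[OF _ p])
  qed
  finally show ?thesis by (simp add: alternant_def sum_distrib_left)
qed

lemma alternant_scale_rows: "alternant m (\<lambda>i x. c i * F i x) y = (\<Prod>i<m. c i) * alternant m F y"
proof -
  have "(\<Prod>j<m. c (p j)) = (\<Prod>i<m. c i)" if "p permutes {..<m}" for p
    using prod.permute[OF that, of c] by (simp add: o_def)
  then show ?thesis
    unfolding alternant_def sum_distrib_left
    by (intro sum.cong refl) (simp add: prod.distrib mult_ac)
qed

text \<open>A permutation sends exactly one index to row i, namely \<open>inv_into UNIV p i\<close>.
  Isolating its factor shows that every product is linear in row i.\<close>

lemma prod_row_upd:
  fixes m :: nat and F :: "nat \<Rightarrow> 'a \<Rightarrow> real"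
  assumes p: "p permutes {..<m}" and i: "i < m"
  shows "(\<Prod>j<m. (F(i := f)) (p j) (y j))
    = f (y (inv_into UNIV p i)) * (\<Prod>j\<in>{..<m} - {inv_into UNIV p i}. F (p j) (y j))"
proof -
  have k: "inv_into UNIV p i \<in> {..<m}" "p (inv_into UNIV p i) = i"
    using p i by (auto simp: permutes_inverses dest: permutes_in_image[OF permutes_inv])
  have ne: "p j \<noteq> i" if "j \<in> {..<m} - {inv_into UNIV p i}" for j
    using p that by (auto simp: permutes_inverses)
  show ?thesis
    unfolding prod.remove[OF finite_lessThan k(1), of "\<lambda>j. (F(i := f)) (p j) (y j)"]
    by (intro arg_cong2[of _ _ _ _ "(*)"] prod.cong refl; use k ne in simp)
qed

lemma alternant_row_sum:
  assumes i: "i < m"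
  shows "alternant m (F(i := (\<lambda>x. \<Sum>k\<in>K. c k * f k x))) y = (\<Sum>k\<in>K. c k * alternant m (F(i := f k)) y)"
  unfolding alternant_def sum_distrib_left
  by (subst sum.swap, intro sum.cong refl, subst (1 2) prod_row_upd)
    (use i in \<open>auto simp: sum_distrib_left sum_distrib_right mult_ac\<close>)

text \<open>In the product of a fixed permutation p the index j meets only row \<open>p j\<close>.
  Summing \<open>g (y j)\<close> over j therefore amounts to multiplying one row at a time by
  g.\<close>

lemma alternant_mult_power_sum:
  "(\<Sum>j<m. g (y j)) * alternant m F y = (\<Sum>i<m. alternant m (F(i := (\<lambda>x. g x * F i x))) y)"
proof -
  have "(\<Sum>j<m. g (y j)) * (\<Prod>j<m. F (p j) (y j)) = (\<Sum>i<m. \<Prod>j<m. (F(i := (\<lambda>x. g x * F i x))) (p j) (y j))"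
    if p: "p permutes {..<m}" for p
  proof -
    have "(\<Prod>j<m. (F(i := (\<lambda>x. g x * F i x))) (p j) (y j)) = g (y (inv_into UNIV p i)) * (\<Prod>j<m. F (p j) (y j))"
      if "i < m" for i
    proof -
      have "inv_into UNIV p i \<in> {..<m}" using permutes_in_image[OF permutes_inv[OF p], of i] that by simp
      then show ?thesis unfolding prod_row_upd[OF p that]
        by (subst (2) prod.remove[of _ "inv_into UNIV p i"]) (simp_all add: permutes_inverses[OF p])
    qed
    moreover have "(\<Sum>i<m. g (y (inv_into UNIV p i))) = (\<Sum>j<m. g (y j))"
      using sum.permute[OF permutes_inv[OF p], of "\<lambda>j. g (y j)"] by (simp add: o_def)
    ultimately show ?thesis by (simp flip: sum_distrib_right)
  qed
  then show ?thesis
    unfolding alternant_def sum_distrib_left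
    by (subst sum.swap) (simp add: mult.left_commute flip: sum_distrib_left)
qed

text \<open>Swapping the two rows fixes the alternant and negates it. This discards a replaced row
  whose new degree already occurs in another row.\<close>

lemma alternant_eq_rows:
  assumes "i < m" "j < m" "i \<noteq> j" "F i = F j"
  shows "alternant m F y = 0"
proof -
  have p: "Transposition.transpose i j permutes {..<m}" using assms by (intro permutes_swap_id) auto
  have "(\<lambda>k. F (Transposition.transpose i j k)) = F"
    using assms by (auto simp: Transposition.transpose_def)
  then show ?thesis using alternant_permute_rows[OF p, of F y] assms by (simp add: sign_swap_id)
qed

lemma alternant_eq_args:
  assumes "i < m" "j < m" "i \<noteq> j" "y i = y j"
  shows "alternant m F y = 0"
proof -
  have p: "Transposition.transpose i j permutes {..<m}" using assms by (intro permutes_swap_id) auto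
  have "(\<lambda>k. y (Transposition.transpose i j k)) = y"
    using assms by (auto simp: Transposition.transpose_def)
  then show ?thesis using alternant_permute_args[OF p, of F y] assms by (simp add: sign_swap_id)
qed

text \<open>Divided differences by repeated synthetic division: unlike the quotient formula, this is
  continuous in the nodes, also where they coincide.\<close>

primrec newton_quot :: "real poly \<Rightarrow> (nat \<Rightarrow> real) \<Rightarrow> nat \<Rightarrow> real poly" where
  "newton_quot p x 0 = p"
| "newton_quot p x (Suc l) = synthetic_div (newton_quot p x l) (x l)"

definition divided_diff :: "real poly \<Rightarrow> (nat \<Rightarrow> real) \<Rightarrow> nat \<Rightarrow> real" where
  "divided_diff p x l = poly (newton_quot p x l) (x l)"

text \<open>Iterated division with remainder. The last quotient is kept, so the identity holds for
  arbitrary, possibly coinciding, nodes.\<close>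

lemma newton_interpolation:
  "poly p z = (\<Sum>l<n. divided_diff p x l * (\<Prod>a<l. z - x a)) + (\<Prod>a<n. z - x a) * poly (newton_quot p x n) z"
proof (induction n)
  case (Suc n)
  have "poly (newton_quot p x n) z
      = poly ([:- x n, 1:] * synthetic_div (newton_quot p x n) (x n) + [:poly (newton_quot p x n) (x n):]) z"
    by (simp only: synthetic_div_correct')
  also have "\<dots> = (z - x n) * poly (newton_quot p x (Suc n)) z + divided_diff p x n"
    by (simp add: divided_diff_def algebra_simps)
  finally have "poly (newton_quot p x n) z = (z - x n) * poly (newton_quot p x (Suc n)) z + divided_diff p x n" .
  with Suc show ?case by (simp add: algebra_simps del: newton_quot.simps)
qed simp

text \<open>The matrix of values is the matrix of divided differences times a triangular matrix
  whose diagonal product is the Vandermonde product. The quotient of the two is thus a determinant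
  that stays meaningful when nodes coincide.\<close>

theorem alternant_newton:
  "alternant m (\<lambda>i. poly (p i)) x
    = Determinant.det (mat m m (\<lambda>(i, l). divided_diff (p i) x l)) * (\<Prod>j<m. \<Prod>a<j. x j - x a)"
proof -
  define D where "D = mat m m (\<lambda>(i, l). divided_diff (p i) x l)"
  define T where "T = mat m m (\<lambda>(l, j). \<Prod>a<l. x j - x a)"
  have D: "D \<in> carrier_mat m m" and T: "T \<in> carrier_mat m m" by (auto simp: D_def T_def)
  have uT: "upper_triangular T"
    by (rule upper_triangularI) (auto simp: T_def)
  \<comment> \<open>Newton interpolation: \<open>T\<close> evaluates the Newton basis at the nodes.\<close>
  have "mat m m (\<lambda>(i, j). poly (p i) (x j)) = D * T"
  proof (rule eq_matI)
    fix i j assume "i < dim_row (D * T)" "j < dim_col (D * T)"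
    then have ij: "i < m" "j < m" by (auto simp: D_def T_def)
    \<comment> \<open>Each node is among the first m, so the remainder after m divisions vanishes
      there.\<close>
    have z: "(\<Prod>a<m. x j - x a) = 0" using ij by auto
    show "mat m m (\<lambda>(i, j). poly (p i) (x j)) $$ (i, j) = (D * T) $$ (i, j)"
      using ij newton_interpolation[where p = "p i" and z = "x j" and n = m and x = x] z
      by (simp add: D_def T_def scalar_prod_def lessThan_atLeast0)
  qed (auto simp: D_def T_def)
  then have "alternant m (\<lambda>i. poly (p i)) x = Determinant.det D * Determinant.det T"
    using det_mult[OF D T] by (simp add: det_eq_alternant[symmetric])
  also have "Determinant.det T = (\<Prod>j<m. \<Prod>a<j. x j - x a)"
    unfolding det_upper_triangular[OF uT T]
    by (simp add: diag_mat_def T_def prod.list_conv_set_nth lessThan_atLeast0)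
  finally show ?thesis by (simp add: D_def)
qed

section \<open>Divided differences of monic polynomials and at coinciding nodes\<close>

lemma coeff_synthetic_div:
  "coeff (synthetic_div p c) n = coeff p (Suc n) + c * coeff (synthetic_div p c) (Suc n)"
  using arg_cong[OF synthetic_div_correct[of p c], of "\<lambda>q. coeff q (Suc n)"] by simp

lemma degree_newton_quot: "degree (newton_quot p x l) = degree p - l"
  by (induction l) (auto simp: degree_synthetic_div)

lemma newton_quot_monic:
  assumes "lead_coeff p = 1"
  shows "l \<le> degree p \<Longrightarrow> lead_coeff (newton_quot p x l) = 1"
proof (induction l)
  case (Suc l)
  have "coeff (newton_quot p x (Suc l)) (degree p - Suc l)
      = coeff (newton_quot p x l) (degree p - l) + x l * coeff (newton_quot p x (Suc l)) (degree p - l)"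
    using coeff_synthetic_div[of "newton_quot p x l" "x l" "degree p - Suc l"] Suc.prems by (simp add: Suc_diff_Suc)
  also have "coeff (newton_quot p x (Suc l)) (degree p - l) = 0"
    by (rule coeff_eq_0) (use Suc.prems in \<open>simp add: degree_newton_quot degree_synthetic_div\<close>)
  finally show ?case using Suc by (simp only: degree_newton_quot Suc_leD)
qed (use assms in simp)

text \<open>After \<open>degree p\<close> divisions a monic polynomial has become the constant 1,
  and one further division leaves 0.\<close>

lemma divided_diff_degree:
  assumes "lead_coeff p = 1"
  shows "divided_diff p x (degree p) = 1"
    and "l > degree p \<Longrightarrow> divided_diff p x l = 0"
proof -
  obtain a where a: "newton_quot p x (degree p) = [:a:]"
    using degree_newton_quot[of p x "degree p"] by (auto elim: degree_eq_zeroE)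
  have 1: "a = 1" using newton_quot_monic[OF assms order.refl, of x] a by simp
  show "divided_diff p x (degree p) = 1" by (simp add: divided_diff_def a 1)
  have "newton_quot p x (Suc (degree p) + k) = 0" for k
    by (induction k) (auto simp: a synthetic_div_pCons)
  then show "divided_diff p x l = 0" if "l > degree p"
    using that unfolding divided_diff_def by (metis less_eqE Suc_leI poly_0)
qed

text \<open>The matrix of divided differences is triangular with unit diagonal, so the lower
  coefficients do not contribute. It is applied both in the variable 1 - u and in the
  eigenvalue.\<close>

theorem alternant_monic:
  assumes "\<And>i. i < m \<Longrightarrow> lead_coeff (p i) = 1" "\<And>i. i < m \<Longrightarrow> degree (p i) = i"
  shows "alternant m (\<lambda>i. poly (p i)) x = (\<Prod>j<m. \<Prod>a<j. x j - x a)"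
proof -
  define D where "D = mat m m (\<lambda>(i, l). divided_diff (p i) x l)"
  have D: "D \<in> carrier_mat m m" by (simp add: D_def)
  have "Determinant.det D = prod_list (diag_mat D)"
    by (rule det_lower_triangular[OF _ D]) (use assms divided_diff_degree(2) in \<open>auto simp: D_def\<close>)
  also have "\<dots> = (\<Prod>i<m. divided_diff (p i) x i)"
    by (simp add: D_def diag_mat_def prod.list_conv_set_nth lessThan_atLeast0)
  also have "\<dots> = 1"
  proof (rule prod.neutral, safe)
    fix i assume "i < m"
    then show "divided_diff (p i) x i = 1" using assms[of i] divided_diff_degree(1)[of "p i" x] by simp
  qed
  finally show ?thesis by (simp add: alternant_newton D_def)
qed

text \<open>Convergence is proved for the coefficients of all intermediate quotients. Division
  computes coefficient n from coefficient n + 1, so the inner induction descends from the degree,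
  above which the coefficients vanish.\<close>

lemma tendsto_divided_diff:
  assumes x: "\<And>l. ((\<lambda>\<omega>. x \<omega> l) \<longlongrightarrow> x0 l) F"
  shows "((\<lambda>\<omega>. divided_diff p (x \<omega>) l) \<longlongrightarrow> divided_diff p x0 l) F"
proof -
  define N where "N = degree p"
  have z: "coeff (newton_quot p y l) n = 0" if "n > N" for y l n
    by (rule coeff_eq_0) (use that in \<open>simp add: degree_newton_quot N_def\<close>)
  have rec: "coeff (newton_quot p y (Suc l)) n
      = coeff (newton_quot p y l) (Suc n) + y l * coeff (newton_quot p y (Suc l)) (Suc n)" for y l n
    by (simp only: newton_quot.simps) (rule coeff_synthetic_div)
  have C: "((\<lambda>\<omega>. coeff (newton_quot p (x \<omega>) l) n) \<longlongrightarrow> coeff (newton_quot p x0 l) n) F" for l n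
  proof (induction l arbitrary: n)
    case (Suc l)
    note IH = Suc
    have "((\<lambda>\<omega>. coeff (newton_quot p (x \<omega>) (Suc l)) (N - k)) \<longlongrightarrow> coeff (newton_quot p x0 (Suc l)) (N - k)) F" for k
    proof (induction k)
      case 0
      have "coeff (newton_quot p y (Suc l)) (N - 0) = coeff (newton_quot p y l) (Suc N)" for y
        unfolding rec[of y l "N - 0"] by (simp add: z del: newton_quot.simps)
      then show ?case using IH[of "Suc N"] by (simp del: newton_quot.simps)
    next
      case (Suc k)
      show ?case
      proof (cases "k < N")
        case True
        have "((\<lambda>\<omega>. coeff (newton_quot p (x \<omega>) l) (N - k) + x \<omega> l * coeff (newton_quot p (x \<omega>) (Suc l)) (N - k))
            \<longlongrightarrow> coeff (newton_quot p x0 l) (N - k) + x0 l * coeff (newton_quot p x0 (Suc l)) (N - k)) F"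
          by (intro tendsto_intros Suc IH x)
        then show ?thesis
          unfolding rec[of _ l "N - Suc k"] using True by (simp add: Suc_diff_Suc del: newton_quot.simps)
      qed (use Suc in \<open>simp del: newton_quot.simps\<close>)
    qed
    from this[of "N - n"] show ?case using z[of n] by (cases "n \<le> N") (auto simp del: newton_quot.simps)
  qed simp
  have "poly (newton_quot p y l) c = (\<Sum>i\<le>N. coeff (newton_quot p y l) i * c ^ i)" for y c
    unfolding poly_altdef
    by (rule sum.mono_neutral_left) (auto simp: degree_newton_quot N_def coeff_eq_0)
  then show ?thesis unfolding divided_diff_def by (auto intro!: tendsto_intros C x)
qed

text \<open>Synthetic division at 0 shifts the coefficients. In the variable 1 - u the zero nodes
  are the point (1, ..., 1).\<close>

lemma divided_diff_0: "divided_diff p (\<lambda>_. 0) l = coeff p l"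
proof -
  have "coeff (synthetic_div q 0) n = coeff q (Suc n)" for q :: "real poly" and n
    by (subst coeff_synthetic_div) (simp only: mult_zero_left add_0_right)
  then have "coeff (newton_quot p (\<lambda>_. 0) l) n = coeff p (n + l)" for n
    by (induction l arbitrary: n) simp_all
  then show ?thesis by (simp add: divided_diff_def poly_0_coeff_0)
qed

section \<open>Jacobi polynomials normalised at 1\<close>

text \<open>\<open>ujac\<close> is the Jacobi polynomial divided by its value at 1. Its expansion in powers of
  \<open>1 - u\<close>, integrated against \<open>u ^ N\<close>, gives a Chu-Vandermonde sum; \<open>ujac_coeff0\<close> are the
  coefficients in powers of \<open>u\<close>.\<close>

definition ujac_coeff :: "nat \<Rightarrow> nat \<Rightarrow> nat \<Rightarrow> nat \<Rightarrow> real" where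
  "ujac_coeff r s k j = pochhammer (- real k) j * pochhammer (real (k + r + s + 1)) j
     / (pochhammer (real s + 1) j * fact j)"

definition ujac :: "nat \<Rightarrow> nat \<Rightarrow> nat \<Rightarrow> real \<Rightarrow> real" where
  "ujac r s k u = (\<Sum>j\<le>k. ujac_coeff r s k j * (1 - u) ^ j)"

definition ujac_coeff0 :: "nat \<Rightarrow> nat \<Rightarrow> nat \<Rightarrow> nat \<Rightarrow> real" where
  "ujac_coeff0 r s k i = (-1) ^ k * pochhammer (real r + 1) k / pochhammer (real s + 1) k
     * (pochhammer (- real k) i * pochhammer (real (k + r + s + 1)) i / (pochhammer (real r + 1) i * fact i))"

definition jacobi_at_1 :: "nat \<Rightarrow> nat \<Rightarrow> real" where
  "jacobi_at_1 s k = (-1) ^ k * pochhammer (real s + 1) k / fact k"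

text \<open>The interval is open to match the strict inequalities in \<open>jacobi_weight\<close>;
  \<open>jacobi_norm_sq\<close> integrates over the closed interval, which differs by a null
  set.\<close>

definition jacobi_w :: "nat \<Rightarrow> nat \<Rightarrow> real \<Rightarrow> real" where
  "jacobi_w r s u = indicator {0<..<1} u * (u ^ r * (1 - u) ^ s)"

text \<open>The classical squared norm of the Jacobi polynomial divided by the square of its value
  at 1; for integer r and s all Gamma factors are factorials.\<close>

definition ujac_norm_sq :: "nat \<Rightarrow> nat \<Rightarrow> nat \<Rightarrow> real" where
  "ujac_norm_sq r s k = (fact s)\<^sup>2 * fact k * fact (k + r)
     / (real (2 * k + r + s + 1) * fact (k + r + s) * fact (k + s))"

lemma pochhammer_real_fact: "pochhammer (real n + 1) j = fact (n + j) / fact n"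
  using pochhammer_product'[of "1::real" n j] by (simp add: pochhammer_fact[symmetric] add.commute)

lemma ujac_coeff_eq_0: "k < j \<Longrightarrow> ujac_coeff r s k j = 0"
  by (simp add: ujac_coeff_def pochhammer_of_nat_eq_0_lemma)

text \<open>This collects the coefficient of u^i after the powers of 1 - u are expanded. Once the
  factors free of l are taken out, the sum over l is a terminating hypergeometric sum at 1.\<close>

lemma sum_choose_ujac_coeff:
  assumes "i \<le> k"
  shows "(\<Sum>l\<le>k - i. ujac_coeff r s k (i + l) * real ((i + l) choose i) * (-1) ^ i) = ujac_coeff0 r s k i"
proof -
  let ?c = "real (k + r + s + 1)" and ?n = "k - i"
  have nz: "pochhammer (real s + 1) n \<noteq> 0" "pochhammer (real s + 1 + real i) n \<noteq> 0"
    "pochhammer (real r + 1) n \<noteq> 0" "pochhammer (real r + 1 + real i) n \<noteq> 0" for n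
    by (auto simp: pochhammer_eq_0_iff)
  have t: "ujac_coeff r s k (i + l) * real ((i + l) choose i) * (-1) ^ i
     = (-1) ^ i * pochhammer (- real k) i * pochhammer ?c i / (pochhammer (real s + 1) i * fact i)
       * (pochhammer (?c + real i) l * pochhammer (- real ?n) l / (fact l * pochhammer (real s + 1 + real i) l))"
    for l
    using assms nz unfolding ujac_coeff_def
    by (simp add: pochhammer_product' binomial_fact of_nat_diff field_simps)
  have v: "(\<Sum>l\<in>{0..?n}. pochhammer (?c + real i) l * pochhammer (- real ?n) l
        / (fact l * pochhammer (real s + 1 + real i) l))
      = pochhammer (real s + 1 + real i - (?c + real i)) ?n / pochhammer (real s + 1 + real i) ?n"
    using Vandermonde_pochhammer[of ?n "real s + 1 + real i" "?c + real i"] by (simp add: add_eq_0_iff)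
  \<comment> \<open>The base is the negative integer i - (k + r) - i = -(k + r). Reversing the
    product gives the sign and the new base r + 1 + i.\<close>
  have m: "pochhammer (real s + 1 + real i - (?c + real i)) ?n = (-1) ^ ?n * pochhammer (real r + 1 + real i) ?n"
    using pochhammer_minus[of "real (k + r)" ?n] assms by (simp add: of_nat_diff algebra_simps)
  have p: "pochhammer (real s + 1) k = pochhammer (real s + 1) i * pochhammer (real s + 1 + real i) ?n"
    "pochhammer (real r + 1) k = pochhammer (real r + 1) i * pochhammer (real r + 1 + real i) ?n"
    using pochhammer_product'[of "real s + 1" i ?n] pochhammer_product'[of "real r + 1" i ?n] assms by auto
  have "(\<Sum>l\<le>k - i. ujac_coeff r s k (i + l) * real ((i + l) choose i) * (-1) ^ i)
     = (-1) ^ i * pochhammer (- real k) i * pochhammer ?c i / (pochhammer (real s + 1) i * fact i)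
       * ((-1) ^ ?n * pochhammer (real r + 1 + real i) ?n / pochhammer (real s + 1 + real i) ?n)"
    unfolding t sum_distrib_left[symmetric] atMost_atLeast0 v m ..
  also have "\<dots> = ujac_coeff0 r s k i"
  proof -
    have "(-1) ^ k = (-1) ^ i * ((-1) ^ ?n :: real)" using assms by (simp flip: power_add)
    then show ?thesis using nz unfolding ujac_coeff0_def p by (simp add: field_simps)
  qed
  finally show ?thesis .
qed

lemma ujac_eq_coeff0: "ujac r s k u = (\<Sum>i\<le>k. ujac_coeff0 r s k i * u ^ i)"
proof -
  have "ujac r s k u = (\<Sum>j\<le>k. \<Sum>i\<le>j. ujac_coeff r s k j * (real (j choose i) * (-1) ^ i * u ^ i))"
    unfolding ujac_def
  proof (intro sum.cong refl)
    fix j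
    have "(1 - u) ^ j = (\<Sum>i\<le>j. real (j choose i) * (-u) ^ i * 1 ^ (j - i))"
      using binomial_ring[of "-u" 1 j] by (simp add: algebra_simps)
    then show "ujac_coeff r s k j * (1 - u) ^ j
        = (\<Sum>i\<le>j. ujac_coeff r s k j * (real (j choose i) * (-1) ^ i * u ^ i))"
      by (simp add: sum_distrib_left power_minus[of u] mult_ac)
  qed
  also have "\<dots> = (\<Sum>i\<le>k. \<Sum>l\<le>k - i. ujac_coeff r s k (i + l) * (real ((i + l) choose i) * (-1) ^ i * u ^ i))"
    unfolding sum.Sigma[OF finite_atMost ballI[OF finite_atMost]]
    by (rule sum.reindex_bij_witness[of _ "\<lambda>(i, l). (i + l, i)" "\<lambda>(j, i). (i, j - i)"]) auto
  also have "\<dots> = (\<Sum>i\<le>k. (\<Sum>l\<le>k - i. ujac_coeff r s k (i + l) * real ((i + l) choose i) * (-1) ^ i) * u ^ i)"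
    unfolding sum_distrib_right by (intro sum.cong refl) (simp only: mult_ac)
  also have "\<dots> = (\<Sum>i\<le>k. ujac_coeff0 r s k i * u ^ i)"
    by (intro sum.cong refl) (simp add: sum_choose_ujac_coeff)
  finally show ?thesis .
qed

text \<open>The passage from powers of 1 - u to powers of u is already contained in
  \<open>ujac_eq_coeff0\<close>. What remains is to cut off the hypergeometric series at j = k,
  where \<open>pochhammer (- real k) j\<close> starts to vanish.\<close>

lemma jacobi_eq_ujac: "jacobi r s k u = jacobi_at_1 s k * ujac r s k u"
proof -
  have "hyp2F1 (- real k) (real (k + r + s + 1)) (real (r + 1)) u
      = (\<Sum>j\<le>k. pochhammer (- real k) j * pochhammer (real (k + r + s + 1)) j / (pochhammer (real r + 1) j * fact j) * u ^ j)"
    unfolding hyp2F1_def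
    by (subst suminf_finite[of "{..k}"]) (auto simp: pochhammer_of_nat_eq_0_lemma add.commute)
  then have "jacobi r s k u = (\<Sum>j\<le>k. jacobi_at_1 s k * (ujac_coeff0 r s k j * u ^ j))"
    using pochhammer_eq_0_iff[of "real s + 1" k]
    by (auto simp: jacobi_def jacobi_at_1_def ujac_coeff0_def sum_distrib_left mult_ac intro!: sum.cong)
  then show ?thesis by (simp add: ujac_eq_coeff0 sum_distrib_left)
qed

lemma jacobi_at_1_nz: "jacobi_at_1 s k \<noteq> 0"
  by (auto simp: jacobi_at_1_def pochhammer_eq_0_iff)

lemma integrable_jacobi_w:
  assumes "continuous_on UNIV f"
  shows "integrable lborel (\<lambda>u. f u * jacobi_w r s u)"
proof -
  have "set_integrable lborel {0..1} (\<lambda>u. f u * (u ^ r * (1 - u) ^ s))"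
    by (intro borel_integrable_atLeastAtMost' continuous_intros continuous_on_subset[OF assms]) auto
  then have "set_integrable lborel {0<..<1} (\<lambda>u. f u * (u ^ r * (1 - u) ^ s))"
    by (rule set_integrable_subset) auto
  then show ?thesis unfolding set_integrable_def jacobi_w_def by (simp add: mult_ac)
qed

lemma integral_beta_nat:
  "(LINT u|lborel. indicator {0<..<1} u * (u ^ a * (1 - u) ^ b)) = fact a * fact b / (fact (a + b + 1) :: real)"
proof -
  have "((\<lambda>t. t powr (real (a + 1) - 1) * (1 - t) powr (real (b + 1) - 1)) has_integral Beta (real (a + 1)) (real (b + 1))) {0<..<1}"
    using has_integral_Beta_real[of "real (a + 1)" "real (b + 1)"] by (simp add: has_integral_Icc_iff_Ioo)
  then have h: "((\<lambda>t. t ^ a * (1 - t) ^ b) has_integral Beta (real (a + 1)) (real (b + 1))) {0<..<1}"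
    by (rule has_integral_eq[rotated]) (auto simp: powr_realpow)
  have "set_integrable lborel {0<..<1} (\<lambda>u::real. u ^ a * (1 - u) ^ b)"
    using integrable_jacobi_w[of "\<lambda>_. 1" a b] by (simp add: set_integrable_def jacobi_w_def)
  then have "(LINT u:{0<..<1}|lborel. u ^ a * (1 - u) ^ b) = Beta (real (a + 1)) (real (b + 1))"
    using h by (simp add: set_borel_integral_eq_integral integral_unique)
  also have "\<dots> = fact a * fact b / fact (a + b + 1)"
    using Gamma_fact[of a, where ?'a = real] Gamma_fact[of b, where ?'a = real] Gamma_fact[of "a + b + 1", where ?'a = real]
    by (simp add: Beta_def algebra_simps)
  finally show ?thesis by (simp add: set_lebesgue_integral_def)
qed

text \<open>A factor (1 - u)^j only shifts the Beta parameter s to s + j. This closed form is the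
  source of orthogonality and of all connection coefficients.\<close>

lemma integral_power_ujac:
  "(LINT u|lborel. u ^ N * ujac r s k u * jacobi_w r s u)
     = (if N < k then 0 else fact N * fact (N + r) * fact s / (fact (N - k) * fact (N + k + r + s + 1)))"
proof -
  let ?c = "real (k + r + s + 1)" and ?d = "real (N + r + s + 1) + 1"
  have e: "u ^ N * ujac r s k u * jacobi_w r s u
     = (\<Sum>j\<le>k. ujac_coeff r s k j * (indicator {0<..<1} u * (u ^ (N + r) * (1 - u) ^ (s + j))))" for u
    by (simp add: ujac_def jacobi_w_def sum_distrib_left sum_distrib_right power_add mult_ac)
  have i: "integrable lborel (\<lambda>u::real. indicator {0<..<1} u * (u ^ a * (1 - u) ^ b))" for a b
    using integrable_jacobi_w[of "\<lambda>_. 1" a b] by (simp add: jacobi_w_def)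
  have "(LINT u|lborel. u ^ N * ujac r s k u * jacobi_w r s u)
     = (\<Sum>j\<le>k. ujac_coeff r s k j * (fact (N + r) * fact (s + j) / fact (N + r + (s + j) + 1)))"
    unfolding e by (subst Bochner_Integration.integral_sum) (auto intro!: integrable_mult_right i simp: integral_beta_nat)
  also have "\<dots> = (\<Sum>j\<le>k. fact (N + r) * fact s / fact (N + r + s + 1)
      * (pochhammer ?c j * pochhammer (- real k) j / (fact j * pochhammer ?d j)))"
  proof (intro sum.cong refl)
    fix j
    have "N + r + (s + j) + 1 = N + r + s + 1 + j" by simp
    moreover have "(fact (N + r + s + 1) :: real) \<noteq> 0" "(fact (N + r + s + 1 + j) :: real) \<noteq> 0" by (rule fact_nonzero)+
    ultimately show "ujac_coeff r s k j * (fact (N + r) * fact (s + j) / fact (N + r + (s + j) + 1))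
      = fact (N + r) * fact s / fact (N + r + s + 1)
      * (pochhammer ?c j * pochhammer (- real k) j / (fact j * pochhammer ?d j))"
      by (simp only: ujac_coeff_def pochhammer_real_fact) (simp del: fact_Suc)
  qed
  also have "\<dots> = fact (N + r) * fact s / fact (N + r + s + 1) * (pochhammer (?d - ?c) k / pochhammer ?d k)"
    unfolding sum_distrib_left[symmetric] atMost_atLeast0
    using Vandermonde_pochhammer[of k ?d ?c] by (simp add: add_eq_0_iff)
  also have "?d - ?c = real N - real k + 1" by simp
  also have "pochhammer (real N - real k + 1) k = (if N < k then 0 else fact N / fact (N - k))"
  proof (cases "N < k")
    case True
    \<comment> \<open>The base is minus a natural number smaller than k, so one of the k factors is
      0.\<close>
    then have "real N - real k + 1 = - real (k - N - 1)" by (simp add: of_nat_diff)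
    moreover have "pochhammer (- real (k - N - 1)) k = 0"
      by (rule pochhammer_of_nat_eq_0_lemma) (use True in simp)
    ultimately show ?thesis using True by (simp only: if_True)
  next
    case False
    then show ?thesis using pochhammer_real_fact[of "N - k" k] by (simp add: of_nat_diff)
  qed
  finally show ?thesis unfolding pochhammer_real_fact by (simp add: add_ac)
qed

lemma continuous_ujac [continuous_intros]: "continuous_on A f \<Longrightarrow> continuous_on A (\<lambda>x. ujac r s k (f x))"
  unfolding ujac_def by (intro continuous_intros)

lemma integral_power_ujac_ujac:
  "(LINT u|lborel. u ^ n * ujac r s j u * ujac r s k u * jacobi_w r s u)
     = (\<Sum>i\<le>j. ujac_coeff0 r s j i * (LINT u|lborel. u ^ (n + i) * ujac r s k u * jacobi_w r s u))"
proof -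
  have e: "u ^ n * ujac r s j u * ujac r s k u * jacobi_w r s u
     = (\<Sum>i\<le>j. ujac_coeff0 r s j i * (u ^ (n + i) * ujac r s k u * jacobi_w r s u))" for u
    by (simp add: ujac_eq_coeff0[of r s j] sum_distrib_left sum_distrib_right power_add mult_ac)
  show ?thesis unfolding e
    by (subst Bochner_Integration.integral_sum) (auto intro!: integrable_mult_right integrable_jacobi_w continuous_intros)
qed

lemma ujac_coeff0_lead: "ujac_coeff0 r s k k = fact (2 * k + r + s) * fact s / (fact (k + r + s) * fact (s + k))"
proof -
  have "pochhammer (real r + 1) k \<noteq> 0" by (simp add: pochhammer_real_fact)
  moreover have "pochhammer (real (k + r + s + 1)) k = fact (2 * k + r + s) / fact (k + r + s)"
    using pochhammer_real_fact[of "k + r + s" k] by (simp add: add_ac mult_2)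
  moreover have sgn: "(-1) ^ k * (x * ((-1) ^ k * y)) = y * x" for x y :: real
    using power_add[of "-1::real" k k] by (simp add: mult.left_commute[of x] flip: mult.assoc)
  ultimately show ?thesis
    unfolding ujac_coeff0_def pochhammer_real_fact[of s] pochhammer_same
    by (simp add: add_ac sgn)
qed

text \<open>One factor is expanded in powers of u: for j < k all moments vanish, and for j = k only
  the leading power survives. The case j > k follows by symmetry.\<close>

lemma ujac_orthogonal:
  "(LINT u|lborel. ujac r s j u * ujac r s k u * jacobi_w r s u) = (if j = k then ujac_norm_sq r s k else 0)"
proof -
  have exp: "(LINT u|lborel. ujac r s j u * ujac r s k u * jacobi_w r s u)
      = (\<Sum>i\<le>j. ujac_coeff0 r s j i * (LINT u|lborel. u ^ i * ujac r s k u * jacobi_w r s u))" for j k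
    using integral_power_ujac_ujac[of 0 r s j k] by (simp only: power_0 mult_1 add_0)
  have 1: "(LINT u|lborel. ujac r s j u * ujac r s k u * jacobi_w r s u) = 0" if "j < k" for j k
    unfolding exp by (rule sum.neutral) (use that in \<open>simp add: integral_power_ujac\<close>)
  have "(LINT u|lborel. ujac r s k u * ujac r s k u * jacobi_w r s u)
      = (\<Sum>i\<le>k. ujac_coeff0 r s k i * (LINT u|lborel. u ^ i * ujac r s k u * jacobi_w r s u))"
    by (rule exp)
  also have "\<dots> = (\<Sum>i\<in>{k}. ujac_coeff0 r s k i * (LINT u|lborel. u ^ i * ujac r s k u * jacobi_w r s u))"
    by (rule sum.mono_neutral_right) (auto simp: integral_power_ujac)
  also have "\<dots> = ujac_norm_sq r s k"
  proof -
    have F: "fact (k + k + r + s + 1) = real (2 * k + r + s + 1) * fact (2 * k + r + s)"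
    proof -
      have "k + k + r + s + 1 = Suc (2 * k + r + s)" by simp
      then show ?thesis by (simp only: fact_Suc) (simp only: Suc_eq_plus1)
    qed
    have "A * x / (B * C) * (D * E * x / (n * A)) = x\<^sup>2 * D * E / (n * B * C)"
      if "A \<noteq> 0" for A B C D E n x :: real
      using that by (simp add: power2_eq_square mult_ac)
    from this[OF fact_nonzero, of "2 * k + r + s" "fact s" "fact (k + r + s)" "fact (s + k)" "fact k" "fact (k + r)" "real (2 * k + r + s + 1)"]
    show ?thesis unfolding ujac_norm_sq_def F[symmetric]
      by (simp only: integral_power_ujac ujac_coeff0_lead add.commute[of k s] sum.insert sum.empty finite.emptyI
        empty_iff not_False_eq_True less_irrefl if_False diff_self_eq_0 fact_0 mult_1 add_0_right)
  qed
  finally have 2: "(LINT u|lborel. ujac r s k u * ujac r s k u * jacobi_w r s u) = ujac_norm_sq r s k" .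
  have "(LINT u|lborel. ujac r s j u * ujac r s k u * jacobi_w r s u)
      = (LINT u|lborel. ujac r s k u * ujac r s j u * jacobi_w r s u)"
    by (rule Bochner_Integration.integral_cong) auto
  then show ?thesis
    using 1[of j k] 1[of k j] 2 by (cases j k rule: linorder_cases) simp_all
qed

lemma ujac_norm_sq_pos: "ujac_norm_sq r s k > 0"
  unfolding ujac_norm_sq_def by (intro divide_pos_pos mult_pos_pos) auto

lemma jacobi_norm_sq_eq: "jacobi_norm_sq r s k = (jacobi_at_1 s k)\<^sup>2 * ujac_norm_sq r s k"
proof -
  have "jacobi_norm_sq r s k = (LINT u|lborel. (jacobi_at_1 s k)\<^sup>2 * (ujac r s k u * ujac r s k u * jacobi_w r s u))"
    unfolding jacobi_norm_sq_def set_lebesgue_integral_def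
  proof (rule integral_cong_AE)
    have "AE u in lborel. u \<noteq> (0::real) \<and> u \<noteq> 1"
      using AE_lborel_singleton[of "0::real"] AE_lborel_singleton[of "1::real"] by eventually_elim simp
    then show "AE u in lborel. indicat_real {0..1} u *\<^sub>R ((jacobi r s k u)\<^sup>2 * (u ^ r * (1 - u) ^ s))
        = (jacobi_at_1 s k)\<^sup>2 * (ujac r s k u * ujac r s k u * jacobi_w r s u)"
      by eventually_elim (auto simp: jacobi_eq_ujac jacobi_w_def power2_eq_square indicator_def mult_ac)
  qed (simp_all add: jacobi_eq_ujac ujac_def jacobi_w_def)
  then show ?thesis by (simp add: ujac_orthogonal)
qed

text \<open>The leading coefficient of \<open>ujac r s N\<close> is nonzero, so u^N can be solved
  for, and the lower powers are expanded by induction.\<close>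

lemma power_ujac_span: "\<exists>c. \<forall>u. u ^ N = (\<Sum>k\<le>N. c k * ujac r s k u)"
proof (induction N rule: less_induct)
  case (less N)
  then have "\<forall>i. \<exists>c. i < N \<longrightarrow> (\<forall>u. u ^ i = (\<Sum>k\<le>i. c k * ujac r s k u))" by blast
  then obtain c where c: "\<And>i u. i < N \<Longrightarrow> u ^ i = (\<Sum>k\<le>i. c i k * ujac r s k u)" by metis
  let ?a = "ujac_coeff0 r s N"
  define b where "b k = ((if k = N then 1 else 0) - (\<Sum>i<N. ?a i * (if k \<le> i then c i k else 0))) / ?a N" for k
  have a: "?a N \<noteq> 0" by (simp add: ujac_coeff0_lead)
  have "u ^ N = (\<Sum>k\<le>N. b k * ujac r s k u)" for u
  proof -
    have "(\<Sum>i<N. ?a i * u ^ i) = (\<Sum>i<N. \<Sum>k\<le>N. ?a i * (if k \<le> i then c i k else 0) * ujac r s k u)"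
    proof (intro sum.cong refl)
      fix i assume "i \<in> {..<N}"
      then have "u ^ i = (\<Sum>k\<le>N. (if k \<le> i then c i k else 0) * ujac r s k u)"
        by (subst c) (auto intro!: sum.mono_neutral_cong_left split: if_splits)
      then show "?a i * u ^ i = (\<Sum>k\<le>N. ?a i * (if k \<le> i then c i k else 0) * ujac r s k u)"
        by (simp add: sum_distrib_left mult_ac)
    qed
    also have "\<dots> = (\<Sum>k\<le>N. (\<Sum>i<N. ?a i * (if k \<le> i then c i k else 0)) * ujac r s k u)"
      by (subst sum.swap) (simp add: sum_distrib_right)
    finally have l: "(\<Sum>i<N. ?a i * u ^ i) = \<dots>" .
    have "ujac r s N u = ?a N * u ^ N + (\<Sum>i<N. ?a i * u ^ i)"
      unfolding ujac_eq_coeff0 by (simp add: lessThan_Suc_atMost[symmetric])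
    moreover have "ujac r s N u = (\<Sum>k\<le>N. (if k = N then 1 else 0) * ujac r s k u)"
      by (simp add: if_distrib[of "\<lambda>x. x * _"] cong: if_cong)
    moreover have "?a N * b k = (if k = N then 1 else 0) - (\<Sum>i<N. ?a i * (if k \<le> i then c i k else 0))" for k
      using a by (simp add: b_def)
    ultimately have "?a N * u ^ N = (\<Sum>k\<le>N. (?a N * b k) * ujac r s k u)"
      unfolding l by (simp only: left_diff_distrib sum_subtractf)
    then have "?a N * u ^ N = ?a N * (\<Sum>k\<le>N. b k * ujac r s k u)"
      by (simp add: sum_distrib_left mult_ac)
    then show ?thesis using a by simp
  qed
  then show ?case by blast
qed

section \<open>Connection coefficients of multiplication by a power of u\<close>

definition ujac_conn :: "nat \<Rightarrow> nat \<Rightarrow> nat \<Rightarrow> nat \<Rightarrow> nat \<Rightarrow> real" where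
  "ujac_conn r s n j k
     = (LINT u|lborel. u ^ n * ujac r s j u * ujac r s k u * jacobi_w r s u) / ujac_norm_sq r s k"

text \<open>Some expansion exists by \<open>power_ujac_span\<close>; integrating it against each
  \<open>ujac r s k\<close> identifies the coefficients.\<close>

lemma power_ujac_expansion:
  "u ^ N = (\<Sum>k\<le>N. (LINT u|lborel. u ^ N * ujac r s k u * jacobi_w r s u) / ujac_norm_sq r s k * ujac r s k u)"
proof -
  obtain c where c: "\<And>u. u ^ N = (\<Sum>k\<le>N. c k * ujac r s k u)" using power_ujac_span[of N r s] by blast
  have "(LINT u|lborel. u ^ N * ujac r s k u * jacobi_w r s u) = c k * ujac_norm_sq r s k" if k: "k \<le> N" for k
  proof -
    have "(LINT u|lborel. u ^ N * ujac r s k u * jacobi_w r s u)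
        = (LINT u|lborel. (\<Sum>l\<le>N. c l * (ujac r s l u * ujac r s k u * jacobi_w r s u)))"
      unfolding c sum_distrib_right by (simp only: mult.assoc)
    also have "\<dots> = (\<Sum>l\<le>N. c l * (if l = k then ujac_norm_sq r s k else 0))"
      by (subst Bochner_Integration.integral_sum)
        (auto intro!: integrable_mult_right integrable_jacobi_w continuous_intros simp: ujac_orthogonal)
    also have "\<dots> = c k * ujac_norm_sq r s k" using k by (simp add: if_distrib cong: if_cong)
    finally show ?thesis .
  qed
  then show ?thesis
    using c[of u] ujac_norm_sq_pos[of r s] by (auto simp: less_imp_neq[symmetric] intro!: sum.cong)
qed

text \<open>This splitting over the powers of u is where \<alpha> comes from: the summand i = m-1-h
  later becomes the contribution of the hook with leg h.\<close>

lemma ujac_conn_eq: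
  "ujac_conn r s n j k = (\<Sum>i\<le>j. ujac_coeff0 r s j i
     * ((LINT u|lborel. u ^ (n + i) * ujac r s k u * jacobi_w r s u) / ujac_norm_sq r s k))"
  by (simp add: ujac_conn_def integral_power_ujac_ujac sum_divide_distrib)

lemma power_mult_ujac_expansion:
  "u ^ n * ujac r s j u = (\<Sum>k\<le>n + j. ujac_conn r s n j k * ujac r s k u)"
proof -
  let ?h = "\<lambda>N k. (LINT u|lborel. u ^ N * ujac r s k u * jacobi_w r s u) / ujac_norm_sq r s k"
  have h0: "?h N k = 0" if "N < k" for N k using that by (simp add: integral_power_ujac)
  have "u ^ n * ujac r s j u = (\<Sum>i\<le>j. ujac_coeff0 r s j i * u ^ (n + i))"
    by (simp add: ujac_eq_coeff0 sum_distrib_left power_add mult_ac)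
  also have "\<dots> = (\<Sum>i\<le>j. ujac_coeff0 r s j i * (\<Sum>k\<le>n + j. ?h (n + i) k * ujac r s k u))"
  proof (intro sum.cong refl arg_cong2[of _ _ _ _ "(*)"])
    fix i assume "i \<in> {..j}"
    then show "u ^ (n + i) = (\<Sum>k\<le>n + j. ?h (n + i) k * ujac r s k u)"
      by (subst power_ujac_expansion[of u "n + i" r s], intro sum.mono_neutral_left) (auto simp: integral_power_ujac)
  qed
  also have "\<dots> = (\<Sum>k\<le>n + j. ujac_conn r s n j k * ujac r s k u)"
    unfolding ujac_conn_eq sum_distrib_left sum_distrib_right
    by (subst sum.swap) (simp add: mult_ac)
  finally show ?thesis .
qed

section \<open>Exponential bounds in the degree\<close>

lemma pow2_ge_Suc: "Suc n \<le> 2 ^ n"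
  by (induction n) auto

text \<open>The quotient of the Pochhammer symbols is a quotient of binomial coefficients whose
  denominator is at least 1.\<close>

lemma abs_ujac_coeff_le: "\<bar>ujac_coeff r s k j\<bar> \<le> real (k choose j) * 2 ^ (2 * k + r + s)" 
proof (cases "j \<le> k")
  case True
  have a: "pochhammer (- real k) j / fact j = (-1) ^ j * real (k choose j)"
    using gbinomial_pochhammer[of "real k" j] by (simp add: binomial_gbinomial flip: power_add)
  have f: "real ((n + j) choose j) = fact (n + j) / (fact n * fact j)" for n
    by (simp add: binomial_fact)
  have b: "pochhammer (real (k + r + s + 1)) j / pochhammer (real s + 1) j
      = real ((k + r + s + j) choose j) / real ((s + j) choose j)"
    using pochhammer_real_fact[of "k + r + s" j] pochhammer_real_fact[of s j]
    unfolding f by (simp add: add_ac)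
  have "ujac_coeff r s k j = (pochhammer (- real k) j / fact j)
      * (pochhammer (real (k + r + s + 1)) j / pochhammer (real s + 1) j)"
    by (simp add: ujac_coeff_def)
  then have "\<bar>ujac_coeff r s k j\<bar> = real (k choose j) * (real ((k + r + s + j) choose j) / real ((s + j) choose j))"
    unfolding a b by (simp add: abs_mult)
  also have "\<dots> \<le> real (k choose j) * 2 ^ (2 * k + r + s)"
  proof (rule mult_left_mono)
    have "real ((s + j) choose j) \<ge> 1" by (simp add: Suc_le_eq)
    then have "real ((k + r + s + j) choose j) / real ((s + j) choose j) \<le> real ((k + r + s + j) choose j)"
      by (simp add: divide_le_eq mult_le_cancel_left1 order_trans[OF zero_le_one])
    also have "\<dots> \<le> real (2 ^ (k + r + s + j))"
      using binomial_le_pow2[of "k + r + s + j" j] of_nat_le_iff by blast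
    also have "\<dots> \<le> 2 ^ (2 * k + r + s)"
      using True by simp
    finally show "real ((k + r + s + j) choose j) / real ((s + j) choose j) \<le> 2 ^ (2 * k + r + s)" .
  qed simp
  finally show ?thesis .
qed (simp add: ujac_coeff_eq_0)

lemma abs_ujac_le:
  assumes "0 \<le> u" "u \<le> 1"
  shows "\<bar>ujac r s k u\<bar> \<le> 2 ^ (3 * k + r + s)"
proof -
  have "\<bar>ujac r s k u\<bar> \<le> (\<Sum>j\<le>k. \<bar>ujac_coeff r s k j * (1 - u) ^ j\<bar>)"
    unfolding ujac_def by (rule sum_abs)
  also have "\<dots> \<le> (\<Sum>j\<le>k. real (k choose j) * 2 ^ (2 * k + r + s))"
  proof (rule sum_mono)
    fix j
    have "\<bar>(1 - u) ^ j\<bar> \<le> 1" using assms by (auto simp: power_abs intro!: power_le_one)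
    then have "\<bar>ujac_coeff r s k j\<bar> * \<bar>(1 - u) ^ j\<bar> \<le> real (k choose j) * 2 ^ (2 * k + r + s) * 1"
      by (intro mult_mono abs_ujac_coeff_le) auto
    then show "\<bar>ujac_coeff r s k j * (1 - u) ^ j\<bar> \<le> real (k choose j) * 2 ^ (2 * k + r + s)"
      by (simp add: abs_mult)
  qed
  also have "\<dots> = 2 ^ (3 * k + r + s)"
    using arg_cong[OF choose_row_sum[of k], of real]
    by (simp add: sum_distrib_right[symmetric] power_add[symmetric] algebra_simps del: choose_row_sum)
  finally show ?thesis .
qed

text \<open>The inverse norm is a linear factor times two binomial coefficients, each at most a
  power of 2.\<close>

lemma inverse_ujac_norm_sq_le: "1 / ujac_norm_sq r s k \<le> 2 ^ (4 * k + 2 * r + 3 * s)"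
proof -
  have f: "real ((n + s) choose s) = fact (n + s) / (fact n * fact s)" for n
    by (simp add: binomial_fact)
  have "1 / ujac_norm_sq r s k = real (2 * k + r + s + 1) * (real ((k + r + s) choose s) * real ((k + s) choose s))"
    unfolding ujac_norm_sq_def f by (simp add: power2_eq_square field_simps)
  also have "\<dots> \<le> real (2 ^ (2 * k + r + s)) * (real (2 ^ (k + r + s)) * real (2 ^ (k + s)))"
    using pow2_ge_Suc[of "2 * k + r + s"] binomial_le_pow2[of "k + r + s" s] binomial_le_pow2[of "k + s" s]
    by (intro mult_mono of_nat_mono) auto
  also have "\<dots> = 2 ^ (4 * k + 2 * r + 3 * s)" by (simp flip: power_add)
  finally show ?thesis .
qed

section \<open>Integration over ordered configurations\<close>

text \<open>Polymorphic because it applies both to configurations of reals and to sequences of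
  degrees.\<close>

definition decreasing_on :: "nat \<Rightarrow> (nat \<Rightarrow> 'a::linorder) \<Rightarrow> bool" where
  "decreasing_on m y \<longleftrightarrow> (\<forall>j<m. \<forall>i<j. y j < y i)"

text \<open>Reversed, both sequences are strictly sorted lists with the same set of entries.\<close>

lemma decreasing_on_unique:
  assumes f: "decreasing_on m f" and g: "decreasing_on m g"
    and im: "f ` {..<m} = g ` {..<m}" and i: "i < m"
  shows "f i = g i"
proof -
  have s: "sorted_wrt (<) (rev (map h [0..<m]))" if "decreasing_on m h" for h :: "nat \<Rightarrow> 'a"
    unfolding sorted_wrt_rev using that by (auto simp: sorted_wrt_iff_nth_less decreasing_on_def)
  have "rev (map f [0..<m]) = rev (map g [0..<m])"
    by (rule strict_sorted_equal[OF s[OF g] s[OF f]]) (use im in \<open>simp add: lessThan_atLeast0\<close>)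
  then have "map f [0..<m] = map g [0..<m]" by simp
  then show ?thesis using i by (simp add: map_eq_conv)
qed

lemma decreasing_on_inj: "decreasing_on m f \<Longrightarrow> inj_on f {..<m}"
  unfolding decreasing_on_def inj_on_def by (metis lessThan_iff less_irrefl linorder_neqE_nat)

lemma decreasing_permutation_exists:
  fixes y :: "nat \<Rightarrow> 'a::linorder"
  assumes inj: "inj_on y {..<m}"
  shows "\<exists>p. p permutes {..<m} \<and> decreasing_on m (\<lambda>i. y (p i))"
proof -
  define xs where "xs = rev (sorted_list_of_set (y ` {..<m}))"
  have len: "length xs = m" using inj by (simp add: xs_def card_image)
  have set: "set xs = y ` {..<m}" by (simp add: xs_def)
  have srt: "xs ! j < xs ! i" if "i < j" "j < m" for i j
  proof -
    have "sorted_wrt (\<lambda>x y. y < x) xs"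
      unfolding xs_def sorted_wrt_rev by simp
    then show ?thesis using that len by (simp add: sorted_wrt_iff_nth_less)
  qed
  \<comment> \<open>\<open>xs\<close> lists the values in decreasing order, and p sends a rank to
    the index that holds the value. A permutation of {..<m} has to be the identity
    elsewhere.\<close>
  define p where "p i = (if i < m then inv_into {..<m} y (xs ! i) else i)" for i
  have in_im: "xs ! i \<in> y ` {..<m}" if "i < m" for i using that len set nth_mem by metis
  have pm: "p i < m" if "i < m" for i
    using inv_into_into[OF in_im[OF that]] that by (simp add: p_def)
  have yp: "y (p i) = xs ! i" if "i < m" for i
    using f_inv_into_f[OF in_im[OF that]] that by (simp add: p_def)
  have ip: "inj_on p {..<m}"
  proof (rule inj_onI)
    fix i j assume ij: "i \<in> {..<m}" "j \<in> {..<m}" "p i = p j"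
    then have "xs ! i = xs ! j" using yp[of i] yp[of j] by simp
    then show "i = j" using srt[of i j] srt[of j i] ij by (metis lessThan_iff less_irrefl linorder_neqE_nat)
  qed
  have "p ` {..<m} = {..<m}" by (rule endo_inj_surj) (use ip pm in auto)
  then have "p permutes {..<m}" using ip by (intro bij_imp_permutes) (auto simp: bij_betw_def p_def)
  moreover have "decreasing_on m (\<lambda>i. y (p i))"
    unfolding decreasing_on_def using yp srt by simp
  ultimately show ?thesis by blast
qed

lemma decreasing_permutation_unique:
  assumes p: "p permutes {..<m}" and q: "q permutes {..<m}"
    and dp: "decreasing_on m (\<lambda>i. y (p i))" and dq: "decreasing_on m (\<lambda>i. y (q i))"
    and inj: "inj_on y {..<m}"
  shows "p = q"
proof (rule ext)
  fix i
  show "p i = q i"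
  proof (cases "i < m")
    case True
    have "(\<lambda>i. y (p i)) ` {..<m} = (\<lambda>i. y (q i)) ` {..<m}"
      using permutes_image[OF p] permutes_image[OF q] by (metis image_image)
    then have "y (p i) = y (q i)" using decreasing_on_unique[OF dp dq _ True] by blast
    then show ?thesis using inj True permutes_in_image[OF p, of i] permutes_in_image[OF q, of i]
      by (auto dest: inj_onD)
  qed (use permutes_not_in[OF p] permutes_not_in[OF q] in simp)
qed

section \<open>Permutation invariance of the product Lebesgue measure\<close>

interpretation lborel_pi: product_sigma_finite "\<lambda>_::nat. lborel :: real measure"
  by standard

lemma measurable_permute_PiM:
  assumes "p permutes {..<m}"
  shows "(\<lambda>y. \<lambda>i\<in>{..<m}. y (p i)) \<in> measurable (lebesgue_pi m) (lebesgue_pi m)"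
  by (intro measurable_restrict measurable_component_singleton) (use assms permutes_in_image in force)

text \<open>A permutation of coordinates maps boxes to boxes and permutes their sides, and the
  product measure is determined by its values on boxes. The restriction keeps the image inside the
  space of extensional functions.\<close>

lemma distr_permute_PiM:
  assumes p: "p permutes {..<m}"
  shows "distr (lebesgue_pi m) (lebesgue_pi m) (\<lambda>y. \<lambda>i\<in>{..<m}. y (p i)) = lebesgue_pi m"
proof (rule lborel_pi.PiM_eqI)
  fix A :: "nat \<Rightarrow> real set" assume A: "\<And>i. i \<in> {..<m} \<Longrightarrow> A i \<in> sets lborel"
  let ?q = "inv_into UNIV p"
  have q: "?q permutes {..<m}" by (rule permutes_inv[OF p])
  have "(\<lambda>y. \<lambda>i\<in>{..<m}. y (p i)) -` Pi\<^sub>E {..<m} A \<inter> space (lebesgue_pi m) = Pi\<^sub>E {..<m} (\<lambda>i. A (?q i))"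
  proof (intro Set.set_eqI iffI)
    fix y assume y: "y \<in> (\<lambda>y. \<lambda>i\<in>{..<m}. y (p i)) -` Pi\<^sub>E {..<m} A \<inter> space (lebesgue_pi m)"
    have "y i \<in> A (?q i)" if "i < m" for i
    proof -
      have "?q i \<in> {..<m}" using permutes_in_image[OF q, of i] that by simp
      then have "y (p (?q i)) \<in> A (?q i)" using y by (auto simp: PiE_def Pi_def)
      then show ?thesis by (simp add: permutes_inverses[OF p])
    qed
    then show "y \<in> Pi\<^sub>E {..<m} (\<lambda>i. A (?q i))" using y by (auto simp: space_PiM PiE_def)
  next
    fix y assume y: "y \<in> Pi\<^sub>E {..<m} (\<lambda>i. A (?q i))"
    have "y (p i) \<in> A i" if "i < m" for i
      using y permutes_in_image[OF p, of i] that permutes_inverses[OF p] by (auto simp: PiE_def Pi_def)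
    then show "y \<in> (\<lambda>y. \<lambda>i\<in>{..<m}. y (p i)) -` Pi\<^sub>E {..<m} A \<inter> space (lebesgue_pi m)"
      using y by (auto simp: space_PiM PiE_def)
  qed
  moreover have "A (?q i) \<in> sets lborel" if "i < m" for i
    using A permutes_in_image[OF q, of i] that by simp
  ultimately have "emeasure (distr (lebesgue_pi m) (lebesgue_pi m) (\<lambda>y. \<lambda>i\<in>{..<m}. y (p i))) (Pi\<^sub>E {..<m} A)
      = (\<Prod>i<m. emeasure lborel (A (?q i)))"
    using A by (subst emeasure_distr) (auto intro!: measurable_permute_PiM[OF p] sets_PiM_I_finite lborel_pi.emeasure_PiM)
  also have "\<dots> = (\<Prod>i<m. emeasure lborel (A i))"
    using prod.permute[OF q, of "\<lambda>i. emeasure lborel (A i)"] by (simp add: o_def)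
  finally show "emeasure (distr (lebesgue_pi m) (lebesgue_pi m) (\<lambda>y. \<lambda>i\<in>{..<m}. y (p i))) (Pi\<^sub>E {..<m} A)
      = (\<Prod>i\<in>{..<m}. emeasure lborel (A i))" .
qed simp_all

lemma integral_permute_PiM:
  fixes f :: "(nat \<Rightarrow> real) \<Rightarrow> real"
  assumes p: "p permutes {..<m}" and f: "f \<in> borel_measurable (lebesgue_pi m)"
  shows "(LINT y|lebesgue_pi m. f (\<lambda>i\<in>{..<m}. y (p i))) = (LINT y|lebesgue_pi m. f y)"
  using integral_distr[OF measurable_permute_PiM[OF p] f] by (simp add: distr_permute_PiM[OF p])

lemma measurable_decreasing_on:
  "(\<lambda>y. of_bool (decreasing_on m y) :: real) \<in> borel_measurable (lebesgue_pi m)"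
proof -
  have "(\<lambda>y::nat \<Rightarrow> real. of_bool (decreasing_on m y) :: real) = (\<lambda>y. \<Prod>j<m. \<Prod>i<j. indicator {0<..} (y i - y j))"
  proof (rule ext)
    fix y :: "nat \<Rightarrow> real"
    show "of_bool (decreasing_on m y) = (\<Prod>j<m. \<Prod>i<j. indicator {0<..} (y i - y j) :: real)"
    proof (cases "decreasing_on m y")
      case True
      then show ?thesis by (auto simp: decreasing_on_def intro!: prod.neutral[symmetric] prod.neutral)
    next
      case False
      then obtain i j where "j < m" "i < j" "\<not> y j < y i" by (auto simp: decreasing_on_def)
      then have "\<exists>i\<in>{..<j}. indicator {0<..} (y i - y j) = (0::real)" "j \<in> {..<m}" by (auto intro!: bexI[of _ i])
      then show ?thesis using False by (auto intro!: prod_zero[symmetric] prod_zero)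
    qed
  qed
  moreover have "\<dots> \<in> borel_measurable (lebesgue_pi m)"
    by (intro borel_measurable_prod borel_measurable_indicator' borel_measurable_diff
        measurable_compose[OF measurable_component_singleton]) auto
  ultimately show ?thesis by simp
qed

text \<open>A point without ties is made decreasing by exactly one permutation, so f is the sum of
  the m! permuted copies of its restriction to the decreasing chamber. Vanishing at ties takes the
  place of a null set argument.\<close>

lemma integral_decreasing_symmetric:
  fixes f :: "(nat \<Rightarrow> real) \<Rightarrow> real"
  assumes int: "integrable (lebesgue_pi m) f"
    and sym: "\<And>p y. p permutes {..<m} \<Longrightarrow> f (\<lambda>i\<in>{..<m}. y (p i)) = f y"
    and ties: "\<And>y. \<not> inj_on y {..<m} \<Longrightarrow> f y = 0"
  shows "(LINT y|lebesgue_pi m. f y) = fact m * (LINT y|lebesgue_pi m. f y * of_bool (decreasing_on m y))"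
proof -
  let ?P = "{p. p permutes {..<m}}"
  define g where "g y = f y * of_bool (decreasing_on m y)" for y
  have d: "decreasing_on m (\<lambda>i\<in>{..<m}. z i) = decreasing_on m z" for z :: "nat \<Rightarrow> real"
    by (auto simp: decreasing_on_def)
  have gm: "g \<in> borel_measurable (lebesgue_pi m)"
    unfolding g_def using int measurable_decreasing_on[of m] by measurable
  have gi: "integrable (lebesgue_pi m) g"
    by (rule Bochner_Integration.integrable_bound[OF int gm]) (auto simp: g_def)
  have gpi: "integrable (lebesgue_pi m) (\<lambda>y. g (\<lambda>i\<in>{..<m}. y (p i)))" if p: "p permutes {..<m}" for p
    using integrable_distr[OF measurable_permute_PiM[OF p], of g] gi by (simp add: distr_permute_PiM[OF p])
  have "f y = (\<Sum>p\<in>?P. g (\<lambda>i\<in>{..<m}. y (p i)))" for y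
  proof (cases "inj_on y {..<m}")
    case True
    obtain q where q: "q permutes {..<m}" "decreasing_on m (\<lambda>i. y (q i))"
      using decreasing_permutation_exists[OF True] by blast
    have "decreasing_on m (\<lambda>i. y (p i)) \<longleftrightarrow> p = q" if "p \<in> ?P" for p
    proof
      assume "decreasing_on m (\<lambda>i. y (p i))"
      then show "p = q" using decreasing_permutation_unique[OF _ q(1) _ q(2) True, of p] that by simp
    qed (use q in simp)
    then have "(\<Sum>p\<in>?P. g (\<lambda>i\<in>{..<m}. y (p i))) = (\<Sum>p\<in>?P. if p = q then f y else 0)"
    proof (intro sum.cong refl)
      fix p assume p: "p \<in> ?P"
      then have "f (\<lambda>i\<in>{..<m}. y (p i)) = f y" by (intro sym) simp
      then show "g (\<lambda>i\<in>{..<m}. y (p i)) = (if p = q then f y else 0)"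
        unfolding g_def d using \<open>p \<in> ?P \<Longrightarrow> decreasing_on m (\<lambda>i. y (p i)) \<longleftrightarrow> p = q\<close>[OF p] by simp
    qed
    also have "\<dots> = f y" using q by (simp add: finite_permutations)
    finally show ?thesis by simp
  next
    case False
    then have "g (\<lambda>i\<in>{..<m}. y (p i)) = 0" if "p \<in> ?P" for p
    proof -
      have "f (\<lambda>i\<in>{..<m}. y (p i)) = f y" by (rule sym) (use that in simp)
      then show ?thesis using ties[OF False] by (simp only: g_def mult_zero_left)
    qed
    then have "(\<Sum>p\<in>?P. g (\<lambda>i\<in>{..<m}. y (p i))) = 0" by (intro sum.neutral ballI)
    then show ?thesis by (simp only: ties[OF False])
  qed
  note split = this
  have "(LINT y|lebesgue_pi m. f y) = (LINT y|lebesgue_pi m. (\<Sum>p\<in>?P. g (\<lambda>i\<in>{..<m}. y (p i))))"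
    by (rule Bochner_Integration.integral_cong[OF refl split])
  also have "\<dots> = (\<Sum>p\<in>?P. LINT y|lebesgue_pi m. g (\<lambda>i\<in>{..<m}. y (p i)))"
    by (rule Bochner_Integration.integral_sum) (auto intro: gpi)
  also have "\<dots> = (\<Sum>p\<in>?P. LINT y|lebesgue_pi m. g y)"
    by (intro sum.cong refl integral_permute_PiM gm) auto
  also have "\<dots> = fact m * (LINT y|lebesgue_pi m. g y)"
    using card_permutations[of "{..<m}" m] by simp
  finally show ?thesis by (simp add: g_def)
qed

section \<open>Orthogonality of alternants\<close>

lemma sign_mult_self: "of_int (sign p) * (of_int (sign p) :: real) = 1"
  by (metis of_int_1 of_int_mult sign_idempotent)

text \<open>Andreief's identity. Fubini factors the integral for each pair (p, q); after replacing q
  by q \<circ> p it no longer depends on p, and the sum over p gives m!.\<close>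

lemma integral_alternant_mult:
  fixes F G :: "nat \<Rightarrow> real \<Rightarrow> real"
  assumes int: "\<And>a b. integrable lborel (\<lambda>u. F a u * G b u * w u)"
  shows "integrable (lebesgue_pi m) (\<lambda>y. alternant m F y * alternant m G y * (\<Prod>j<m. w (y j)))"
    and "(LINT y|lebesgue_pi m. alternant m F y * alternant m G y * (\<Prod>j<m. w (y j)))
      = fact m * (\<Sum>p | p permutes {..<m}. of_int (sign p) * (\<Prod>j<m. LINT u|lborel. F j u * G (p j) u * w u))"
proof -
  let ?P = "{p. p permutes {..<m}}"
  let ?t = "\<lambda>p q y. of_int (sign p * sign q) * (\<Prod>j<m. F (p j) (y j) * G (q j) (y j) * w (y j)) :: real"
  have e: "alternant m F y * alternant m G y * (\<Prod>j<m. w (y j)) = (\<Sum>p\<in>?P. \<Sum>q\<in>?P. ?t p q y)" for y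
    unfolding alternant_def sum_product unfolding sum_distrib_right
    by (intro sum.cong refl) (simp add: prod.distrib)
  have i: "integrable (lebesgue_pi m) (?t p q)" for p q
    by (intro integrable_mult_right lborel_pi.product_integrable_prod int) auto
  have v: "(LINT y|lebesgue_pi m. ?t p q y)
      = of_int (sign p * sign q) * (\<Prod>j<m. LINT u|lborel. F (p j) u * G (q j) u * w u)" for p q
    using lborel_pi.product_integral_prod[OF finite_lessThan[of m] int, of "\<lambda>i. p i" "\<lambda>i. q i"] by simp
  show "integrable (lebesgue_pi m) (\<lambda>y. alternant m F y * alternant m G y * (\<Prod>j<m. w (y j)))"
    unfolding e by (intro Bochner_Integration.integrable_sum i)
  let ?I = "\<lambda>a b. LINT u|lborel. F a u * G b u * w u"
  have "(LINT y|lebesgue_pi m. alternant m F y * alternant m G y * (\<Prod>j<m. w (y j)))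
      = (\<Sum>p\<in>?P. \<Sum>q\<in>?P. of_int (sign p * sign q) * (\<Prod>j<m. ?I (p j) (q j)))"
    unfolding e
    by (subst Bochner_Integration.integral_sum, intro Bochner_Integration.integrable_sum i,
        subst Bochner_Integration.integral_sum, rule i) (simp only: v)
  also have "\<dots> = (\<Sum>p\<in>?P. \<Sum>q\<in>?P. of_int (sign q) * (\<Prod>j<m. ?I j (q j)))"
  proof (rule sum.cong[OF refl])
    fix p assume "p \<in> ?P"
    then have p: "p permutes {..<m}" by simp
    have "(\<Sum>q\<in>?P. of_int (sign p * sign q) * (\<Prod>j<m. ?I (p j) (q j)))
        = (\<Sum>q\<in>?P. of_int (sign p * sign (q \<circ> p)) * (\<Prod>j<m. ?I (p j) ((q \<circ> p) j)))"
      by (rule sum_permutations_compose_right[OF p])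
    also have "\<dots> = (\<Sum>q\<in>?P. of_int (sign q) * (\<Prod>j<m. ?I j (q j)))"
    proof (intro sum.cong refl)
      fix q assume "q \<in> ?P"
      moreover have "(\<Prod>j<m. ?I (p j) ((q \<circ> p) j)) = (\<Prod>j<m. ?I j (q j))"
        using prod.permute[OF p, of "\<lambda>j. ?I j (q j)"] by (simp add: o_def)
      ultimately show "of_int (sign p * sign (q \<circ> p)) * (\<Prod>j<m. ?I (p j) ((q \<circ> p) j)) = of_int (sign q) * (\<Prod>j<m. ?I j (q j))"
        by (simp only: sign_permutes_comp[OF _ p] mem_Collect_eq) (simp add: mult.left_commute sign_mult_self)
    qed
    finally show "(\<Sum>q\<in>?P. of_int (sign p * sign q) * (\<Prod>j<m. ?I (p j) (q j)))
        = (\<Sum>q\<in>?P. of_int (sign q) * (\<Prod>j<m. ?I j (q j)))" .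
  qed
  also have "\<dots> = fact m * (\<Sum>q\<in>?P. of_int (sign q) * (\<Prod>j<m. ?I j (q j)))"
    using card_permutations[of "{..<m}" m] by simp
  finally show "(LINT y|lebesgue_pi m. alternant m F y * alternant m G y * (\<Prod>j<m. w (y j)))
      = fact m * (\<Sum>p | p permutes {..<m}. of_int (sign p) * (\<Prod>j<m. ?I j (p j)))" .
qed

text \<open>\<open>jacobi_weight\<close> without the squared Vandermonde factor: one copy cancels
  the denominator of the multivariate polynomial, and the other is treated as an alternant.\<close>

definition ordered_weight :: "nat \<Rightarrow> nat \<Rightarrow> nat \<Rightarrow> (nat \<Rightarrow> real) \<Rightarrow> real" where
  "ordered_weight r s m y = (\<Prod>j<m. jacobi_w r s (y j)) * of_bool (decreasing_on m y)"

text \<open>In the determinant of pairings at most one permutation has a nonzero product. Its factor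
  m! is cancelled by restricting to the decreasing chamber.\<close>

theorem ujac_alternant_orthogonal:
  fixes lam mu :: "nat \<Rightarrow> nat"
  assumes l: "decreasing_on m lam" and u: "decreasing_on m mu"
  shows "(LINT y|lebesgue_pi m. alternant m (\<lambda>i. ujac r s (lam i)) y * alternant m (\<lambda>i. ujac r s (mu i)) y
            * ordered_weight r s m y)
    = (if \<forall>i<m. lam i = mu i then \<Prod>i<m. ujac_norm_sq r s (lam i) else 0)"
proof -
  let ?F = "\<lambda>i. ujac r s (lam i)" and ?G = "\<lambda>i. ujac r s (mu i)" and ?w = "jacobi_w r s"
  let ?P = "{p. p permutes {..<m}}"
  let ?f = "\<lambda>y. alternant m ?F y * alternant m ?G y * (\<Prod>j<m. ?w (y j))"
  have int: "integrable lborel (\<lambda>u. ?F a u * ?G b u * ?w u)" for a b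
    by (intro integrable_jacobi_w continuous_intros)
  have sym: "?f (\<lambda>i\<in>{..<m}. y (p i)) = ?f y" if p: "p permutes {..<m}" for p y
  proof -
    have a: "alternant m F (\<lambda>i\<in>{..<m}. y (p i)) = of_int (sign p) * alternant m F y" for F :: "nat \<Rightarrow> real \<Rightarrow> real"
      by (subst alternant_permute_args[OF p, symmetric], rule alternant_cong) simp
    have "(\<Prod>j<m. ?w ((\<lambda>i\<in>{..<m}. y (p i)) j)) = (\<Prod>j<m. ?w (y j))"
      using prod.permute[OF p, of "\<lambda>j. ?w (y j)"] by (simp add: o_def)
    then show ?thesis unfolding a by (simp add: mult.left_commute flip: of_int_mult mult.assoc)
  qed
  have ties: "?f y = 0" if "\<not> inj_on y {..<m}" for y
    using that alternant_eq_args[of _ m _ y] by (force simp: inj_on_def)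
  have I: "(LINT u|lborel. ?F i u * ?G j u * ?w u) = (if lam i = mu j then ujac_norm_sq r s (mu j) else 0)" for i j
    by (rule ujac_orthogonal)
  have "fact m * (LINT y|lebesgue_pi m. ?f y * of_bool (decreasing_on m y)) = (LINT y|lebesgue_pi m. ?f y)"
    by (rule integral_decreasing_symmetric[symmetric]) (use integral_alternant_mult(1)[OF int] sym ties in auto)
  also have "\<dots> = fact m * (\<Sum>p\<in>?P. of_int (sign p) * (\<Prod>j<m. if lam j = mu (p j) then ujac_norm_sq r s (mu (p j)) else 0))"
    unfolding integral_alternant_mult(2)[OF int] I ..
  also have "(\<Sum>p\<in>?P. of_int (sign p) * (\<Prod>j<m. if lam j = mu (p j) then ujac_norm_sq r s (mu (p j)) else 0))
      = (if \<forall>i<m. lam i = mu i then \<Prod>i<m. ujac_norm_sq r s (lam i) else 0)"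
  proof -
    \<comment> \<open>Agreement along p gives both decreasing sequences the same set of values, so
      they coincide; injectivity then forces p to be the identity.\<close>
    have key: "(\<forall>i<m. lam i = mu i) \<and> p = id" if p: "p permutes {..<m}" and e: "\<forall>j<m. lam j = mu (p j)" for p
    proof -
      have "lam ` {..<m} = mu ` {..<m}"
        using e permutes_image[OF p] by (metis (no_types, lifting) image_cong image_image lessThan_iff)
      then have 1: "\<forall>i<m. lam i = mu i" using decreasing_on_unique[OF l u] by blast
      have "p = id"
      proof
        fix i show "p i = id i"
        proof (cases "i < m")
          case True
          then have "mu (p i) = mu i" using 1 e by metis
          then show ?thesis using decreasing_on_inj[OF u] True permutes_in_image[OF p, of i]
            by (auto dest: inj_onD)
        qed (use permutes_not_in[OF p] in simp)
      qed
      then show ?thesis using 1 by blast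
    qed
    have "(\<Sum>p\<in>?P. of_int (sign p) * (\<Prod>j<m. if lam j = mu (p j) then ujac_norm_sq r s (mu (p j)) else 0))
      = (\<Sum>p\<in>?P. if p = id then (if \<forall>i<m. lam i = mu i then \<Prod>i<m. ujac_norm_sq r s (lam i) else 0) else 0)"
    proof (intro sum.cong refl)
      fix p assume p: "p \<in> ?P"
      show "of_int (sign p) * (\<Prod>j<m. if lam j = mu (p j) then ujac_norm_sq r s (mu (p j)) else 0)
        = (if p = id then (if \<forall>i<m. lam i = mu i then \<Prod>i<m. ujac_norm_sq r s (lam i) else 0) else 0)"
      proof (cases "\<forall>j<m. lam j = mu (p j)")
        case True
        then show ?thesis using key[of p] p by simp
      next
        case False
        then have "(\<Prod>j<m. if lam j = mu (p j) then ujac_norm_sq r s (mu (p j)) else 0) = 0"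
          by (auto intro!: prod_zero)
        then show ?thesis using False by auto
      qed
    qed
    then show ?thesis by (simp add: finite_permutations permutes_id)
  qed
  finally show ?thesis by (simp add: ordered_weight_def mult_ac)
qed

section \<open>Integrability against the ordered weight\<close>

lemma jacobi_w_nonneg: "0 \<le> jacobi_w r s u"
  by (cases "u \<in> {0<..<1}") (auto simp: jacobi_w_def)

lemma ordered_weight_nonneg: "0 \<le> ordered_weight r s m y"
  unfolding ordered_weight_def by (intro mult_nonneg_nonneg prod_nonneg ballI jacobi_w_nonneg) simp

lemma ordered_weight_eq_0: "j < m \<Longrightarrow> \<not> (0 < y j \<and> y j < 1) \<Longrightarrow> ordered_weight r s m y = 0"
  unfolding ordered_weight_def jacobi_w_def by (auto simp: indicator_def)

lemma measurable_ordered_weight [measurable]: "ordered_weight r s m \<in> borel_measurable (lebesgue_pi m)"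
proof -
  have "(\<lambda>y. jacobi_w r s (y j)) \<in> borel_measurable (lebesgue_pi m)" if "j < m" for j
    by (rule measurable_compose[OF measurable_component_singleton]) (use that in \<open>auto simp: jacobi_w_def\<close>)
  then have "(\<lambda>y. \<Prod>j<m. jacobi_w r s (y j)) \<in> borel_measurable (lebesgue_pi m)"
    by (intro borel_measurable_prod) auto
  then show ?thesis unfolding ordered_weight_def [abs_def]
    by (intro borel_measurable_times measurable_decreasing_on)
qed

lemma integrable_ordered_weight: "integrable (lebesgue_pi m) (ordered_weight r s m)"
proof (rule Bochner_Integration.integrable_bound)
  show "integrable (lebesgue_pi m) (\<lambda>y. \<Prod>j<m. jacobi_w r s (y j))"
    using integrable_jacobi_w[of "\<lambda>_. 1" r s]
    by (intro lborel_pi.product_integrable_prod) auto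
qed (auto simp: ordered_weight_def abs_mult)

lemma integrable_bounded_ordered_weight:
  assumes f: "f \<in> borel_measurable (lebesgue_pi m)"
    and B: "\<And>y. (\<And>j. j < m \<Longrightarrow> 0 < y j \<and> y j < 1) \<Longrightarrow> \<bar>f y\<bar> \<le> B"
  shows "integrable (lebesgue_pi m) (\<lambda>y. f y * ordered_weight r s m y)"
proof (rule Bochner_Integration.integrable_bound[OF integrable_mult_right[OF integrable_ordered_weight]])
  show "AE y in lebesgue_pi m. norm (f y * ordered_weight r s m y) \<le> norm (B * ordered_weight r s m y)"
  proof (rule AE_I2)
    fix y
    show "norm (f y * ordered_weight r s m y) \<le> norm (B * ordered_weight r s m y)"
    proof (cases "\<forall>j<m. 0 < y j \<and> y j < 1")
      case True
      then have "\<bar>f y\<bar> \<le> \<bar>B\<bar>" using B[of y] by auto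
      then show ?thesis by (simp add: abs_mult mult_right_mono)
    qed (use ordered_weight_eq_0 in force)
  qed
qed (use f in measurable)

section \<open>Multivariate Jacobi polynomials at the point (1, ..., 1)\<close>

definition shifted_part :: "nat \<Rightarrow> nat list \<Rightarrow> nat \<Rightarrow> nat" where
  "shifted_part m \<tau> i = part \<tau> i + (m - 1 - i)"

lemma part_antimono:
  assumes "\<tau> \<in> partitions" "i \<le> j"
  shows "part \<tau> j \<le> part \<tau> i"
  using assms by (cases "i = j") (auto simp: partitions_def part_def sorted_wrt_iff_nth_less)

lemma decreasing_shifted_part:
  assumes "\<tau> \<in> partitions"
  shows "decreasing_on m (shifted_part m \<tau>)"
  unfolding decreasing_on_def shifted_part_def
proof (intro allI impI)
  fix i j assume "j < m" "i < j"
  then show "part \<tau> j + (m - 1 - j) < part \<tau> i + (m - 1 - i)"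
    using part_antimono[OF assms, of i j] by simp
qed

text \<open>The length is the first index with part 0. If the lengths differed, the smaller one
  would be an index below m at which the parts differ.\<close>

lemma partition_eqI:
  assumes t: "\<tau> \<in> partitions" "length \<tau> \<le> m" and u: "\<tau>' \<in> partitions" "length \<tau>' \<le> m"
    and eq: "\<And>i. i < m \<Longrightarrow> part \<tau> i = part \<tau>' i"
  shows "\<tau> = \<tau>'"
proof -
  have z: "part \<sigma> i = 0 \<longleftrightarrow> length \<sigma> \<le> i" if "\<sigma> \<in> partitions" for \<sigma> i
  proof (cases "i < length \<sigma>")
    case True
    then have "\<sigma> ! i \<in> set \<sigma>" by simp
    then have "\<sigma> ! i \<noteq> 0" using that by (metis (mono_tags, lifting) mem_Collect_eq partitions_def)
    then show ?thesis using True by (simp add: part_def)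
  qed (simp add: part_def)
  have len: "length \<tau> = length \<tau>'"
  proof (rule ccontr)
    assume "length \<tau> \<noteq> length \<tau>'"
    then show False
      using z[OF t(1), of "min (length \<tau>) (length \<tau>')"] z[OF u(1), of "min (length \<tau>) (length \<tau>')"]
        eq[of "min (length \<tau>) (length \<tau>')"] t(2) u(2) by (simp add: min_def split: if_splits)
  qed
  show ?thesis
  proof (rule nth_equalityI[OF len])
    fix i assume "i < length \<tau>"
    then show "\<tau> ! i = \<tau>' ! i" using eq[of i] len t(2) by (simp add: part_def)
  qed
qed

lemma shifted_part_inject:
  assumes "\<tau> \<in> partitions" "length \<tau> \<le> m" "\<tau>' \<in> partitions" "length \<tau>' \<le> m"
  shows "(\<forall>i<m. shifted_part m \<tau> i = shifted_part m \<tau>' i) \<longleftrightarrow> \<tau> = \<tau>'"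
proof
  assume eq: "\<forall>i<m. shifted_part m \<tau> i = shifted_part m \<tau>' i"
  show "\<tau> = \<tau>'"
  proof (rule partition_eqI[OF assms])
    fix i assume "i < m"
    then have "shifted_part m \<tau> i = shifted_part m \<tau>' i" using eq by blast
    then show "part \<tau> i = part \<tau>' i" unfolding shifted_part_def by (rule add_right_imp_eq)
  qed
qed simp

section \<open>The value at (1, ..., 1) as a Vandermonde product in the eigenvalues\<close>

definition jacobi_eigenvalue :: "nat \<Rightarrow> nat \<Rightarrow> nat \<Rightarrow> real" where
  "jacobi_eigenvalue r s k = real k * real (k + r + s + 1)"

text \<open>The determinant of the Taylor coefficients at 1, in evaluated form
  (\<open>alternant_ujac_coeff\<close>). The first product does not depend on \<open>lam\<close> and
  drops out of quotients.\<close>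

definition ujac_at_ones :: "nat \<Rightarrow> nat \<Rightarrow> nat \<Rightarrow> (nat \<Rightarrow> nat) \<Rightarrow> real" where
  "ujac_at_ones r s m lam = (\<Prod>l<m. (-1) ^ l / (pochhammer (real s + 1) l * fact l))
     * (\<Prod>j<m. \<Prod>a<j. jacobi_eigenvalue r s (lam j) - jacobi_eigenvalue r s (lam a))"

text \<open>Since (-k + a)(k + r + s + 1 + a) is minus the difference of the eigenvalues of k and a,
  the coefficient of (1 - u)^l is a polynomial of degree l in the eigenvalue of k.\<close>

lemma ujac_coeff_eq_prod:
  "ujac_coeff r s k l = (-1) ^ l / (pochhammer (real s + 1) l * fact l)
     * (\<Prod>a<l. jacobi_eigenvalue r s k - jacobi_eigenvalue r s a)"
proof -
  have "pochhammer (- real k) l * pochhammer (real (k + r + s + 1)) l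
      = (-1) ^ l * (\<Prod>a<l. jacobi_eigenvalue r s k - jacobi_eigenvalue r s a)"
  proof (induction l)
    case (Suc l)
    have "(- real k + real l) * (real (k + r + s + 1) + real l)
        = - (jacobi_eigenvalue r s k - jacobi_eigenvalue r s l)"
      by (simp add: jacobi_eigenvalue_def algebra_simps)
    moreover have "pochhammer (- real k) (Suc l) * pochhammer (real (k + r + s + 1)) (Suc l)
        = (pochhammer (- real k) l * pochhammer (real (k + r + s + 1)) l)
          * ((- real k + real l) * (real (k + r + s + 1) + real l))"
      by (simp only: pochhammer_Suc mult_ac)
    ultimately have "pochhammer (- real k) (Suc l) * pochhammer (real (k + r + s + 1)) (Suc l)
        = (-1) ^ l * (\<Prod>a<l. jacobi_eigenvalue r s k - jacobi_eigenvalue r s a)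
          * - (jacobi_eigenvalue r s k - jacobi_eigenvalue r s l)"
      by (simp only: Suc)
    then show ?case by (simp only: prod.lessThan_Suc power_Suc mult_ac mult_minus_left mult_minus_right mult_1)
  qed simp
  then show ?thesis by (simp add: ujac_coeff_def)
qed

text \<open>Transposed, row l holds, up to a constant, the values of a monic polynomial of degree l
  at the eigenvalues, so \<open>alternant_monic\<close> applies. With the identity as argument
  sequence, \<open>alternant\<close> is an ordinary determinant.\<close>

lemma alternant_ujac_coeff: "alternant m (\<lambda>i l. ujac_coeff r s (lam i) l) (\<lambda>l. l) = ujac_at_ones r s m lam"
proof -
  define p where "p l = (\<Prod>a<l. [:- jacobi_eigenvalue r s a, 1:])" for l
  have p1: "lead_coeff (p l) = 1" for l by (simp add: p_def lead_coeff_prod)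
  have p2: "degree (p l) = l" for l by (simp add: p_def degree_prod_eq_sum_degree)
  have "alternant m (\<lambda>i l. ujac_coeff r s (lam i) l) (\<lambda>l. l)
      = Determinant.det (mat m m (\<lambda>(i, l). ujac_coeff r s (lam i) l))"
    using det_eq_alternant[of m "\<lambda>i l. ujac_coeff r s (lam i) l" "\<lambda>l. l"] by simp
  also have "\<dots> = Determinant.det (mat m m (\<lambda>(l, i). ujac_coeff r s (lam i) l))"
    by (subst det_transpose[symmetric, of _ m], simp, rule arg_cong[of _ _ Determinant.det], rule eq_matI) auto
  also have "\<dots> = alternant m (\<lambda>l x. (-1) ^ l / (pochhammer (real s + 1) l * fact l) * poly (p l) x)
      (\<lambda>i. jacobi_eigenvalue r s (lam i))"
    unfolding det_eq_alternant[symmetric] by (simp add: ujac_coeff_eq_prod p_def poly_prod)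
  also have "\<dots> = ujac_at_ones r s m lam"
    unfolding alternant_scale_rows by (subst alternant_monic[OF p1 p2]) (simp add: ujac_at_ones_def)
  finally show ?thesis .
qed

section \<open>Removing the Vandermonde denominator\<close>

definition ujac_poly :: "nat \<Rightarrow> nat \<Rightarrow> nat \<Rightarrow> real poly" where
  "ujac_poly r s k = (\<Sum>j\<le>k. monom (ujac_coeff r s k j) j)"

lemma poly_ujac_poly: "poly (ujac_poly r s k) (1 - u) = ujac r s k u"
  by (simp add: ujac_poly_def ujac_def poly_sum poly_monom)

lemma coeff_ujac_poly: "coeff (ujac_poly r s k) l = ujac_coeff r s k l"
  using ujac_coeff_eq_0[of k l r s] by (cases "l \<le> k") (auto simp: ujac_poly_def coeff_sum)

text \<open>The alternant divided by the Vandermonde product, in a form that makes sense at every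
  point. The nodes are 1 - x_j, and (1 - x_j) - (1 - x_a) = x_a - x_j has the orientation of
  \<open>vandermonde\<close>, so no sign appears.\<close>

definition ujac_quotient :: "nat \<Rightarrow> nat \<Rightarrow> nat \<Rightarrow> (nat \<Rightarrow> nat) \<Rightarrow> (nat \<Rightarrow> real) \<Rightarrow> real" where
  "ujac_quotient r s m lam x
     = alternant m (\<lambda>i l. divided_diff (ujac_poly r s (lam i)) (\<lambda>j. 1 - x j) l) (\<lambda>l. l)"

lemma alternant_ujac_quotient:
  "alternant m (\<lambda>i. ujac r s (lam i)) x = ujac_quotient r s m lam x * vandermonde m x"
proof -
  have "alternant m (\<lambda>i. ujac r s (lam i)) x = alternant m (\<lambda>i. poly (ujac_poly r s (lam i))) (\<lambda>j. 1 - x j)"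
    by (rule alternant_cong) (simp add: poly_ujac_poly)
  also have "\<dots> = ujac_quotient r s m lam x * (\<Prod>j<m. \<Prod>a<j. (1 - x j) - (1 - x a))"
    unfolding alternant_newton ujac_quotient_def det_eq_alternant[symmetric] ..
  finally show ?thesis by (simp add: vandermonde_def)
qed

lemma ujac_quotient_ones: "ujac_quotient r s m lam (\<lambda>_. 1) = ujac_at_ones r s m lam"
  by (simp add: ujac_quotient_def divided_diff_0 coeff_ujac_poly alternant_ujac_coeff)

lemma tendsto_ujac_quotient:
  assumes "\<And>j. ((\<lambda>\<omega>. x \<omega> j) \<longlongrightarrow> 1) F"
  shows "((\<lambda>\<omega>. ujac_quotient r s m lam (x \<omega>)) \<longlongrightarrow> ujac_at_ones r s m lam) F"
proof -
  have "((\<lambda>\<omega>. 1 - x \<omega> j) \<longlongrightarrow> 0) F" for j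
    using tendsto_diff[OF tendsto_const[of 1] assms[of j]] by simp
  then show ?thesis
    unfolding ujac_quotient_ones[symmetric] ujac_quotient_def alternant_def diff_self
    by (intro tendsto_sum tendsto_mult tendsto_const tendsto_prod tendsto_divided_diff)
qed

lemma jacobi_quotient_eq:
  assumes "vandermonde m x \<noteq> 0"
  shows "jacobi_quotient r s m \<tau> x
    = (\<Prod>i<m. jacobi_at_1 s (shifted_part m \<tau> i)) * ujac_quotient r s m (shifted_part m \<tau>) x"
  unfolding jacobi_quotient_def shifted_part_def[symmetric]
    det_eq_alternant[of m "\<lambda>i. jacobi r s (shifted_part m \<tau> i)"]
  unfolding jacobi_eq_ujac[abs_def] alternant_scale_rows alternant_ujac_quotient
  using assms by simp

text \<open>\<open>Lim\<close> is determined by convergence only along a nontrivial filter. The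
  points with coordinates 1 + j h have distinct coordinates for h > 0 and tend to (1, ..., 1) in the
  product topology.\<close>

lemma at_ones_within_vandermonde_nontrivial:
  assumes "2 \<le> m"
  shows "at (\<lambda>_. 1) within {z. vandermonde m z \<noteq> 0} \<noteq> bot"
proof
  assume b: "at (\<lambda>_. 1 :: real) within {z. vandermonde m z \<noteq> 0} = bot"
  define g :: "real \<Rightarrow> nat \<Rightarrow> real" where "g h j = 1 + real j * h" for h j
  define z where "z n = g (inverse (real (Suc n)))" for n
  have "continuous_on UNIV g"
    unfolding g_def by (intro continuous_intros)
  then have "z \<longlonglongrightarrow> g 0"
    unfolding z_def by (rule continuous_on_tendsto_compose[OF _ LIMSEQ_inverse_real_of_nat]) auto
  moreover have "g 0 = (\<lambda>_. 1)" by (rule ext) (simp add: g_def)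
  ultimately have "z \<longlonglongrightarrow> (\<lambda>_. 1)" by simp
  moreover have "z n \<in> {z. vandermonde m z \<noteq> 0}" for n
    by (auto simp: z_def g_def vandermonde_def)
  moreover have "z n \<noteq> (\<lambda>_. 1)" for n
    by (auto simp: z_def g_def fun_eq_iff intro!: exI[of _ 1])
  ultimately have "filterlim z (at (\<lambda>_. 1) within {z. vandermonde m z \<noteq> 0}) sequentially"
    by (auto simp: filterlim_at)
  then show False unfolding b by (auto simp: filterlim_def bot_unique filtermap_bot_iff)
qed

text \<open>For m \<ge> 2 the defining limit is taken and computed from the continuous quotient. For
  m \<le> 1 the Vandermonde product is empty, and the plain quotient applies.\<close>

theorem multi_jacobi_ones:
  "multi_jacobi r s m \<tau> (\<lambda>_. 1)
     = (\<Prod>i<m. jacobi_at_1 s (shifted_part m \<tau> i)) * ujac_at_ones r s m (shifted_part m \<tau>)"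
proof (cases "vandermonde m (\<lambda>_. 1) = 0")
  case False
  then show ?thesis by (simp add: multi_jacobi_def jacobi_quotient_eq ujac_quotient_ones)
next
  case True
  have m: "2 \<le> m"
  proof (rule ccontr)
    assume "\<not> 2 \<le> m"
    then have "m = 0 \<or> m = 1" by auto
    then show False using True by (auto simp: vandermonde_def)
  qed
  let ?F = "at (\<lambda>_. 1) within {z. vandermonde m z \<noteq> 0}"
  let ?c = "\<Prod>i<m. jacobi_at_1 s (shifted_part m \<tau> i)"
  have "((\<lambda>x. x j) \<longlongrightarrow> 1) ?F" for j
    using continuous_on_product_coordinates[of j]
    by (auto simp: continuous_on_def intro: tendsto_within_subset)
  then have "((\<lambda>x. ?c * ujac_quotient r s m (shifted_part m \<tau>) x) \<longlongrightarrow> ?c * ujac_at_ones r s m (shifted_part m \<tau>)) ?F"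
    by (intro tendsto_mult tendsto_const tendsto_ujac_quotient)
  moreover have "eventually (\<lambda>x. ?c * ujac_quotient r s m (shifted_part m \<tau>) x = jacobi_quotient r s m \<tau> x) ?F"
    by (auto simp: eventually_at_filter jacobi_quotient_eq)
  ultimately have "(jacobi_quotient r s m \<tau> \<longlongrightarrow> ?c * ujac_at_ones r s m (shifted_part m \<tau>)) ?F"
    by (rule Lim_transform_eventually)
  then show ?thesis
    using True tendsto_Lim[OF at_ones_within_vandermonde_nontrivial[OF m]] by (simp add: multi_jacobi_def)
qed

section \<open>The terms of the density as alternants\<close>

lemma jacobi_weight_eq: "jacobi_weight r s m y = (vandermonde m y)\<^sup>2 * ordered_weight r s m y"
proof -
  have "(\<Prod>j<m. jacobi_w r s (y j)) = (\<Prod>i<m. y i ^ r * (1 - y i) ^ s) * of_bool (\<forall>i<m. 0 < y i \<and> y i < 1)"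
  proof (cases "\<forall>i<m. 0 < y i \<and> y i < 1")
    case False
    then show ?thesis by (auto simp: jacobi_w_def indicator_def intro!: prod_zero)
  qed (auto simp: jacobi_w_def indicator_def intro!: prod.cong)
  then show ?thesis by (simp add: jacobi_weight_def ordered_weight_def decreasing_on_def)
qed

lemma vandermonde_decreasing_nz: "decreasing_on m y \<Longrightarrow> vandermonde m y \<noteq> 0"
  by (force simp: vandermonde_def decreasing_on_def)

text \<open>\<open>jacobi_at_1\<close> enters once through the value at (1, ..., 1), once through y,
  and squared through the norms, so it cancels. Off the decreasing chamber both sides are 0, hence
  only the quotient branch of \<open>multi_jacobi\<close> matters at y.\<close>

lemma jacobi_density_term:
  "exp (- real (nu r s m \<tau>) * t) * (\<Prod>j<m. 1 / jacobi_norm_sq r s (part \<tau> j + (m - 1 - j)))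
      * multi_jacobi r s m \<tau> (\<lambda>_. 1) * multi_jacobi r s m \<tau> y * jacobi_weight r s m y
   = exp (- real (nu r s m \<tau>) * t) * ujac_at_ones r s m (shifted_part m \<tau>)
      / (\<Prod>j<m. ujac_norm_sq r s (shifted_part m \<tau> j))
      * (alternant m (\<lambda>i. ujac r s (shifted_part m \<tau> i)) y * vandermonde m y * ordered_weight r s m y)"
proof -
  let ?c = "\<Prod>i<m. jacobi_at_1 s (shifted_part m \<tau> i)"
  have c: "?c \<noteq> 0" using jacobi_at_1_nz by simp
  have "multi_jacobi r s m \<tau> y * jacobi_weight r s m y
      = ?c * (alternant m (\<lambda>i. ujac r s (shifted_part m \<tau> i)) y * vandermonde m y * ordered_weight r s m y)"
  proof (cases "decreasing_on m y")
    case True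
    then show ?thesis
      by (simp add: multi_jacobi_def vandermonde_decreasing_nz jacobi_quotient_eq jacobi_weight_eq
          alternant_ujac_quotient power2_eq_square)
  qed (simp add: jacobi_weight_eq ordered_weight_def)
  moreover have "(\<Prod>j<m. 1 / jacobi_norm_sq r s (part \<tau> j + (m - 1 - j)))
      = 1 / (?c * ?c * (\<Prod>j<m. ujac_norm_sq r s (shifted_part m \<tau> j)))"
    unfolding shifted_part_def[symmetric] jacobi_norm_sq_eq
    by (simp add: prod_dividef prod.distrib power2_eq_square)
  ultimately show ?thesis using c by (simp add: multi_jacobi_ones mult.assoc)
qed

section \<open>A summable majorant of the density\<close>

lemma summable_power_gauss:
  fixes A t :: real
  assumes A: "1 \<le> A" and t: "0 < t"
  shows "summable (\<lambda>n. A ^ n * exp (- t * (real n)\<^sup>2))"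
proof (rule summable_comparison_test_ev)
  \<comment> \<open>Beyond N one has n t \<ge> ln A + 1, so the exponent n ln A - t n^2 is at most
    -n.\<close>
  define N where "N = nat \<lceil>(ln A + 1) / t\<rceil>"
  show "eventually (\<lambda>n. norm (A ^ n * exp (- t * (real n)\<^sup>2)) \<le> exp (-1) ^ n) sequentially"
  proof (rule eventually_sequentiallyI)
    fix n assume "N \<le> n"
    then have "(ln A + 1) / t \<le> real n" unfolding N_def by linarith
    then have "ln A + 1 \<le> real n * t" using t by (simp add: pos_divide_le_eq)
    then have "real n * (ln A + 1) \<le> real n * (real n * t)" by (rule mult_left_mono) simp
    then have "real n * ln A + - t * (real n)\<^sup>2 \<le> real n * (-1)" by (simp add: power2_eq_square algebra_simps)
    then have "exp (real n * ln A + - t * (real n)\<^sup>2) \<le> exp (real n * (-1))" by (simp only: exp_le_cancel_iff)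
    moreover have "A ^ n = exp (real n * ln A)" using A by (simp add: exp_of_nat_mult)
    moreover have "exp (real n * (-1)) = exp (-1 :: real) ^ n" by (rule exp_of_nat_mult)
    ultimately have "A ^ n * exp (- t * (real n)\<^sup>2) \<le> exp (-1) ^ n" by (simp only: exp_add)
    then show "norm (A ^ n * exp (- t * (real n)\<^sup>2)) \<le> exp (-1) ^ n" using A by (simp add: abs_mult)
  qed
  show "summable (\<lambda>n. exp (-1 :: real) ^ n)" by (rule summable_geometric) simp
qed

text \<open>Partitions of length at most m inject into m-tuples through their parts, and a product
  of summable functions is summable over all tuples.\<close>

lemma summable_on_partitions_prod:
  fixes f :: "nat \<Rightarrow> real"
  assumes f: "summable f" and nonneg: "\<And>n. 0 \<le> f n"
  shows "(\<lambda>\<tau>. \<Prod>i<m. f (part \<tau> i)) summable_on {\<tau> \<in> partitions. length \<tau> \<le> m}"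
proof -
  let ?K = "{\<tau> \<in> partitions. length \<tau> \<le> m}" and ?e = "\<lambda>\<tau>. restrict (part \<tau>) {..<m}"
  have "f summable_on UNIV" using f nonneg by (simp add: summable_on_UNIV_nonneg_real_iff)
  then have "Infinite_Set_Sum.abs_summable_on f UNIV"
    using nonneg by (simp add: abs_summable_equivalent[symmetric])
  then have "Infinite_Set_Sum.abs_summable_on (\<lambda>g. \<Prod>i<m. f (g i)) (Pi\<^sub>E {..<m} (\<lambda>_. UNIV))"
    by (intro abs_summable_on_prod_PiE) auto
  then have "(\<lambda>g. \<Prod>i<m. f (g i)) summable_on (Pi\<^sub>E {..<m} (\<lambda>_. UNIV))"
    by (simp add: abs_summable_equivalent[symmetric] abs_summable_summable)
  then have "(\<lambda>g. \<Prod>i<m. f (g i)) summable_on (?e ` ?K)"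
    by (rule summable_on_subset_banach) (simp add: PiE_iff image_subset_iff)
  moreover have "inj_on ?e ?K"
  proof (rule inj_onI)
    fix \<tau> \<tau>' assume t: "\<tau> \<in> ?K" "\<tau>' \<in> ?K" and e: "?e \<tau> = ?e \<tau>'"
    have "part \<tau> i = part \<tau>' i" if "i < m" for i using fun_cong[OF e, of i] that by simp
    then show "\<tau> = \<tau>'" using t partition_eqI by blast
  qed
  ultimately have "((\<lambda>g. \<Prod>i<m. f (g i)) \<circ> ?e) summable_on ?K" by (simp add: summable_on_reindex)
  then show ?thesis by (simp add: o_def cong: prod.cong_simp)
qed

lemma abs_alternant_ujac_le:
  assumes y: "\<And>j. j < m \<Longrightarrow> 0 \<le> y j \<and> y j \<le> 1"
  shows "\<bar>alternant m (\<lambda>i. ujac r s (lam i)) y\<bar> \<le> fact m * (\<Prod>i<m. 2 ^ (3 * lam i + r + s))"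
proof -
  have "\<bar>alternant m (\<lambda>i. ujac r s (lam i)) y\<bar>
      \<le> (\<Sum>p | p permutes {..<m}. \<bar>of_int (sign p) * (\<Prod>j<m. ujac r s (lam (p j)) (y j))\<bar>)"
    unfolding alternant_def by (rule sum_abs)
  also have "\<dots> \<le> (\<Sum>p | p permutes {..<m}. \<Prod>i<m. 2 ^ (3 * lam i + r + s))"
  proof (rule sum_mono)
    fix p assume "p \<in> {p. p permutes {..<m}}"
    then have p: "p permutes {..<m}" by simp
    have "\<bar>of_int (sign p) * (\<Prod>j<m. ujac r s (lam (p j)) (y j))\<bar> = (\<Prod>j<m. \<bar>ujac r s (lam (p j)) (y j)\<bar>)"
      by (cases p rule: sign_cases) (simp_all add: abs_prod)
    also have "\<dots> \<le> (\<Prod>j<m. 2 ^ (3 * lam (p j) + r + s))"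
      by (intro prod_mono conjI abs_ujac_le) (use y in auto)
    also have "\<dots> = (\<Prod>i<m. 2 ^ (3 * lam i + r + s))"
      using prod.permute[OF p, of "\<lambda>i. 2 ^ (3 * lam i + r + s) :: real"] by (simp add: o_def)
    finally show "\<bar>of_int (sign p) * (\<Prod>j<m. ujac r s (lam (p j)) (y j))\<bar> \<le> (\<Prod>i<m. 2 ^ (3 * lam i + r + s))" .
  qed
  also have "\<dots> = fact m * (\<Prod>i<m. 2 ^ (3 * lam i + r + s))"
    using card_permutations[of "{..<m}" m] by simp
  finally show ?thesis .
qed

lemma abs_vandermonde_le:
  assumes y: "\<And>j. j < m \<Longrightarrow> 0 \<le> y j \<and> y j \<le> 1"
  shows "\<bar>vandermonde m y\<bar> \<le> 1"
proof -
  have "\<bar>y i - y j\<bar> \<le> 1" if "j < m" "i < j" for i j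
    using y[of i] y[of j] that by linarith
  then show ?thesis
    unfolding vandermonde_def abs_prod by (intro prod_le_1 conjI prod_nonneg) auto
qed

lemma jacobi_eigenvalue_le: "jacobi_eigenvalue r s k + 1 \<le> 2 ^ (2 * k + r + s + 1)"
proof -
  have "k * (k + r + s + 1) + 1 \<le> (k + 1) * (k + r + s + 1)" by simp
  also have "\<dots> \<le> 2 ^ k * 2 ^ (k + r + s + 1)"
    using pow2_ge_Suc[of k] pow2_ge_Suc[of "k + r + s + 1"] by (intro mult_mono) auto
  also have "\<dots> = 2 ^ (2 * k + r + s + 1)" by (simp flip: power_add)
  finally have "real (k * (k + r + s + 1) + 1) \<le> real (2 ^ (2 * k + r + s + 1))" by (rule of_nat_mono)
  then show ?thesis by (simp add: jacobi_eigenvalue_def algebra_simps)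
qed

text \<open>For nonnegative x and z, |x - z| \<le> (x + 1)(z + 1), which separates the two rows of
  each factor. Missing pairs are filled in with factors at least 1, so the bound becomes a product
  over rows.\<close>

lemma abs_ujac_at_ones_le:
  "\<bar>ujac_at_ones r s m lam\<bar> \<le> \<bar>\<Prod>l<m. (-1) ^ l / (pochhammer (real s + 1) l * fact l)\<bar>
     * (\<Prod>i<m. (2 ^ (2 * lam i + r + s + 1)) ^ (2 * m))"
proof -
  define q :: "nat \<Rightarrow> real" where "q i = 2 ^ (2 * lam i + r + s + 1)" for i
  let ?k = "\<lambda>i. jacobi_eigenvalue r s (lam i)"
  have q1: "1 \<le> q i" for i unfolding q_def by (rule one_le_power) simp
  have k0: "0 \<le> ?k i" for i by (simp add: jacobi_eigenvalue_def)
  have kq: "?k i + 1 \<le> q i" for i unfolding q_def by (rule jacobi_eigenvalue_le)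
  have d: "\<bar>?k j - ?k a\<bar> \<le> q j * q a" for j a
  proof -
    have "\<bar>?k j - ?k a\<bar> \<le> (?k j + 1) * (?k a + 1)"
    proof -
      have "\<bar>x - z\<bar> \<le> (x + 1) * (z + 1)" if "0 \<le> x" "0 \<le> z" for x z :: real
        using that mult_nonneg_nonneg[OF that] by (simp only: distrib_left distrib_right abs_le_iff) linarith
      then show ?thesis using k0 by blast
    qed
    also have "\<dots> \<le> q j * q a" using kq k0 q1 by (intro mult_mono) (auto intro: add_nonneg_nonneg order_trans[OF zero_le_one])
    finally show ?thesis .
  qed
  have "\<bar>\<Prod>j<m. \<Prod>a<j. ?k j - ?k a\<bar> \<le> (\<Prod>j<m. \<Prod>a<j. q j * q a)"
    unfolding abs_prod by (intro prod_mono conjI prod_nonneg ballI d) auto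
  also have "\<dots> \<le> (\<Prod>j<m. \<Prod>a<m. q j * q a)"
  proof (intro prod_mono conjI)
    fix j assume j: "j \<in> {..<m}"
    have "1 \<le> q j * q a" for a using mult_mono[OF q1[of j] q1[of a]] q1[of j] by simp
    then show "(\<Prod>a<j. q j * q a) \<le> (\<Prod>a<m. q j * q a)"
      by (intro prod_mono2) (use j in \<open>auto intro: order_trans[OF zero_le_one]\<close>)
    show "0 \<le> (\<Prod>a<j. q j * q a)"
      using q1 by (intro prod_nonneg ballI mult_nonneg_nonneg) (auto intro: order_trans[OF zero_le_one])
  qed
  also have "\<dots> = (\<Prod>i<m. q i ^ (2 * m))"
    by (simp add: prod.distrib prod_power_distrib power_add mult_2)
  finally show ?thesis
    unfolding ujac_at_ones_def abs_mult q_def by (intro mult_left_mono) auto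
qed

text \<open>The scalar left in the term of \<tau> after the cancellation in
  \<open>jacobi_density_term\<close>. It is also used at t = 0, where the empty partition gives the
  stationary law.\<close>

definition term_coeff :: "nat \<Rightarrow> nat \<Rightarrow> nat \<Rightarrow> real \<Rightarrow> nat list \<Rightarrow> real" where
  "term_coeff r s m t \<tau> = exp (- real (nu r s m \<tau>) * t) * ujac_at_ones r s m (shifted_part m \<tau>)
      / (\<Prod>j<m. ujac_norm_sq r s (shifted_part m \<tau> j))"

text \<open>Bounds that are exponential in the degrees suffice, since \<open>exp (- nu t)\<close> decays like a
  Gaussian in the parts.\<close>

theorem density_majorant:
  assumes t: "0 < t"
  shows "\<exists>B. B summable_on {\<tau> \<in> partitions. length \<tau> \<le> m} \<and>
    (\<forall>\<tau> y. (\<forall>j<m. 0 \<le> y j \<and> y j \<le> 1) \<longrightarrow>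
      \<bar>term_coeff r s m t \<tau> * (alternant m (\<lambda>i. ujac r s (shifted_part m \<tau> i)) y * vandermonde m y)\<bar> \<le> B \<tau>)"
proof -
  \<comment> \<open>For a row of degree k the three factors bound its share in the value at (1, ...,
    1), in the inverse norms and in the alternant at y.\<close>
  define b :: "nat \<Rightarrow> real" where
    "b k = (2 ^ (2 * k + r + s + 1)) ^ (2 * m) * 2 ^ (4 * k + 2 * r + 3 * s) * 2 ^ (3 * k + r + s)" for k
  define g where "g = \<bar>\<Prod>l<m. (-1) ^ l / (pochhammer (real s + 1) l * fact l)\<bar>"
  \<comment> \<open>A shifted part exceeds the part by less than m, so n + m bounds the
    degree.\<close>
  define f where "f n = b (n + m) * exp (- t * (real n)\<^sup>2)" for n
  define B where "B \<tau> = fact m * g * (\<Prod>i<m. f (part \<tau> i))" for \<tau>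
  have b0: "0 \<le> b k" for k by (simp add: b_def)
  have b_mono: "b k \<le> b l" if "k \<le> l" for k l
    unfolding b_def by (intro mult_mono power_mono power_increasing) (use that in auto)
  \<comment> \<open>Raising k by 1 adds 2 * 2m, 4 and 3 to the exponents of the three powers of
    2.\<close>
  have "b (n + m) = b m * (2 ^ (4 * m + 7)) ^ n" for n
    unfolding b_def power_mult[symmetric] power_add[symmetric] mult.assoc
    by (simp add: algebra_simps flip: power_add power_mult)
  then have fe: "f = (\<lambda>n. b m * ((2 ^ (4 * m + 7)) ^ n * exp (- t * (real n)\<^sup>2)))"
    by (intro ext) (simp add: f_def)
  have "summable f"
    unfolding fe by (intro summable_mult summable_power_gauss one_le_power t) simp
  moreover have "0 \<le> f n" for n by (simp add: f_def b0)
  ultimately have "B summable_on {\<tau> \<in> partitions. length \<tau> \<le> m}"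
    unfolding B_def by (intro summable_on_cmult_right summable_on_partitions_prod)
  moreover have "\<bar>term_coeff r s m t \<tau> * (alternant m (\<lambda>i. ujac r s (shifted_part m \<tau> i)) y * vandermonde m y)\<bar> \<le> B \<tau>"
    if y: "\<forall>j<m. 0 \<le> y j \<and> y j \<le> 1" for \<tau> y
  proof -
    let ?l = "shifted_part m \<tau>"
    have e: "exp (- real (nu r s m \<tau>) * t) \<le> (\<Prod>i<m. exp (- t * (real (part \<tau> i))\<^sup>2))"
    proof -
      have "(\<Sum>i<m. (part \<tau> i)\<^sup>2) \<le> nu r s m \<tau>"
        unfolding nu_def power2_eq_square by (intro sum_mono mult_mono) auto
      then have "(\<Sum>i<m. (real (part \<tau> i))\<^sup>2) \<le> real (nu r s m \<tau>)"
        by (metis (mono_tags, lifting) of_nat_le_iff of_nat_power of_nat_sum sum.cong)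
      then have "- real (nu r s m \<tau>) * t \<le> - t * (\<Sum>i<m. (real (part \<tau> i))\<^sup>2)"
        using t by (simp add: mult.commute)
      then show ?thesis by (simp add: exp_sum[symmetric] sum_distrib_left)
    qed
    have n: "1 / (\<Prod>j<m. ujac_norm_sq r s (?l j)) \<le> (\<Prod>j<m. 2 ^ (4 * ?l j + 2 * r + 3 * s))"
      "0 \<le> 1 / (\<Prod>j<m. ujac_norm_sq r s (?l j))"
    proof -
      have "(\<Prod>j<m. 1 / ujac_norm_sq r s (?l j)) \<le> (\<Prod>j<m. 2 ^ (4 * ?l j + 2 * r + 3 * s))"
        using ujac_norm_sq_pos by (intro prod_mono conjI inverse_ujac_norm_sq_le) (auto intro: less_imp_le)
      then show "1 / (\<Prod>j<m. ujac_norm_sq r s (?l j)) \<le> (\<Prod>j<m. 2 ^ (4 * ?l j + 2 * r + 3 * s))"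
        by (simp add: prod_dividef)
      show "0 \<le> 1 / (\<Prod>j<m. ujac_norm_sq r s (?l j))"
        by (intro divide_nonneg_nonneg prod_nonneg ballI less_imp_le[OF ujac_norm_sq_pos]) simp
    qed
    have "\<bar>term_coeff r s m t \<tau> * (alternant m (\<lambda>i. ujac r s (?l i)) y * vandermonde m y)\<bar>
      = exp (- real (nu r s m \<tau>) * t) * \<bar>ujac_at_ones r s m ?l\<bar> * (1 / (\<Prod>j<m. ujac_norm_sq r s (?l j)))
        * \<bar>alternant m (\<lambda>i. ujac r s (?l i)) y\<bar> * \<bar>vandermonde m y\<bar>"
      using n(2) unfolding term_coeff_def by (simp add: abs_mult)
    also have "\<dots> \<le> (\<Prod>i<m. exp (- t * (real (part \<tau> i))\<^sup>2))
        * (g * (\<Prod>i<m. (2 ^ (2 * ?l i + r + s + 1)) ^ (2 * m))) * (\<Prod>j<m. 2 ^ (4 * ?l j + 2 * r + 3 * s))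
        * (fact m * (\<Prod>i<m. 2 ^ (3 * ?l i + r + s))) * 1"
      unfolding g_def
      by (intro mult_mono e n abs_ujac_at_ones_le abs_alternant_ujac_le abs_vandermonde_le
          mult_nonneg_nonneg prod_nonneg abs_ge_zero) (use y in auto)
    also have "\<dots> = fact m * g * (\<Prod>i<m. b (?l i) * exp (- t * (real (part \<tau> i))\<^sup>2))"
      unfolding b_def prod.distrib by (simp only: mult_ac mult_1)
    also have "\<dots> \<le> B \<tau>"
      unfolding B_def f_def
      by (intro mult_left_mono prod_mono conjI mult_right_mono b_mono mult_nonneg_nonneg b0)
        (auto simp: g_def shifted_part_def)
    finally show ?thesis .
  qed
  ultimately show ?thesis by blast
qed

section \<open>Trace powers and determinants from the eigenvalues\<close>

lemma upper_triangular_mult_diag: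
  fixes A B :: "'a::comm_ring_1 mat"
  assumes A: "A \<in> carrier_mat n n" and B: "B \<in> carrier_mat n n"
    and uA: "upper_triangular A" and uB: "upper_triangular B"
  shows "upper_triangular (A * B)"
    and "i < n \<Longrightarrow> (A * B) $$ (i,i) = A $$ (i,i) * B $$ (i,i)"
proof -
  have e: "(A * B) $$ (i,j) = (\<Sum>k\<in>{0..<n}. A $$ (i,k) * B $$ (k,j))" if "i < n" "j < n" for i j
    using A B that by (simp add: scalar_prod_def)
  show "upper_triangular (A * B)"
  proof (rule upper_triangularI)
    fix i j assume ij: "j < i" "i < dim_row (A * B)"
    then have lt: "i < n" "j < n" using A by auto
    have "A $$ (i,k) * B $$ (k,j) = 0" if "k \<in> {0..<n}" for k
      using that ij lt A B uA uB by (cases "k < i") (auto simp: upper_triangular_def)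
    then show "(A * B) $$ (i,j) = 0" using e[OF lt] by simp
  qed
  assume i: "i < n"
  have "(\<Sum>k\<in>{0..<n}. A $$ (i,k) * B $$ (k,i)) = (\<Sum>k\<in>{i}. A $$ (i,k) * B $$ (k,i))"
  proof (intro sum.mono_neutral_right ballI)
    fix k assume "k \<in> {0..<n} - {i}"
    then show "A $$ (i,k) * B $$ (k,i) = 0"
      using i A B uA uB by (cases "k < i") (auto simp: upper_triangular_def)
  qed (use i in auto)
  then show "(A * B) $$ (i,i) = A $$ (i,i) * B $$ (i,i)" using e[OF i i] by simp
qed

lemma upper_triangular_pow_diag:
  fixes A :: "'a::comm_ring_1 mat"
  assumes A: "A \<in> carrier_mat n n" and uA: "upper_triangular A"
  shows "upper_triangular (A ^\<^sub>m k) \<and> (\<forall>i<n. (A ^\<^sub>m k) $$ (i,i) = (A $$ (i,i)) ^ k)"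
proof (induction k)
  case 0
  then show ?case using A by (auto simp: upper_triangular_def)
next
  case (Suc k)
  have C: "A ^\<^sub>m k \<in> carrier_mat n n" using A by simp
  show ?case using upper_triangular_mult_diag[OF C A _ uA] Suc by (auto simp: power_Suc2 simp del: power_Suc)
qed

lemma trace_mult_commute:
  fixes A B :: "'a::comm_ring_1 mat"
  assumes A: "A \<in> carrier_mat n n" and B: "B \<in> carrier_mat n n"
  shows "(\<Sum>i<n. (A * B) $$ (i,i)) = (\<Sum>i<n. (B * A) $$ (i,i))"
proof -
  have e: "(X * Y) $$ (i,i) = (\<Sum>k<n. X $$ (i,k) * Y $$ (k,i))"
    if "X \<in> carrier_mat n n" "Y \<in> carrier_mat n n" "i < n" for i and X Y :: "'a mat"
    using that by (simp add: scalar_prod_def lessThan_atLeast0)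
  have "(\<Sum>i<n. (A * B) $$ (i,i)) = (\<Sum>i<n. \<Sum>k<n. A $$ (i,k) * B $$ (k,i))"
    using e[OF A B] by simp
  also have "\<dots> = (\<Sum>k<n. \<Sum>i<n. B $$ (k,i) * A $$ (i,k))"
    by (subst sum.swap) (simp add: mult.commute)
  also have "\<dots> = (\<Sum>i<n. (B * A) $$ (i,i))" using e[OF B A] by simp
  finally show ?thesis .
qed

text \<open>Schur decomposition with the prescribed list of eigenvalues: powers of a triangular
  matrix have the powers of its diagonal entries on the diagonal, and the trace is invariant under
  similarity.\<close>

lemma ordered_eigenvalues_trace_pow:
  assumes A: "A \<in> carrier_mat m m" and ev: "ordered_eigenvalues m A y"
  shows "(\<Sum>i<m. (A ^\<^sub>m n) $$ (i,i)) = complex_of_real (\<Sum>i<m. y i ^ n)"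
proof -
  define es where "es = map (\<lambda>i. complex_of_real (y i)) [0..<m]"
  have cp: "char_poly A = (\<Prod>e\<leftarrow>es. [:- e, 1:])"
    using ev unfolding ordered_eigenvalues_def es_def
    by (simp add: prod.list_conv_set_nth lessThan_atLeast0)
  obtain B P Q where sd: "schur_decomposition A es = (B, P, Q)" by (metis prod_cases3)
  note S = schur_decomposition[OF A cp sd]
  note W = similar_mat_witD2[OF A conjunct1[OF S]]
  have BC: "B ^\<^sub>m n \<in> carrier_mat m m" using W by simp
  have d: "B $$ (i,i) = complex_of_real (y i)" if "i < m" for i
  proof -
    have "diag_mat B ! i = es ! i" using S by simp
    then show ?thesis using that W(5) by (simp add: diag_mat_def es_def)
  qed
  have "(\<Sum>i<m. (A ^\<^sub>m n) $$ (i,i)) = (\<Sum>i<m. (P * (B ^\<^sub>m n * Q)) $$ (i,i))"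
    using similar_mat_wit_pow_id[OF conjunct1[OF S], of n] W BC by (simp add: assoc_mult_mat[of P m m _ m _ m])
  also have "\<dots> = (\<Sum>i<m. ((B ^\<^sub>m n * Q) * P) $$ (i,i))"
    by (rule trace_mult_commute) (use W BC in auto)
  also have "(B ^\<^sub>m n * Q) * P = B ^\<^sub>m n"
    using W BC by (simp add: assoc_mult_mat[of _ m m _ m _ m])
  also have "(\<Sum>i<m. (B ^\<^sub>m n) $$ (i,i)) = (\<Sum>i<m. complex_of_real (y i) ^ n)"
    using upper_triangular_pow_diag[OF W(5)] S d by simp
  finally show ?thesis by simp
qed

text \<open>With z = -1/\<rho> the matrix is -\<rho> (z - A), so its determinant is the
  characteristic polynomial at z times (-\<rho>)^m.\<close>

lemma ordered_eigenvalues_det: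
  assumes A: "A \<in> carrier_mat m m" and ev: "ordered_eigenvalues m A y" and rho: "\<rho> \<noteq> 0"
  shows "Determinant.det (1\<^sub>m m + complex_of_real \<rho> \<cdot>\<^sub>m A) = complex_of_real (\<Prod>i<m. 1 + \<rho> * y i)"
proof -
  define z where "z = - 1 / complex_of_real \<rho>"
  have "1\<^sub>m m + complex_of_real \<rho> \<cdot>\<^sub>m A = (- complex_of_real \<rho>) \<cdot>\<^sub>m (z \<cdot>\<^sub>m 1\<^sub>m m + (- A))"
    by (rule eq_matI) (use A rho in \<open>auto simp: z_def field_simps\<close>)
  moreover have "- char_matrix A z = z \<cdot>\<^sub>m 1\<^sub>m m + (- A)"
    by (rule eq_matI) (use A in \<open>auto simp: char_matrix_def\<close>)
  ultimately have "Determinant.det (1\<^sub>m m + complex_of_real \<rho> \<cdot>\<^sub>m A)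
      = (- complex_of_real \<rho>) ^ m * poly (char_poly A) z"
    using A by (simp add: char_poly_matrix[OF A])
  also have "\<dots> = (\<Prod>i<m. (- complex_of_real \<rho>) * (z - y i))"
    using ev unfolding ordered_eigenvalues_def
    by (simp only: poly_prod prod.distrib prod_constant card_lessThan) simp
  also have "\<dots> = (\<Prod>i<m. complex_of_real (1 + \<rho> * y i))"
    using rho by (intro prod.cong) (auto simp: z_def field_simps)
  finally show ?thesis by simp
qed

section \<open>Power sums against the terms of the density\<close>

text \<open>The degrees of the empty partition. On {..<m} this is an involution, used to pass
  between row indices and degrees in both directions.\<close>

definition staircase :: "nat \<Rightarrow> nat \<Rightarrow> nat" where
  "staircase m i = m - 1 - i"

lemma shifted_part_Nil: "shifted_part m [] = staircase m"
  by (rule ext) (simp add: shifted_part_def staircase_def part_def)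

lemma ujac_at_ones_permute:
  assumes "p permutes {..<m}"
  shows "ujac_at_ones r s m (\<lambda>i. lam (p i)) = of_int (sign p) * ujac_at_ones r s m lam"
  using alternant_permute_rows[OF assms, of "\<lambda>i l. ujac_coeff r s (lam i) l" "\<lambda>l. l"]
  by (simp add: alternant_ujac_coeff)

lemma ujac_at_ones_cong:
  "(\<And>i. i < m \<Longrightarrow> lam i = mu i) \<Longrightarrow> ujac_at_ones r s m lam = ujac_at_ones r s m mu"
  unfolding alternant_ujac_coeff[symmetric] by (rule alternant_cong) simp

lemma jacobi_eigenvalue_strict_mono: "j < k \<Longrightarrow> jacobi_eigenvalue r s j < jacobi_eigenvalue r s k"
  unfolding jacobi_eigenvalue_def by (intro mult_strict_mono) auto

lemma ujac_at_ones_nz: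
  assumes "inj_on lam {..<m}"
  shows "ujac_at_ones r s m lam \<noteq> 0"
proof -
  have "jacobi_eigenvalue r s (lam j) - jacobi_eigenvalue r s (lam a) \<noteq> 0" if "j < m" "a < j" for j a
  proof -
    have "lam j \<noteq> lam a" using inj_onD[OF assms, of j a] that by auto
    then show ?thesis
      using jacobi_eigenvalue_strict_mono[of "lam j" "lam a" r s] jacobi_eigenvalue_strict_mono[of "lam a" "lam j" r s]
      by (cases "lam j < lam a") auto
  qed
  moreover have "pochhammer (real s + 1) l \<noteq> 0" for l by (simp add: pochhammer_real_fact)
  ultimately show ?thesis by (simp add: ujac_at_ones_def)
qed

lemma reverse_permutes: "(\<lambda>i. if i < m then m - 1 - i else i) permutes {..<m::nat}"
proof (rule bij_imp_permutes)
  have "inj_on (\<lambda>i. if i < m then m - 1 - i else i) {..<m}" by (rule inj_onI) (auto split: if_splits)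
  then show "bij_betw (\<lambda>i. if i < m then m - 1 - i else i) {..<m} {..<m}"
    unfolding bij_betw_def by (intro conjI endo_inj_surj) auto
qed auto

text \<open>In the variable 1 - u the degrees are 0, ..., m-1, so the alternant is the product of
  the leading coefficients times the Vandermonde product. By \<open>ujac_coeff_eq_prod\<close> that
  product is the value at (1, ..., 1), and reversing the rows changes both by the same sign.\<close>

theorem alternant_ujac_staircase:
  "alternant m (\<lambda>i. ujac r s (staircase m i)) y = ujac_at_ones r s m (staircase m) * vandermonde m y"
proof -
  define p where "p = (\<lambda>i. if i < m then m - 1 - i else i)"
  have p: "p permutes {..<m}" unfolding p_def by (rule reverse_permutes)
  define c where "c l = ujac_coeff r s l l" for l
  have cnz: "c l \<noteq> 0" for l
  proof -
    have "jacobi_eigenvalue r s l - jacobi_eigenvalue r s a \<noteq> 0" if "a < l" for a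
      using jacobi_eigenvalue_strict_mono[OF that, of r s] by simp
    then show ?thesis by (simp add: c_def ujac_coeff_eq_prod pochhammer_real_fact)
  qed
  define q where "q l = Polynomial.smult (inverse (c l)) (ujac_poly r s l)" for l
  have deg: "degree (ujac_poly r s l) = l" for l
    by (rule antisym[OF degree_le le_degree]) (use cnz[of l] in \<open>auto simp: coeff_ujac_poly c_def ujac_coeff_eq_0\<close>)
  have q1: "degree (q l) = l" for l using cnz by (simp add: q_def deg)
  have q2: "lead_coeff (q l) = 1" for l using cnz by (simp add: q_def deg coeff_ujac_poly c_def)
  have "alternant m (\<lambda>i. ujac r s i) y = alternant m (\<lambda>i x. c i * poly (q i) x) (\<lambda>j. 1 - y j)"
    by (rule alternant_cong) (use cnz in \<open>simp add: q_def poly_ujac_poly\<close>)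
  also have "\<dots> = (\<Prod>i<m. c i) * vandermonde m y"
    unfolding alternant_scale_rows by (subst alternant_monic[OF q2 q1]) (simp add: vandermonde_def)
  also have "(\<Prod>i<m. c i) = ujac_at_ones r s m (\<lambda>i. i)"
  proof -
    have "(\<Prod>l<m. c l) = (\<Prod>l<m. (-1) ^ l / (pochhammer (real s + 1) l * fact l))
        * (\<Prod>l<m. \<Prod>a<l. jacobi_eigenvalue r s l - jacobi_eigenvalue r s a)"
      unfolding c_def ujac_coeff_eq_prod prod.distrib ..
    then show ?thesis by (simp only: ujac_at_ones_def)
  qed
  finally have id: "alternant m (\<lambda>i. ujac r s i) y = ujac_at_ones r s m (\<lambda>i. i) * vandermonde m y" .
  have "alternant m (\<lambda>i. ujac r s (staircase m i)) y = alternant m (\<lambda>i. ujac r s (p i)) y"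
    by (rule alternant_cong) (simp add: p_def staircase_def)
  also have "\<dots> = of_int (sign p) * (ujac_at_ones r s m (\<lambda>i. i) * vandermonde m y)"
    using alternant_permute_rows[OF p, of "ujac r s" y] by (simp add: id)
  also have "of_int (sign p) * ujac_at_ones r s m (\<lambda>i. i) = ujac_at_ones r s m (staircase m)"
    unfolding ujac_at_ones_permute[OF p, symmetric] by (rule ujac_at_ones_cong) (simp add: p_def staircase_def)
  then have "of_int (sign p) * (ujac_at_ones r s m (\<lambda>i. i) * vandermonde m y)
      = ujac_at_ones r s m (staircase m) * vandermonde m y"
    by (simp add: mult.assoc[symmetric])
  finally show ?thesis .
qed

lemma inj_staircase: "inj_on (staircase m) {..<m}"
  by (rule inj_onI) (auto simp: staircase_def)

text \<open>The shifted parts of this hook are, up to order, the staircase with entry \<open>i\<close> replaced by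
  \<open>k \<ge> m\<close>.\<close>

definition hook_of :: "nat \<Rightarrow> nat \<Rightarrow> nat \<Rightarrow> nat list" where
  "hook_of m i k = (k + 1 - m) # replicate i 1"

lemma hook_of_partition: "m \<le> k \<Longrightarrow> hook_of m i k \<in> partitions"
  by (auto simp: hook_of_def partitions_def sorted_wrt_iff_nth_less nth_Cons')

lemma length_hook_of: "length (hook_of m i k) = Suc i"
  by (simp add: hook_of_def)

lemma shifted_part_hook_of:
  assumes i: "i < m" and k: "m \<le> k"
  shows "\<exists>p. p permutes {..<m} \<and> (\<forall>j<m. ((staircase m)(i := k)) j = shifted_part m (hook_of m i k) (p j))"
proof -
  \<comment> \<open>The new degree k exceeds every other entry, so row i moves to the front. The i
    rows before it move one place down, which makes each of their parts 1.\<close>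
  define p where "p j = (if j < i then Suc j else if j = i then 0 else j)" for j
  have inj: "inj_on p {..<m}" by (rule inj_onI) (auto simp: p_def split: if_splits)
  have "p permutes {..<m}"
  proof (rule bij_imp_permutes)
    show "bij_betw p {..<m} {..<m}" unfolding bij_betw_def
      by (intro conjI endo_inj_surj inj) (use i in \<open>auto simp: p_def\<close>)
  qed (use i in \<open>auto simp: p_def\<close>)
  moreover have "((staircase m)(i := k)) j = shifted_part m (hook_of m i k) (p j)" if "j < m" for j
    using that i k by (auto simp: p_def staircase_def shifted_part_def hook_of_def part_def nth_Cons')
  ultimately show ?thesis by blast
qed

lemma power_sum_vandermonde_expansion:
  "(\<Sum>j<m. y j ^ n) * (ujac_at_ones r s m (staircase m) * vandermonde m y)
     = (\<Sum>i<m. \<Sum>k\<le>n + staircase m i. ujac_conn r s n (staircase m i) k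
          * alternant m (\<lambda>a. ujac r s (((staircase m)(i := k)) a)) y)"
proof -
  let ?F = "\<lambda>i. ujac r s (staircase m i)"
  have upd: "?F(i := ujac r s k) = (\<lambda>a. ujac r s (((staircase m)(i := k)) a))" for i k
    by (rule ext) simp
  have "(\<Sum>j<m. y j ^ n) * alternant m ?F y = (\<Sum>i<m. alternant m (?F(i := (\<lambda>x. x ^ n * ?F i x))) y)"
    by (rule alternant_mult_power_sum)
  also have "\<dots> = (\<Sum>i<m. \<Sum>k\<le>n + staircase m i. ujac_conn r s n (staircase m i) k
      * alternant m (?F(i := ujac r s k)) y)"
    by (intro sum.cong refl) (simp only: power_mult_ujac_expansion alternant_row_sum lessThan_iff)
  finally show ?thesis unfolding upd alternant_ujac_staircase .
qed

lemma nu_Nil: "nu r s m [] = 0"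
  by (simp add: nu_def part_def)

text \<open>The weight of giving row i the degree k, relative to the staircase. The value 0 reflects
  a repeated row, and the value 1 an unchanged one.\<close>

definition hook_factor :: "nat \<Rightarrow> nat \<Rightarrow> nat \<Rightarrow> real \<Rightarrow> nat \<Rightarrow> nat \<Rightarrow> real" where
  "hook_factor r s m t i k = (if m \<le> k then exp (- real (nu r s m (hook_of m i k)) * t)
        * ujac_at_ones r s m ((staircase m)(i := k)) / ujac_at_ones r s m (staircase m)
      else if k = staircase m i then 1 else 0)"

text \<open>Sorting the rows of \<open>lam\<close> produces a sign, which is absorbed by evaluating
  \<open>ujac_at_ones\<close> at the unsorted sequence; the norms cancel against those in
  \<open>term_coeff\<close>.\<close>

lemma term_coeff_mult_integral:
  fixes lam :: "nat \<Rightarrow> nat"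
  assumes tau: "\<tau> \<in> partitions" "length \<tau> \<le> m" and sig: "\<sigma> \<in> partitions" "length \<sigma> \<le> m"
    and p: "p permutes {..<m}" and lam: "\<And>j. j < m \<Longrightarrow> lam j = shifted_part m \<sigma> (p j)"
  shows "term_coeff r s m t \<tau>
      * (LINT y|lebesgue_pi m. alternant m (\<lambda>a. ujac r s (lam a)) y * alternant m (\<lambda>i. ujac r s (shifted_part m \<tau> i)) y
          * ordered_weight r s m y)
    = (if \<tau> = \<sigma> then exp (- real (nu r s m \<sigma>) * t) * ujac_at_ones r s m lam else 0)"
proof -
  have "alternant m (\<lambda>a. ujac r s (lam a)) y = of_int (sign p) * alternant m (\<lambda>i. ujac r s (shifted_part m \<sigma> i)) y" for y
    unfolding alternant_permute_rows[OF p, of "\<lambda>i. ujac r s (shifted_part m \<sigma> i)", symmetric]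
    by (rule alternant_cong) (simp add: lam)
  then have "(LINT y|lebesgue_pi m. alternant m (\<lambda>a. ujac r s (lam a)) y * alternant m (\<lambda>i. ujac r s (shifted_part m \<tau> i)) y
          * ordered_weight r s m y)
      = of_int (sign p) * (LINT y|lebesgue_pi m. alternant m (\<lambda>i. ujac r s (shifted_part m \<sigma> i)) y
          * alternant m (\<lambda>i. ujac r s (shifted_part m \<tau> i)) y * ordered_weight r s m y)"
    by (simp add: mult.assoc)
  also have "\<dots> = of_int (sign p) * (if \<sigma> = \<tau> then \<Prod>i<m. ujac_norm_sq r s (shifted_part m \<sigma> i) else 0)"
    unfolding ujac_alternant_orthogonal[OF decreasing_shifted_part[OF sig(1)] decreasing_shifted_part[OF tau(1)]]
      shifted_part_inject[OF sig tau] ..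
  finally have I: "(LINT y|lebesgue_pi m. alternant m (\<lambda>a. ujac r s (lam a)) y
        * alternant m (\<lambda>i. ujac r s (shifted_part m \<tau> i)) y * ordered_weight r s m y) = \<dots>" .
  have "ujac_at_ones r s m lam = ujac_at_ones r s m (\<lambda>i. shifted_part m \<sigma> (p i))"
    by (rule ujac_at_ones_cong) (simp add: lam)
  then have E: "ujac_at_ones r s m lam = of_int (sign p) * ujac_at_ones r s m (shifted_part m \<sigma>)"
    using ujac_at_ones_permute[OF p, of r s "shifted_part m \<sigma>"] by simp
  have "(\<Prod>i<m. ujac_norm_sq r s (shifted_part m \<sigma> i)) \<noteq> 0"
    using ujac_norm_sq_pos[of r s] by (simp add: less_imp_neq[symmetric])
  then show ?thesis unfolding I E term_coeff_def by simp
qed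

lemma term_coeff_mult_integral_upd:
  assumes tau: "\<tau> \<in> partitions" "length \<tau> \<le> m" and i: "i < m"
  shows "term_coeff r s m t \<tau>
      * (LINT y|lebesgue_pi m. alternant m (\<lambda>a. ujac r s (((staircase m)(i := k)) a)) y
          * alternant m (\<lambda>i. ujac r s (shifted_part m \<tau> i)) y * ordered_weight r s m y)
    = (if \<tau> = (if m \<le> k then hook_of m i k else [])
       then hook_factor r s m t i k * ujac_at_ones r s m (staircase m) else 0)"
proof -
  have nz: "ujac_at_ones r s m (staircase m) \<noteq> 0" by (rule ujac_at_ones_nz[OF inj_staircase])
  consider "m \<le> k" | "k < m" "k = staircase m i" | "k < m" "k \<noteq> staircase m i" by linarith
  then show ?thesis
  proof cases
    case 1
    obtain p where p: "p permutes {..<m}"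
      "\<And>j. j < m \<Longrightarrow> ((staircase m)(i := k)) j = shifted_part m (hook_of m i k) (p j)"
      using shifted_part_hook_of[OF i 1] by blast
    have "length (hook_of m i k) \<le> m" using i by (simp add: length_hook_of)
    note T = term_coeff_mult_integral[OF tau hook_of_partition[OF 1] this p]
    show ?thesis
      using 1 nz by (subst T) (simp_all add: hook_factor_def)
  next
    case 2
    have e: "(staircase m)(i := k) = staircase m" using 2 by auto
    have "[] \<in> partitions" by (simp add: partitions_def)
    then show ?thesis
      unfolding e using term_coeff_mult_integral[OF tau _ _ permutes_id, of "[]" "staircase m" r s t] 2
      by (simp add: hook_factor_def shifted_part_Nil nu_Nil)
  next
    case 3
    \<comment> \<open>The other row of degree k is the one with index m - 1 - k.\<close>
    then have "staircase m k < m" "staircase m k \<noteq> i" "staircase m (staircase m k) = k"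
      using i by (auto simp: staircase_def)
    then have "alternant m (\<lambda>a. ujac r s (((staircase m)(i := k)) a)) y = 0" for y
      using i by (intro alternant_eq_rows[of i m "staircase m k"]) auto
    then show ?thesis using 3 by (simp add: hook_factor_def)
  qed
qed

lemma measurable_alternant_ujac [measurable]:
  "alternant m (\<lambda>i. ujac r s (lam i)) \<in> borel_measurable (lebesgue_pi m)"
proof -
  have "(\<lambda>y. ujac r s k (y j)) \<in> borel_measurable (lebesgue_pi m)" if "j < m" for j k
    by (rule measurable_compose[OF measurable_component_singleton])
      (use that in \<open>auto simp: ujac_def\<close>)
  then show ?thesis unfolding alternant_def [abs_def]
    by (intro borel_measurable_sum borel_measurable_times borel_measurable_const borel_measurable_prod) auto
qed

lemma measurable_vandermonde [measurable]: "vandermonde m \<in> borel_measurable (lebesgue_pi m)"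
  unfolding vandermonde_def [abs_def]
  by (intro borel_measurable_prod borel_measurable_diff measurable_component_singleton) auto

lemma measurable_component_power_sum [measurable]:
  "(\<lambda>y. \<Sum>j<m. y j ^ n) \<in> borel_measurable (lebesgue_pi m)" for n :: nat
  by (intro borel_measurable_sum borel_measurable_power) (auto intro: measurable_component_singleton)

lemma abs_power_sum_le:
  assumes "\<And>j. j < m \<Longrightarrow> 0 < y j \<and> y j < (1::real)"
  shows "\<bar>\<Sum>j<m. y j ^ n\<bar> \<le> real m"
proof -
  have "\<bar>\<Sum>j<m. y j ^ n\<bar> \<le> (\<Sum>j<m. \<bar>y j ^ n\<bar>)" by (rule sum_abs)
  also have "\<dots> \<le> (\<Sum>j<m. 1)"
    by (rule sum_mono) (use assms in \<open>force simp: power_abs intro!: power_le_one\<close>)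
  finally show ?thesis by simp
qed

lemma integrable_alternant_ujac_pair:
  "integrable (lebesgue_pi m) (\<lambda>y. alternant m (\<lambda>i. ujac r s (lam i)) y * alternant m (\<lambda>i. ujac r s (mu i)) y
      * ordered_weight r s m y)"
proof (rule integrable_bounded_ordered_weight)
  fix y :: "nat \<Rightarrow> real" assume y: "\<And>j. j < m \<Longrightarrow> 0 < y j \<and> y j < 1"
  then have "0 \<le> y j \<and> y j \<le> 1" if "j < m" for j using that by (simp add: less_imp_le)
  then show "\<bar>alternant m (\<lambda>i. ujac r s (lam i)) y * alternant m (\<lambda>i. ujac r s (mu i)) y\<bar>
      \<le> (fact m * (\<Prod>i<m. 2 ^ (3 * lam i + r + s))) * (fact m * (\<Prod>i<m. 2 ^ (3 * mu i + r + s)))"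
    unfolding abs_mult by (intro mult_mono abs_alternant_ujac_le mult_nonneg_nonneg prod_nonneg) auto
qed measurable

lemma power_sum_term_integral:
  assumes tau: "\<tau> \<in> partitions" "length \<tau> \<le> m"
  shows "term_coeff r s m t \<tau> * (LINT y|lebesgue_pi m. (\<Sum>j<m. y j ^ n)
      * (alternant m (\<lambda>i. ujac r s (shifted_part m \<tau> i)) y * vandermonde m y * ordered_weight r s m y))
    = (\<Sum>i<m. \<Sum>k\<le>n + staircase m i. if \<tau> = (if m \<le> k then hook_of m i k else [])
         then ujac_conn r s n (staircase m i) k * hook_factor r s m t i k else 0)"
proof -
  let ?E = "ujac_at_ones r s m (staircase m)" and ?A = "alternant m (\<lambda>i. ujac r s (shifted_part m \<tau> i))"
  let ?I = "\<lambda>i k y. alternant m (\<lambda>a. ujac r s (((staircase m)(i := k)) a)) y * ?A y * ordered_weight r s m y"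
  have nz: "?E \<noteq> 0" by (rule ujac_at_ones_nz[OF inj_staircase])
  have "(\<Sum>j<m. y j ^ n) * (?A y * vandermonde m y * ordered_weight r s m y)
      = (\<Sum>i<m. \<Sum>k\<le>n + staircase m i. ujac_conn r s n (staircase m i) k / ?E * ?I i k y)" for y
  proof -
    have "(\<Sum>j<m. y j ^ n) * (?A y * vandermonde m y * ordered_weight r s m y)
        = (\<Sum>j<m. y j ^ n) * (?E * vandermonde m y) * (?A y * ordered_weight r s m y / ?E)"
      using nz by simp
    also have "\<dots> = (\<Sum>i<m. \<Sum>k\<le>n + staircase m i. ujac_conn r s n (staircase m i) k / ?E * ?I i k y)"
      unfolding power_sum_vandermonde_expansion unfolding sum_distrib_right
      by (intro sum.cong refl) (simp only: divide_inverse mult_ac)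
    finally show ?thesis .
  qed
  then have "(LINT y|lebesgue_pi m. (\<Sum>j<m. y j ^ n) * (?A y * vandermonde m y * ordered_weight r s m y))
      = (\<Sum>i<m. \<Sum>k\<le>n + staircase m i. ujac_conn r s n (staircase m i) k / ?E * (LINT y|lebesgue_pi m. ?I i k y))"
    by (simp only: Bochner_Integration.integral_sum Bochner_Integration.integrable_sum
        integrable_mult_right integrable_alternant_ujac_pair integral_mult_right_zero)
  then have "term_coeff r s m t \<tau> * (LINT y|lebesgue_pi m. (\<Sum>j<m. y j ^ n)
      * (?A y * vandermonde m y * ordered_weight r s m y))
    = (\<Sum>i<m. \<Sum>k\<le>n + staircase m i. ujac_conn r s n (staircase m i) k / ?E
        * (term_coeff r s m t \<tau> * (LINT y|lebesgue_pi m. ?I i k y)))"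
    by (simp only: sum_distrib_left mult.left_commute)
  also have "\<dots> = (\<Sum>i<m. \<Sum>k\<le>n + staircase m i. if \<tau> = (if m \<le> k then hook_of m i k else [])
         then ujac_conn r s n (staircase m i) k * hook_factor r s m t i k else 0)"
    by (intro sum.cong refl, subst term_coeff_mult_integral_upd[OF tau]) (use nz in auto)
  finally show ?thesis .
qed

text \<open>The Vandermonde product is a multiple of the staircase alternant, which is orthogonal to
  the alternant of every nonempty partition.\<close>

lemma constant_term_integral:
  assumes tau: "\<tau> \<in> partitions" "length \<tau> \<le> m"
  shows "term_coeff r s m t \<tau> * (LINT y|lebesgue_pi m.
      alternant m (\<lambda>i. ujac r s (shifted_part m \<tau> i)) y * vandermonde m y * ordered_weight r s m y)
    = (if \<tau> = [] then 1 else 0)"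
proof -
  let ?E = "ujac_at_ones r s m (staircase m)" and ?A = "alternant m (\<lambda>i. ujac r s (shifted_part m \<tau> i))"
  have nz: "?E \<noteq> 0" by (rule ujac_at_ones_nz[OF inj_staircase])
  have "?A y * vandermonde m y * ordered_weight r s m y
      = inverse ?E * (alternant m (\<lambda>i. ujac r s (staircase m i)) y * ?A y * ordered_weight r s m y)" for y
    using nz by (simp add: alternant_ujac_staircase)
  then have "(LINT y|lebesgue_pi m. ?A y * vandermonde m y * ordered_weight r s m y)
      = inverse ?E * (LINT y|lebesgue_pi m. alternant m (\<lambda>i. ujac r s (staircase m i)) y * ?A y * ordered_weight r s m y)"
    by (simp only: integral_mult_right_zero)
  moreover have "[] \<in> partitions" by (simp add: partitions_def)
  ultimately show ?thesis
    using term_coeff_mult_integral[OF tau _ _ permutes_id, of "[]" "staircase m" r s t] nz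
    by (simp add: shifted_part_Nil nu_Nil mult.left_commute[of "term_coeff r s m t \<tau>"])
qed

section \<open>Moments of the density\<close>

text \<open>An infinite index set is enumerated, so that the unordered sums become series and
  termwise integration applies; the integrable w times the summable B controls the norms.\<close>

lemma integral_infsum_dominated:
  fixes f :: "'i \<Rightarrow> 'a \<Rightarrow> real"
  assumes K: "countable K"
    and meas: "\<And>i. i \<in> K \<Longrightarrow> f i \<in> borel_measurable M"
    and bound: "\<And>i x. i \<in> K \<Longrightarrow> x \<in> space M \<Longrightarrow> \<bar>f i x\<bar> \<le> B i * w x"
    and B: "B summable_on K" "\<And>i. i \<in> K \<Longrightarrow> 0 \<le> B i"
    and w: "integrable M w"
  shows "integrable M (\<lambda>x. \<Sum>\<^sub>\<infinity>i\<in>K. f i x)"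
    and "(LINT x|M. (\<Sum>\<^sub>\<infinity>i\<in>K. f i x)) = (\<Sum>\<^sub>\<infinity>i\<in>K. LINT x|M. f i x)"
proof -
  have int: "integrable M (f i)" if "i \<in> K" for i
    by (rule Bochner_Integration.integrable_bound[OF integrable_mult_right[OF w, of "B i"] meas[OF that]])
      (use bound[OF that] in \<open>auto intro!: AE_I2 order_trans[OF _ abs_ge_self]\<close>)
  have "integrable M (\<lambda>x. \<Sum>\<^sub>\<infinity>i\<in>K. f i x) \<and> (LINT x|M. (\<Sum>\<^sub>\<infinity>i\<in>K. f i x)) = (\<Sum>\<^sub>\<infinity>i\<in>K. LINT x|M. f i x)"
  proof (cases "finite K")
    case True
    then show ?thesis using int by simp
  next
    case False
    define e where "e = from_nat_into K"
    have bij: "bij_betw e UNIV K" unfolding e_def by (rule bij_betw_from_nat_into[OF K False])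
    have eK: "e n \<in> K" for n using bij by (auto simp: bij_betw_def)
    have re: "(\<Sum>\<^sub>\<infinity>i\<in>K. g i) = (\<Sum>n. g (e n))" if "summable (\<lambda>n. norm (g (e n)))" for g :: "'i \<Rightarrow> real"
    proof -
      have "(\<Sum>\<^sub>\<infinity>i\<in>K. g i) = (\<Sum>\<^sub>\<infinity>n\<in>UNIV. g (e n))" by (rule infsum_reindex_bij_betw[OF bij, symmetric])
      also have "\<dots> = (\<Sum>n. g (e n))"
        by (intro infsumI norm_summable_imp_has_sum that summable_sums summable_norm_cancel[OF that])
      finally show ?thesis .
    qed
    have Bs: "summable (\<lambda>n. B (e n))"
      using B summable_on_reindex_bij_betw[OF bij, of B] summable_on_UNIV_nonneg_real_iff[of "\<lambda>n. B (e n)"] eK by auto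
    have ns: "summable (\<lambda>n. norm (f (e n) x))" if "x \<in> space M" for x
      by (rule summable_comparison_test'[OF summable_mult2[OF Bs, of "w x"], of 0]) (use bound[OF eK that] in simp)
    have nb: "norm (LINT x|M. norm (f (e n) x)) \<le> B (e n) * (LINT x|M. w x)" for n
    proof -
      have "(LINT x|M. norm (f (e n) x)) \<le> (LINT x|M. B (e n) * w x)"
        by (intro integral_mono integrable_norm int eK integrable_mult_right w) (use bound[OF eK] in simp)
      then show ?thesis by simp
    qed
    have si: "summable (\<lambda>n. LINT x|M. norm (f (e n) x))"
      by (rule summable_comparison_test'[OF summable_mult2[OF Bs, of "LINT x|M. w x"], of 0]) (rule nb)
    have si': "summable (\<lambda>n. norm (LINT x|M. f (e n) x))"
      by (rule summable_comparison_test'[OF si, of 0]) simp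
    have A: "AE x in M. summable (\<lambda>n. norm (f (e n) x))" using ns by (intro AE_I2)
    have eq: "(\<Sum>\<^sub>\<infinity>i\<in>K. f i x) = (\<Sum>n. f (e n) x)" if "x \<in> space M" for x
      by (rule re[OF ns[OF that]])
    show ?thesis
    proof
      show "integrable M (\<lambda>x. \<Sum>\<^sub>\<infinity>i\<in>K. f i x)"
        by (rule Bochner_Integration.integrable_cong[THEN iffD2, OF refl eq integrable_suminf[OF int[OF eK] A si]])
      have "(LINT x|M. (\<Sum>\<^sub>\<infinity>i\<in>K. f i x)) = (LINT x|M. (\<Sum>n. f (e n) x))"
        by (rule Bochner_Integration.integral_cong[OF refl eq])
      also have "\<dots> = (\<Sum>n. LINT x|M. f (e n) x)"
        by (rule integral_suminf[OF int[OF eK] A si])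
      also have "\<dots> = (\<Sum>\<^sub>\<infinity>i\<in>K. LINT x|M. f i x)" by (rule re[OF si', symmetric])
      finally show "(LINT x|M. (\<Sum>\<^sub>\<infinity>i\<in>K. f i x)) = (\<Sum>\<^sub>\<infinity>i\<in>K. LINT x|M. f i x)" .
    qed
  qed
  then show "integrable M (\<lambda>x. \<Sum>\<^sub>\<infinity>i\<in>K. f i x)"
    and "(LINT x|M. (\<Sum>\<^sub>\<infinity>i\<in>K. f i x)) = (\<Sum>\<^sub>\<infinity>i\<in>K. LINT x|M. f i x)" by blast+
qed

lemma jacobi_density_eq:
  "jacobi_density r s m t y = (\<Sum>\<^sub>\<infinity>\<tau>\<in>{\<tau> \<in> partitions. length \<tau> \<le> m}. term_coeff r s m t \<tau>
      * (alternant m (\<lambda>i. ujac r s (shifted_part m \<tau> i)) y * vandermonde m y * ordered_weight r s m y))"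
  unfolding jacobi_density_def jacobi_density_term term_coeff_def ..

lemma jacobi_density_eq_0: "j < m \<Longrightarrow> \<not> (0 < y j \<and> y j < 1) \<Longrightarrow> jacobi_density r s m t y = 0"
  unfolding jacobi_density_eq using ordered_weight_eq_0[of j m y r s] by simp

theorem jacobi_density_integral:
  assumes t: "0 < t" and f: "f \<in> borel_measurable (lebesgue_pi m)"
    and C: "\<And>y. (\<And>j. j < m \<Longrightarrow> 0 < y j \<and> y j < 1) \<Longrightarrow> \<bar>f y\<bar> \<le> C"
  shows "integrable (lebesgue_pi m) (\<lambda>y. f y * jacobi_density r s m t y)"
    and "(LINT y|lebesgue_pi m. f y * jacobi_density r s m t y)
      = (\<Sum>\<^sub>\<infinity>\<tau>\<in>{\<tau> \<in> partitions. length \<tau> \<le> m}. term_coeff r s m t \<tau> * (LINT y|lebesgue_pi m. f y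
          * (alternant m (\<lambda>i. ujac r s (shifted_part m \<tau> i)) y * vandermonde m y * ordered_weight r s m y)))"
proof -
  let ?K = "{\<tau> \<in> partitions. length \<tau> \<le> m}"
  let ?A = "\<lambda>\<tau>. alternant m (\<lambda>i. ujac r s (shifted_part m \<tau> i))"
  define h where "h \<tau> y = f y * (term_coeff r s m t \<tau> * (?A \<tau> y * vandermonde m y * ordered_weight r s m y))" for \<tau> y
  obtain B where B: "B summable_on ?K"
    "\<And>\<tau> y. (\<forall>j<m. 0 \<le> y j \<and> y j \<le> 1) \<Longrightarrow> \<bar>term_coeff r s m t \<tau> * (?A \<tau> y * vandermonde m y)\<bar> \<le> B \<tau>"
    using density_majorant[OF t, of m r s] by blast
  \<comment> \<open>Any point of the cube shows that the majorant is nonnegative; the centre is used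
    here and for C.\<close>
  have B0: "0 \<le> B \<tau>" for \<tau> using B(2)[of "\<lambda>_. 1/2" \<tau>] by linarith
  have C0: "0 \<le> C" using C[of "\<lambda>_. 1/2"] by force
  have eq: "f y * jacobi_density r s m t y = (\<Sum>\<^sub>\<infinity>\<tau>\<in>?K. h \<tau> y)" for y
    unfolding jacobi_density_eq h_def by (rule infsum_cmult_right'[symmetric])
  have meas: "h \<tau> \<in> borel_measurable (lebesgue_pi m)" for \<tau>
    unfolding h_def [abs_def] using f by measurable
  have bound: "\<bar>h \<tau> y\<bar> \<le> (C * B \<tau>) * ordered_weight r s m y" for \<tau> y
  proof (cases "\<forall>j<m. 0 < y j \<and> y j < 1")
    case True
    have "\<bar>h \<tau> y\<bar> = (\<bar>f y\<bar> * \<bar>term_coeff r s m t \<tau> * (?A \<tau> y * vandermonde m y)\<bar>) * ordered_weight r s m y"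
      using ordered_weight_nonneg[of r s m y] by (simp add: h_def abs_mult)
    also have "\<dots> \<le> (C * B \<tau>) * ordered_weight r s m y"
      by (intro mult_right_mono mult_mono C B(2) C0 ordered_weight_nonneg) (use True in \<open>auto simp: less_imp_le\<close>)
    finally show ?thesis .
  qed (use ordered_weight_eq_0 in \<open>force simp: h_def\<close>)
  note I = integral_infsum_dominated[OF countableI_type meas bound summable_on_cmult_right[OF B(1)]
      mult_nonneg_nonneg[OF C0 B0] integrable_ordered_weight]
  show "integrable (lebesgue_pi m) (\<lambda>y. f y * jacobi_density r s m t y)"
    unfolding eq by (rule I(1))
  have "(LINT y|lebesgue_pi m. h \<tau> y) = term_coeff r s m t \<tau> * (LINT y|lebesgue_pi m. f y
          * (?A \<tau> y * vandermonde m y * ordered_weight r s m y))" for \<tau>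
    unfolding h_def by (subst integral_mult_right_zero[symmetric]) (simp only: mult.left_commute)
  then show "(LINT y|lebesgue_pi m. f y * jacobi_density r s m t y)
      = (\<Sum>\<^sub>\<infinity>\<tau>\<in>?K. term_coeff r s m t \<tau> * (LINT y|lebesgue_pi m. f y
          * (?A \<tau> y * vandermonde m y * ordered_weight r s m y)))"
    unfolding eq I(2) by simp
qed

text \<open>Several x may have the same image under \<sigma>, and their coefficients then add up:
  all pairs with k < m are sent to the empty partition.\<close>

lemma infsum_finite_support:
  fixes c :: "'a \<Rightarrow> real"
  assumes P: "finite P" and K: "\<And>x. x \<in> P \<Longrightarrow> \<sigma> x \<in> K"
  shows "(\<Sum>\<^sub>\<infinity>\<tau>\<in>K. \<Sum>x\<in>P. if \<tau> = \<sigma> x then c x else 0) = (\<Sum>x\<in>P. c x)"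
proof -
  have "(\<Sum>\<^sub>\<infinity>\<tau>\<in>K. \<Sum>x\<in>P. if \<tau> = \<sigma> x then c x else 0)
      = (\<Sum>\<^sub>\<infinity>\<tau>\<in>\<sigma> ` P. \<Sum>x\<in>P. if \<tau> = \<sigma> x then c x else 0)"
    by (rule infsum_cong_neutral) (use K in \<open>auto intro!: sum.neutral\<close>)
  also have "\<dots> = (\<Sum>x\<in>P. \<Sum>\<tau>\<in>\<sigma> ` P. if \<tau> = \<sigma> x then c x else 0)"
    using P by (simp add: sum.swap[of _ P])
  also have "\<dots> = (\<Sum>x\<in>P. c x)"
    using P by (intro sum.cong refl) simp
  finally show ?thesis .
qed

theorem jacobi_density_moment:
  assumes t: "0 < t"
  shows "(LINT y|lebesgue_pi m. (\<Sum>j<m. y j ^ n) * jacobi_density r s m t y)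
    = (\<Sum>i<m. \<Sum>k\<le>n + staircase m i. ujac_conn r s n (staircase m i) k * hook_factor r s m t i k)"
proof -
  let ?K = "{\<tau> \<in> partitions. length \<tau> \<le> m}"
  let ?P = "Sigma {..<m} (\<lambda>i. {..n + staircase m i})"
  let ?\<sigma> = "\<lambda>x. if m \<le> snd x then hook_of m (fst x) (snd x) else []"
  let ?c = "\<lambda>x. ujac_conn r s n (staircase m (fst x)) (snd x) * hook_factor r s m t (fst x) (snd x)"
  have "(LINT y|lebesgue_pi m. (\<Sum>j<m. y j ^ n) * jacobi_density r s m t y)
      = (\<Sum>\<^sub>\<infinity>\<tau>\<in>?K. term_coeff r s m t \<tau> * (LINT y|lebesgue_pi m. (\<Sum>j<m. y j ^ n)
          * (alternant m (\<lambda>i. ujac r s (shifted_part m \<tau> i)) y * vandermonde m y * ordered_weight r s m y)))"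
    by (rule jacobi_density_integral(2)[OF t measurable_component_power_sum abs_power_sum_le])
  also have "\<dots> = (\<Sum>\<^sub>\<infinity>\<tau>\<in>?K. \<Sum>x\<in>?P. if \<tau> = ?\<sigma> x then ?c x else 0)"
  proof (rule infsum_cong)
    fix \<tau> assume "\<tau> \<in> ?K"
    then show "term_coeff r s m t \<tau> * (LINT y|lebesgue_pi m. (\<Sum>j<m. y j ^ n)
          * (alternant m (\<lambda>i. ujac r s (shifted_part m \<tau> i)) y * vandermonde m y * ordered_weight r s m y))
        = (\<Sum>x\<in>?P. if \<tau> = ?\<sigma> x then ?c x else 0)"
      by (subst power_sum_term_integral) (simp_all add: sum.Sigma split_def)
  qed
  also have "\<dots> = (\<Sum>x\<in>?P. ?c x)"
    by (rule infsum_finite_support)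
      (auto simp: hook_of_partition length_hook_of Suc_le_eq, simp_all add: partitions_def)
  also have "\<dots> = (\<Sum>i<m. \<Sum>k\<le>n + staircase m i. ujac_conn r s n (staircase m i) k * hook_factor r s m t i k)"
    by (simp add: sum.Sigma split_def)
  finally show ?thesis .
qed

lemma jacobi_density_total:
  assumes t: "0 < t"
  shows "integrable (lebesgue_pi m) (jacobi_density r s m t)"
    and "(LINT y|lebesgue_pi m. jacobi_density r s m t y) = 1"
proof -
  note I = jacobi_density_integral[OF t, of "\<lambda>_. 1" m 1 r s]
  show "integrable (lebesgue_pi m) (jacobi_density r s m t)" using I(1) by simp
  have "(LINT y|lebesgue_pi m. jacobi_density r s m t y)
     = (\<Sum>\<^sub>\<infinity>\<tau>\<in>{\<tau> \<in> partitions. length \<tau> \<le> m}. term_coeff r s m t \<tau> * (LINT y|lebesgue_pi m.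
          alternant m (\<lambda>i. ujac r s (shifted_part m \<tau> i)) y * vandermonde m y * ordered_weight r s m y))"
    using I(2) by simp
  also have "\<dots> = (\<Sum>\<^sub>\<infinity>\<tau>\<in>{\<tau> \<in> partitions. length \<tau> \<le> m}. \<Sum>x\<in>{()}. if \<tau> = [] then 1 else 0)"
    by (rule infsum_cong) (simp add: constant_term_integral)
  also have "\<dots> = 1"
    by (subst infsum_finite_support) (auto simp: partitions_def)
  finally show "(LINT y|lebesgue_pi m. jacobi_density r s m t y) = 1" .
qed

text \<open>Up to a constant the stationary weight is the term of the empty partition, taken at t =
  0. Its total mass 1 identifies that constant with the inverse of \<open>jacobi_const\<close>, and
  only unchanged degrees contribute to the power sum.\<close>

lemma stationary_moment:
  shows "jacobi_const r s m \<noteq> 0"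
    and "1 / jacobi_const r s m * (LINT y|lebesgue_pi m. (\<Sum>j<m. y j ^ n) * jacobi_weight r s m y)
      = (\<Sum>i<m. ujac_conn r s n (staircase m i) (staircase m i))"
proof -
  let ?a = "term_coeff r s m 0 [] * ujac_at_ones r s m (staircase m)"
  have N: "[] \<in> partitions" by (simp add: partitions_def)
  have e: "alternant m (\<lambda>i. ujac r s (shifted_part m [] i)) y * vandermonde m y * ordered_weight r s m y
      = ujac_at_ones r s m (staircase m) * jacobi_weight r s m y" for y
    by (simp add: shifted_part_Nil alternant_ujac_staircase jacobi_weight_eq power2_eq_square)
  have c: "?a * jacobi_const r s m = 1"
    using constant_term_integral[OF N, of m r s 0] unfolding e jacobi_const_def by simp
  then show nz: "jacobi_const r s m \<noteq> 0" by auto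
  have "?a * (LINT y|lebesgue_pi m. (\<Sum>j<m. y j ^ n) * jacobi_weight r s m y)
      = (\<Sum>i<m. \<Sum>k\<le>n + staircase m i. if [] = (if m \<le> k then hook_of m i k else [])
         then ujac_conn r s n (staircase m i) k * hook_factor r s m 0 i k else 0)"
    using power_sum_term_integral[OF N, of m r s 0 n] unfolding e by (simp add: mult.left_commute mult.assoc)
  also have "\<dots> = (\<Sum>i<m. \<Sum>k\<le>n + staircase m i. if k = staircase m i then ujac_conn r s n (staircase m i) k else 0)"
    by (intro sum.cong refl) (auto simp: hook_of_def hook_factor_def staircase_def)
  also have "\<dots> = (\<Sum>i<m. ujac_conn r s n (staircase m i) (staircase m i))"
    by (intro sum.cong refl) simp
  finally have "?a * (LINT y|lebesgue_pi m. (\<Sum>j<m. y j ^ n) * jacobi_weight r s m y)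
      = (\<Sum>i<m. ujac_conn r s n (staircase m i) (staircase m i))" .
  moreover have "?a = 1 / jacobi_const r s m" using c nz by (simp add: field_simps)
  ultimately show "1 / jacobi_const r s m * (LINT y|lebesgue_pi m. (\<Sum>j<m. y j ^ n) * jacobi_weight r s m y)
      = (\<Sum>i<m. ujac_conn r s n (staircase m i) (staircase m i))"
    by simp
qed

section \<open>Integrating the logarithmic series, and expectations as integrals against the
  density\<close>

lemma abs_alternating_sum_le:
  fixes a :: "nat \<Rightarrow> real"
  assumes "\<And>k. 0 \<le> a k" "\<And>k. a (Suc k) \<le> a k"
  shows "0 \<le> (\<Sum>k<n. (-1) ^ k * a k) \<and> (\<Sum>k<n. (-1) ^ k * a k) \<le> a 0"
  using assms
proof (induction n arbitrary: a)
  case (Suc n)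
  have "(\<Sum>k<Suc n. (-1) ^ k * a k) = a 0 - (\<Sum>k<n. (-1) ^ k * a (Suc k))"
    by (subst sum.lessThan_Suc_shift) (simp add: sum_negf)
  moreover have "0 \<le> (\<Sum>k<n. (-1) ^ k * a (Suc k)) \<and> (\<Sum>k<n. (-1) ^ k * a (Suc k)) \<le> a (Suc 0)"
    by (rule Suc.IH) (use Suc.prems in auto)
  ultimately show ?case using Suc.prems(2)[of 0] by linarith
qed simp

lemma ln_series_partial_le:
  assumes "0 \<le> x" "x \<le> (1::real)"
  shows "\<bar>\<Sum>k<n. (-1) ^ k * (x ^ Suc k / real (Suc k))\<bar> \<le> 1"
proof -
  have "0 \<le> (\<Sum>k<n. (-1) ^ k * (x ^ Suc k / real (Suc k)))
      \<and> (\<Sum>k<n. (-1) ^ k * (x ^ Suc k / real (Suc k))) \<le> x ^ Suc 0 / real (Suc 0)"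
  proof (rule abs_alternating_sum_le)
    fix k
    show "x ^ Suc (Suc k) / real (Suc (Suc k)) \<le> x ^ Suc k / real (Suc k)"
      using assms by (intro frac_le power_decreasing) auto
  qed (use assms in auto)
  then show ?thesis using assms by auto
qed

text \<open>The weight w may be signed, so that this serves the density, whose sign is not known
  pointwise, as well as the stationary weight. Each coordinate contributes at most 1 to the partial
  sums, hence the dominating function m |w|.\<close>

theorem log_series_integral:
  fixes w :: "(nat \<Rightarrow> real) \<Rightarrow> real"
  assumes w: "integrable (lebesgue_pi m) w"
    and w0: "\<And>y j. j < m \<Longrightarrow> \<not> (0 < y j \<and> y j < 1) \<Longrightarrow> w y = 0"
    and rho: "0 < \<rho>" "\<rho> \<le> 1"
    and int: "\<And>n. integrable (lebesgue_pi m) (\<lambda>y. (\<Sum>j<m. y j ^ n) * w y)"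
  shows "(\<lambda>k. (-1) ^ k * \<rho> ^ Suc k / real (Suc k) * (LINT y|lebesgue_pi m. (\<Sum>j<m. y j ^ Suc k) * w y))
    sums (LINT y|lebesgue_pi m. (\<Sum>j<m. ln (1 + \<rho> * y j)) * w y)"
proof -
  let ?N = "lebesgue_pi m"
  let ?c = "\<lambda>k. (-1) ^ k * \<rho> ^ Suc k / real (Suc k)"
  let ?s = "\<lambda>n y. \<Sum>k<n. ?c k * ((\<Sum>j<m. y j ^ Suc k) * w y)"
  have s_eq: "?s n y = (\<Sum>j<m. \<Sum>k<n. (-1) ^ k * ((\<rho> * y j) ^ Suc k / real (Suc k))) * w y" for n y
    unfolding sum_distrib_left sum_distrib_right
    by (subst sum.swap) (intro sum.cong refl, simp add: power_mult_distrib)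
  have "(\<lambda>n. LINT y|?N. ?s n y) \<longlonglongrightarrow> (LINT y|?N. (\<Sum>j<m. ln (1 + \<rho> * y j)) * w y)"
  proof (rule integral_dominated_convergence)
    show "(\<lambda>y. (\<Sum>j<m. ln (1 + \<rho> * y j)) * w y) \<in> borel_measurable ?N"
      using w by (intro borel_measurable_times borel_measurable_sum borel_measurable_ln borel_measurable_add
          borel_measurable_const measurable_component_singleton) auto
    show "?s n \<in> borel_measurable ?N" for n
      using w by (intro borel_measurable_sum borel_measurable_times borel_measurable_const
          measurable_component_power_sum) auto
    show "integrable ?N (\<lambda>y. real m * \<bar>w y\<bar>)" using w by simp
    show "AE y in ?N. (\<lambda>n. ?s n y) \<longlonglongrightarrow> (\<Sum>j<m. ln (1 + \<rho> * y j)) * w y"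
    proof (rule AE_I2)
      fix y
      show "(\<lambda>n. ?s n y) \<longlonglongrightarrow> (\<Sum>j<m. ln (1 + \<rho> * y j)) * w y"
      proof (cases "\<forall>j<m. 0 < y j \<and> y j < 1")
        case True
        have "(\<lambda>n. \<Sum>k<n. (-1) ^ k * ((\<rho> * y j) ^ Suc k / real (Suc k))) \<longlonglongrightarrow> ln (1 + \<rho> * y j)" if "j < m" for j
        proof -
          have x: "0 < \<rho> * y j" "\<rho> * y j < 1"
            using True that rho mult_le_less_imp_less[of \<rho> 1 "y j" 1] by auto
          have "ln (1 + \<rho> * y j) = (\<Sum>n. (-1) ^ n * (1 / real (n + 1)) * (1 + \<rho> * y j - 1) ^ Suc n)"
            by (rule ln_series) (use x in auto)
          moreover have "summable (\<lambda>n. (-1) ^ n * (1 / real (n + 1)) * (\<rho> * y j) ^ Suc n)"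
          proof (rule summable_comparison_test'[OF summable_geometric[of "\<rho> * y j"], of 0])
            fix n
            have "(\<rho> * y j) ^ Suc n / real (n + 1) \<le> (\<rho> * y j) ^ n / 1"
              using x by (intro frac_le power_decreasing) auto
            moreover have "norm ((-1) ^ n * (1 / real (n + 1)) * z ^ Suc n) = z ^ Suc n / real (n + 1)" if "0 < z" for z :: real
              using that by (simp add: abs_mult power_abs)
            ultimately show "norm ((-1) ^ n * (1 / real (n + 1)) * (\<rho> * y j) ^ Suc n) \<le> (\<rho> * y j) ^ n"
              using x by (simp only: div_by_1)
          qed (use x in simp)
          ultimately show ?thesis by (simp add: sums_def[symmetric] sums_iff)
        qed
        then show ?thesis unfolding s_eq by (intro tendsto_mult tendsto_sum tendsto_const) auto
      next
        case False
        then have "w y = 0" using w0 by blast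
        then show ?thesis by simp
      qed
    qed
    show "AE y in ?N. norm (?s n y) \<le> real m * \<bar>w y\<bar>" for n
    proof (rule AE_I2)
      fix y
      show "norm (?s n y) \<le> real m * \<bar>w y\<bar>"
      proof (cases "\<forall>j<m. 0 < y j \<and> y j < 1")
        case True
        have "\<bar>\<Sum>j<m. \<Sum>k<n. (-1) ^ k * ((\<rho> * y j) ^ Suc k / real (Suc k))\<bar> \<le> (\<Sum>j<m. 1)"
          by (rule order_trans[OF sum_abs sum_mono], rule ln_series_partial_le)
            (use True rho in \<open>auto intro: mult_le_one less_imp_le\<close>)
        then show ?thesis unfolding s_eq by (simp add: abs_mult mult_right_mono)
      next
        case False
        then have "w y = 0" using w0 by blast
        then show ?thesis by simp
      qed
    qed
  qed
  moreover have "(LINT y|?N. ?s n y) = (\<Sum>k<n. ?c k * (LINT y|?N. (\<Sum>j<m. y j ^ Suc k) * w y))" for n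
    by (simp only: Bochner_Integration.integral_sum integrable_mult_right int integral_mult_right_zero)
  ultimately show ?thesis by (simp only: sums_def)
qed

text \<open>The law determines only the positive part of the density, whose integral is 1 by
  normalisation. The signed density has integral 1 by orthogonality, so the nonnegative difference
  of the two vanishes almost everywhere.\<close>

theorem expectation_eq_density_integral:
  assumes M: "prob_space M" and t: "0 < t"
    and D: "distributed M (lebesgue_pi m) Y (\<lambda>y. ennreal (jacobi_density r s m t y))"
    and f: "f \<in> borel_measurable (lebesgue_pi m)"
  shows "(LINT \<omega>|M. f (Y \<omega>)) = (LINT y|lebesgue_pi m. f y * jacobi_density r s m t y)"
proof -
  interpret prob_space M by fact
  let ?N = "lebesgue_pi m" and ?G = "jacobi_density r s m t"
  have Y: "Y \<in> measurable M ?N" by (rule distributed_measurable[OF D])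
  note G = jacobi_density_total[OF t, of m r s]
  have Gm: "?G \<in> borel_measurable ?N" using G(1) by simp
  have "emeasure (distr M ?N Y) (space ?N) = 1"
    using prob_space.emeasure_space_1[OF prob_space_distr[OF Y]] by simp
  then have "(\<integral>\<^sup>+ y. ennreal (?G y) \<partial>?N) = 1"
    unfolding distributed_distr_eq_density[OF D]
    using Gm by (subst (asm) emeasure_density) (auto cong: nn_integral_cong)
  then have "(\<integral>\<^sup>+ y. ennreal (max 0 (?G y)) \<partial>?N) = 1"
    by (simp add: ennreal_max_0')
  then have pos: "(LINT y|?N. max 0 (?G y)) = 1"
    using Gm by (subst integral_eq_nn_integral) auto
  have "(LINT y|?N. max 0 (?G y) - ?G y) = 0"
    using G pos by (subst Bochner_Integration.integral_diff) auto
  then have "AE y in ?N. max 0 (?G y) - ?G y = 0"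
    by (subst (asm) integral_nonneg_eq_0_iff_AE) (use G(1) in auto)
  then have AE: "AE y in ?N. f y * max 0 (?G y) = f y * ?G y"
    by eventually_elim simp
  have "(LINT \<omega>|M. f (Y \<omega>)) = (LINT y|distr M ?N Y. f y)"
    by (rule integral_distr[symmetric, OF Y f])
  also have "distr M ?N Y = density ?N (\<lambda>y. ennreal (max 0 (?G y)))"
    unfolding distributed_distr_eq_density[OF D] by (simp add: ennreal_max_0')
  also have "(LINT y|density ?N (\<lambda>y. ennreal (max 0 (?G y))). f y) = (LINT y|?N. max 0 (?G y) * f y)"
    using Gm f by (subst integral_density) auto
  also have "\<dots> = (LINT y|?N. f y * ?G y)"
    using AE Gm f by (intro integral_cong_AE) (auto simp: mult.commute)
  finally show ?thesis .
qed

section \<open>Explicit form of the hook contributions\<close>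

text \<open>Only pairs containing i change when one node is replaced. Collecting them costs the sign
  (-1)^(m-1-i) on both sides, and the cross-multiplied form avoids division by zero.\<close>

lemma prod_pair_upd:
  fixes x :: "nat \<Rightarrow> real"
  assumes i: "i < m"
  shows "(\<Prod>j<m. \<Prod>a<j. (x(i := z)) j - (x(i := z)) a) * (\<Prod>a\<in>{..<m} - {i}. x i - x a)
    = (\<Prod>j<m. \<Prod>a<j. x j - x a) * (\<Prod>a\<in>{..<m} - {i}. z - x a)"
proof -
  have split: "(\<Prod>j<m. \<Prod>a<j. y j - y a)
      = (\<Prod>j\<in>{..<m} - {i}. \<Prod>a\<in>{..<j} - {i}. y j - y a)
        * ((-1) ^ (m - 1 - i) * (\<Prod>a\<in>{..<m} - {i}. y i - y a))" for y :: "nat \<Rightarrow> real"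
  proof -
    have "(\<Prod>j<m. \<Prod>a<j. y j - y a) = (\<Prod>a<i. y i - y a) * (\<Prod>j\<in>{..<m} - {i}. \<Prod>a<j. y j - y a)"
      using i by (intro prod.remove) auto
    also have "(\<Prod>j\<in>{..<m} - {i}. \<Prod>a<j. y j - y a)
        = (\<Prod>j\<in>{..<m} - {i}. (\<Prod>a\<in>{..<j} - {i}. y j - y a) * (if i < j then y j - y i else 1))"
    proof (intro prod.cong refl)
      fix j assume "j \<in> {..<m} - {i}"
      show "(\<Prod>a<j. y j - y a) = (\<Prod>a\<in>{..<j} - {i}. y j - y a) * (if i < j then y j - y i else 1)"
      proof (cases "i < j")
        case True
        then show ?thesis by (subst prod.remove[of _ i]) (auto simp: mult.commute)
      next
        case False
        then have "{..<j} - {i} = {..<j}" by auto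
        then show ?thesis using False by simp
      qed
    qed
    also have "\<dots> = (\<Prod>j\<in>{..<m} - {i}. \<Prod>a\<in>{..<j} - {i}. y j - y a) * (\<Prod>j\<in>{i<..<m}. y j - y i)"
      unfolding prod.distrib
      by (rule arg_cong2[of _ _ _ _ "(*)", OF refl], subst prod.inter_filter[symmetric]) (auto intro!: prod.cong)
    also have "(\<Prod>j\<in>{i<..<m}. y j - y i) = (\<Prod>j\<in>{i<..<m}. (-1) * (y i - y j))"
      by (intro prod.cong) auto
    also have "\<dots> = (-1) ^ (m - 1 - i) * (\<Prod>j\<in>{i<..<m}. y i - y j)"
      by (simp only: prod.distrib prod_constant card_greaterThanLessThan) simp
    finally have 1: "(\<Prod>j<m. \<Prod>a<j. y j - y a) = (\<Prod>a<i. y i - y a)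
        * ((\<Prod>j\<in>{..<m} - {i}. \<Prod>a\<in>{..<j} - {i}. y j - y a)
        * ((-1) ^ (m - 1 - i) * (\<Prod>j\<in>{i<..<m}. y i - y j)))" .
    have un: "{..<m} - {i} = {..<i} \<union> {i<..<m}" using i by auto
    have "(\<Prod>a\<in>{..<m} - {i}. y i - y a) = (\<Prod>a<i. y i - y a) * (\<Prod>j\<in>{i<..<m}. y i - y j)"
      unfolding un by (rule prod.union_disjoint) auto
    then show ?thesis unfolding 1 by (simp only: mult_ac)
  qed
  have a: "(\<Prod>j\<in>{..<m} - {i}. \<Prod>a\<in>{..<j} - {i}. (x(i := z)) j - (x(i := z)) a)
      = (\<Prod>j\<in>{..<m} - {i}. \<Prod>a\<in>{..<j} - {i}. x j - x a)"
    by (intro prod.cong refl) auto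
  have b: "(\<Prod>a\<in>{..<m} - {i}. (x(i := z)) i - (x(i := z)) a) = (\<Prod>a\<in>{..<m} - {i}. z - x a)"
    by (intro prod.cong refl) auto
  show ?thesis unfolding split[of "x(i := z)"] split[of x] a b by (simp only: mult_ac)
qed

lemma ujac_at_ones_upd:
  assumes i: "i < m"
  shows "ujac_at_ones r s m ((staircase m)(i := k)) / ujac_at_ones r s m (staircase m)
    = (\<Prod>j\<in>{..<m} - {staircase m i}. jacobi_eigenvalue r s k - jacobi_eigenvalue r s j)
      / (\<Prod>j\<in>{..<m} - {staircase m i}. jacobi_eigenvalue r s (staircase m i) - jacobi_eigenvalue r s j)"
proof -
  let ?x = "\<lambda>a. jacobi_eigenvalue r s (staircase m a)"
  let ?D = "\<Prod>a\<in>{..<m} - {i}. ?x i - ?x a" and ?E = "ujac_at_ones r s m (staircase m)"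
  have re: "(\<Prod>a\<in>{..<m} - {i}. z - ?x a) = (\<Prod>j\<in>{..<m} - {staircase m i}. z - jacobi_eigenvalue r s j)" for z
    by (rule prod.reindex_bij_witness[of _ "staircase m" "staircase m"]) (use i in \<open>auto simp: staircase_def\<close>)
  have u: "(\<lambda>a. jacobi_eigenvalue r s (((staircase m)(i := k)) a)) = ?x(i := jacobi_eigenvalue r s k)"
    by (rule ext) simp
  have E: "?E \<noteq> 0" by (rule ujac_at_ones_nz[OF inj_staircase])
  have D: "?D \<noteq> 0"
  proof -
    have "?x i \<noteq> ?x a" if "a \<in> {..<m} - {i}" for a
    proof -
      have "staircase m i \<noteq> staircase m a" using that i by (auto simp: staircase_def)
      then show ?thesis
        using jacobi_eigenvalue_strict_mono[of "staircase m i" "staircase m a" r s]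
          jacobi_eigenvalue_strict_mono[of "staircase m a" "staircase m i" r s]
        by (cases "staircase m i < staircase m a") auto
    qed
    then show ?thesis by simp
  qed
  have "ujac_at_ones r s m ((staircase m)(i := k)) * ?D
      = ?E * (\<Prod>a\<in>{..<m} - {i}. jacobi_eigenvalue r s k - ?x a)"
    using prod_pair_upd[OF i, of ?x "jacobi_eigenvalue r s k"]
    unfolding ujac_at_ones_def u[symmetric] by (simp only: mult.assoc)
  then have "ujac_at_ones r s m ((staircase m)(i := k)) / ?E = (\<Prod>a\<in>{..<m} - {i}. jacobi_eigenvalue r s k - ?x a) / ?D"
    unfolding frac_eq_eq[OF E D] by (simp only: mult.commute)
  then show ?thesis unfolding re .
qed

lemma jacobi_eigenvalue_diff:
  "jacobi_eigenvalue r s k - jacobi_eigenvalue r s j = (real k - real j) * real (k + j + r + s + 1)"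
  by (simp add: jacobi_eigenvalue_def algebra_simps)

text \<open>The factors k - j and k + j + r + s + 1 run through consecutive integers. The induction
  varies the number l of nodes while the evaluation point k stays fixed; the case b = 0 later gives
  the nodes below an omitted one.\<close>

lemma prod_jacobi_eigenvalue_diff:
  "(\<Prod>j<m. jacobi_eigenvalue r s (m + b) - jacobi_eigenvalue r s j)
    = fact (m + b) * fact (2 * m + b + r + s) / (fact b * fact (m + b + r + s))"
proof -
  have "l \<le> k \<Longrightarrow> (\<Prod>j<l. jacobi_eigenvalue r s k - jacobi_eigenvalue r s j)
      = fact k * fact (k + l + r + s) / (fact (k - l) * fact (k + r + s))" for k l
  proof (induction l)
    case (Suc l)
    have "fact (k - l) = real (k - l) * fact (k - Suc l)"
      using Suc.prems by (subst fact_reduce) (auto simp: Suc_diff_Suc)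
    moreover have "fact (k + Suc l + r + s) = real (k + l + r + s + 1) * (fact (k + l + r + s) :: real)"
      by simp
    moreover have "real k - real l = real (k - l)" using Suc.prems by simp
    moreover have "real (k - l) \<noteq> 0" using Suc.prems by simp
    ultimately show ?case using Suc by (simp add: jacobi_eigenvalue_diff del: fact_Suc of_nat_diff)
  qed simp
  from this[of m "m + b"] show ?thesis by (simp add: mult_2 add_ac)
qed

lemma prod_jacobi_eigenvalue_diff_above:
  "(\<Prod>j\<in>{k<..<k + 1 + i}. jacobi_eigenvalue r s k - jacobi_eigenvalue r s j)
    = (-1) ^ i * fact i * fact (2 * k + 1 + i + r + s) / fact (2 * k + 1 + r + s)"
proof (induction i)
  case 0
  have "{k<..<k + 1} = {}" by auto
  then show ?case by simp
next
  case (Suc i)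
  have "{k<..<k + 1 + Suc i} = insert (k + 1 + i) {k<..<k + 1 + i}" by auto
  then have "(\<Prod>j\<in>{k<..<k + 1 + Suc i}. jacobi_eigenvalue r s k - jacobi_eigenvalue r s j)
     = (jacobi_eigenvalue r s k - jacobi_eigenvalue r s (k + 1 + i))
       * (\<Prod>j\<in>{k<..<k + 1 + i}. jacobi_eigenvalue r s k - jacobi_eigenvalue r s j)"
    by simp
  also have "jacobi_eigenvalue r s k - jacobi_eigenvalue r s (k + 1 + i) = - (real (i + 1) * real (2 * k + 2 + i + r + s))"
    by (simp add: jacobi_eigenvalue_diff algebra_simps)
  also have "- (real (i + 1) * real (2 * k + 2 + i + r + s))
      * (\<Prod>j\<in>{k<..<k + 1 + i}. jacobi_eigenvalue r s k - jacobi_eigenvalue r s j)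
     = (-1) ^ Suc i * (real (i + 1) * fact i) * (real (2 * k + 2 + i + r + s) * fact (2 * k + 1 + i + r + s))
       / fact (2 * k + 1 + r + s)"
    unfolding Suc by simp
  also have "real (i + 1) * fact i = fact (Suc i)" by simp
  also have "real (2 * k + 2 + i + r + s) * fact (2 * k + 1 + i + r + s) = fact (2 * k + 1 + Suc i + r + s)"
    by simp
  finally show ?case .
qed

text \<open>The omitted node j has i nodes above it. The numerator is the full product divided by
  the factor of j, and the denominator splits into nodes below and above j, the latter giving the
  sign.\<close>

lemma lagrange_ratio:
  fixes j i b :: nat
  defines "m \<equiv> j + i + 1"
  shows "(\<Prod>a\<in>{..<m} - {j}. jacobi_eigenvalue r s (m + b) - jacobi_eigenvalue r s a)
      / (\<Prod>a\<in>{..<m} - {j}. jacobi_eigenvalue r s j - jacobi_eigenvalue r s a)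
    = (-1) ^ i * (fact (m + b) * fact (2 * m + b + r + s) * fact (j + r + s) * real (2 * j + r + s + 1))
      / (fact b * fact (m + b + r + s) * (real (b + i + 1) * real (m + b + j + r + s + 1))
         * (fact j * fact i * fact (j + m + r + s)))"
proof -
  have d: "jacobi_eigenvalue r s (m + b) - jacobi_eigenvalue r s j = real (b + i + 1) * real (m + b + j + r + s + 1)"
    unfolding jacobi_eigenvalue_diff by (simp add: m_def)
  have "(\<Prod>a<m. jacobi_eigenvalue r s (m + b) - jacobi_eigenvalue r s a)
      = (real (b + i + 1) * real (m + b + j + r + s + 1))
        * (\<Prod>a\<in>{..<m} - {j}. jacobi_eigenvalue r s (m + b) - jacobi_eigenvalue r s a)"
    unfolding d[symmetric] by (rule prod.remove) (auto simp: m_def)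
  then have num: "(\<Prod>a\<in>{..<m} - {j}. jacobi_eigenvalue r s (m + b) - jacobi_eigenvalue r s a)
     = fact (m + b) * fact (2 * m + b + r + s) / (fact b * fact (m + b + r + s))
       / (real (b + i + 1) * real (m + b + j + r + s + 1))"
    unfolding prod_jacobi_eigenvalue_diff by simp
  have un: "{..<m} - {j} = {..<j} \<union> {j<..<j + 1 + i}" by (auto simp: m_def)
  have "(\<Prod>a\<in>{..<m} - {j}. jacobi_eigenvalue r s j - jacobi_eigenvalue r s a)
      = (\<Prod>a<j. jacobi_eigenvalue r s j - jacobi_eigenvalue r s a)
        * (\<Prod>a\<in>{j<..<j + 1 + i}. jacobi_eigenvalue r s j - jacobi_eigenvalue r s a)"
    unfolding un by (rule prod.union_disjoint) auto
  also have "(\<Prod>a<j. jacobi_eigenvalue r s j - jacobi_eigenvalue r s a) = fact j * fact (2 * j + r + s) / fact (j + r + s)"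
    using prod_jacobi_eigenvalue_diff[of r s j 0] by simp
  also have "(\<Prod>a\<in>{j<..<j + 1 + i}. jacobi_eigenvalue r s j - jacobi_eigenvalue r s a)
      = (-1) ^ i * fact i * fact (j + m + r + s) / (real (2 * j + r + s + 1) * fact (2 * j + r + s))"
  proof -
    have e: "2 * j + 1 + i + r + s = j + m + r + s" by (simp add: m_def)
    have "fact (2 * j + 1 + r + s) = real (2 * j + r + s + 1) * fact (2 * j + r + s)" by simp
    then show ?thesis unfolding prod_jacobi_eigenvalue_diff_above e by (simp only:)
  qed
  finally have den: "(\<Prod>a\<in>{..<m} - {j}. jacobi_eigenvalue r s j - jacobi_eigenvalue r s a)
      = fact j * fact (2 * j + r + s) / fact (j + r + s)
        * ((-1) ^ i * fact i * fact (j + m + r + s) / (real (2 * j + r + s + 1) * fact (2 * j + r + s)))" .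
  \<comment> \<open>Abstracting the factorials leaves a field identity that does not unfold them; S
    is the sign, its own inverse.\<close>
  have gen: "(A * B / (C * D) / F) / (G * H / I * (S * K * L / (P * H))) = S * (A * B * I * P) / (C * D * F * (G * K * L))"
    if "H \<noteq> 0" "S * S = 1" for A B C D F G H I S K L P :: real
  proof -
    have "inverse S = S" by (rule inverse_unique[OF that(2)])
    then show ?thesis using that(1) by (simp add: divide_inverse inverse_mult_distrib mult_ac)
  qed
  have S: "(-1) ^ i * (-1) ^ i = (1::real)" by (simp flip: power_add)
  show ?thesis unfolding num den by (rule gen[OF fact_nonzero S])
qed

lemma ujac_coeff0_fact:
  "ujac_coeff0 r s (i + q) i = (-1) ^ q * (fact (i + q + r) * fact s * fact (i + q) * fact (2 * i + q + r + s))
     / (fact (i + q + s) * fact q * fact (i + q + r + s) * fact (i + r) * fact i)"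
proof -
  let ?j = "i + q"
  have a: "pochhammer (- real ?j) i = (-1) ^ i * (fact ?j / fact q)"
    using pochhammer_minus[of "real ?j" i] pochhammer_real_fact[of q i] by (simp add: add.commute)
  have b: "pochhammer (real (?j + r + s + 1)) i = fact (2 * i + q + r + s) / fact (?j + r + s)"
    using pochhammer_real_fact[of "?j + r + s" i] by (simp add: add_ac mult_2)
  have c: "pochhammer (real r + 1) l = fact (l + r) / fact r" for l r
    using pochhammer_real_fact[of r l] by (simp add: add.commute)
  have sg: "(-1) ^ ?j * ((-1) ^ i) = ((-1) ^ q :: real)"
    by (simp add: power_add mult_ac flip: power_mult_distrib)
  have gen: "S * (A / R) / (B / Z) * (T * (J / Q) * (C / D) / (E / R * I)) = S * T * (A * Z * J * C) / (B * Q * D * E * I)"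
    if "R \<noteq> 0" for A B C D E I J Q R S T Z :: real
    using that by (simp add: mult_ac)
  show ?thesis unfolding ujac_coeff0_def a b c sg[symmetric] by (rule gen) simp
qed

section \<open>The hook coefficients in factorials\<close>

lemma Gamma_eq_fact: "x = real n + 1 \<Longrightarrow> Gamma x = fact n"
  using Gamma_fact[of n, where ?'a = real] by (simp add: add.commute)

text \<open>With \<tau>_1 = b + 1 and \<alpha>_1 = b + 1 + e no truncated subtraction is
  left.\<close>

lemma V_coeff_fact:
  "V_coeff r s m (b + 1 + e) (b + 1) = real (2 * (m + b) + r + s + 1) * fact (2 * m + b + r + s) * fact (m + b + e)
      * fact (m + b + e + r) * fact (m + b + s)
    / (fact e * fact b * fact (m + b + e + (m + b) + r + s + 1) * fact (m + b + r))"
proof -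
  have g: "Gamma (real (b + 1 + 2 * m + r + s)) = fact (2 * m + b + r + s)"
    "Gamma (real (b + 1 + e + m)) = fact (m + b + e)"
    "Gamma (real (r + (b + 1 + e) + m)) = fact (m + b + e + r)"
    "Gamma (real (b + 1 + m + s)) = fact (m + b + s)"
    "Gamma (real (r + s + (b + 1 + e) + (b + 1) + 2 * m)) = fact (m + b + e + (m + b) + r + s + 1)"
    "Gamma (real (r + (b + 1) + m)) = fact (m + b + r)"
    by (rule Gamma_eq_fact, simp)+
  have n: "r + s + 2 * (b + 1) + 2 * m - 1 = 2 * (m + b) + r + s + 1" "b + 1 + e - (b + 1) = e" "b + 1 - 1 = b"
    by simp_all
  show ?thesis unfolding V_coeff_def g n ..
qed

text \<open>Here the length of \<tau> is i + 1, that of \<alpha> is i + q + 1, and l is m minus the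
  length of \<alpha>; all Gamma arguments are then visibly positive integers.\<close>

lemma U_coeff_fact:
  fixes l q i :: nat
  defines "m \<equiv> l + q + i + 1"
  shows "U_coeff r s m (i + q + 1) (i + 1) = real (2 * (l + q) + r + s + 1) * fact (l + q + r) * fact (2 * l + q + r + s)
    / (fact q * fact i * fact l * fact (l + r) * fact (l + q + s) * fact (l + q + m + r + s))"
proof -
  have g: "Gamma (real r + real m - real (i + 1) + 1) = fact (l + q + r)"
    "Gamma (real r + real s + 2 * real m - real (i + q + 1) - real (i + 1) + 1) = fact (2 * l + q + r + s)"
    "Gamma (real m - real (i + q + 1) + 1) = fact l"
    "Gamma (real r + real m - real (i + q + 1) + 1) = fact (l + r)"
    "Gamma (real m + real s - real (i + 1) + 1) = fact (l + q + s)"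
    "Gamma (2 * real m + real r + real s - real (i + 1) + 1) = fact (l + q + m + r + s)"
    by (rule Gamma_eq_fact, simp add: m_def)+
  have n: "2 * real m + real r + real s + 1 - 2 * real (i + 1) = real (2 * (l + q) + r + s + 1)"
    "i + q + 1 - (i + 1) = q" "i + 1 - 1 = i"
    by (simp_all add: m_def)
  show ?thesis unfolding U_coeff_def g n ..
qed

text \<open>On the left stand the coefficient of u^l in the polynomial of row i, the connection
  coefficient of u^(m+b+e) to degree m + b, and the Lagrange factor. The two linear denominators on
  the right are the factors of the difference between the eigenvalues of m + b and of the replaced
  degree l + q.\<close>

theorem hook_term_identity:
  fixes l q i b e :: nat
  defines "m \<equiv> l + q + i + 1"
  shows "ujac_coeff0 r s (l + q) l
      * ((LINT u|lborel. u ^ (m + b + e) * ujac r s (m + b) u * jacobi_w r s u) / ujac_norm_sq r s (m + b))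
      * (ujac_at_ones r s m ((staircase m)(i := m + b)) / ujac_at_ones r s m (staircase m))
    = (-1) ^ (i + q) * (V_coeff r s m (b + 1 + e) (b + 1) * U_coeff r s m (i + q + 1) (i + 1)
        / (real (r + s + (b + 1) + 2 * m - (i + 1)) * real (b + 1 + (i + 1) - 1)))"
proof -
  have im: "i < m" and st: "staircase m i = l + q" and m': "m = (l + q) + i + 1"
    by (simp_all add: m_def staircase_def)
  have R: "ujac_at_ones r s m ((staircase m)(i := m + b)) / ujac_at_ones r s m (staircase m)
    = (-1) ^ i * (fact (m + b) * fact (2 * m + b + r + s) * fact (l + q + r + s) * real (2 * (l + q) + r + s + 1))
      / (fact b * fact (m + b + r + s) * (real (b + i + 1) * real (m + b + (l + q) + r + s + 1))
         * (fact (l + q) * fact i * fact (l + q + m + r + s)))"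
    unfolding ujac_at_ones_upd[OF im] st using lagrange_ratio[where j = "l + q" and i = i and r = r and s = s and b = b] by (simp only: m'[symmetric])
  have H: "(LINT u|lborel. u ^ (m + b + e) * ujac r s (m + b) u * jacobi_w r s u)
    = fact (m + b + e) * fact (m + b + e + r) * fact s / (fact e * fact (m + b + e + (m + b) + r + s + 1))"
    unfolding integral_power_ujac by simp
  have n: "r + s + (b + 1) + 2 * m - (i + 1) = m + b + (l + q) + r + s + 1" "b + 1 + (i + 1) - 1 = b + i + 1"
    by (simp_all add: m_def)
  have sg: "(-1) ^ (i + q) = ((-1) ^ q * (-1) ^ i :: real)" by (simp add: power_add)
  have gen: "Sq * (A1 * S * A2 * A3) / (B1 * B2 * B3 * B4 * B5) * (C1 * C2 * S / (D1 * D2) / (S\<^sup>2 * E1 * E2 / (F1 * E3 * E4)))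
      * (Si * (E1 * G1 * B3 * G2) / (H1 * E3 * (X1 * X2) * (A2 * H2 * H3)))
    = (Sq * Si) * ((F1 * G1 * C1 * C2 * E4 / (D1 * H1 * D2 * E2)) * (G2 * A1 * A3 / (B2 * H2 * B5 * B4 * B1 * H3))
        / (X2 * X1))"
    if "S \<noteq> 0" "A2 \<noteq> 0" "B3 \<noteq> 0" "E1 \<noteq> 0" "E3 \<noteq> 0"
    for Sq Si A1 A2 A3 B1 B2 B3 B4 B5 C1 C2 S D1 D2 E1 E2 E3 E4 F1 G1 G2 H1 H2 H3 X1 X2 :: real
    using that by (simp add: power2_eq_square mult_ac)
  show ?thesis
    unfolding R H n sg ujac_coeff0_fact V_coeff_fact U_coeff_fact[of r s l q i, folded m_def] ujac_norm_sq_def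
    by (rule gen) simp_all
qed

section \<open>The capacity series\<close>

text \<open>The summand of the capacity formula without its sign, power of \<rho> and weight;
  \<alpha> enters only through its first part a and its length l.\<close>

definition hook_term :: "nat \<Rightarrow> nat \<Rightarrow> nat \<Rightarrow> real \<Rightarrow> nat \<Rightarrow> nat \<Rightarrow> nat list \<Rightarrow> real" where
  "hook_term r s m t a l \<tau> = exp (- real (nu r s m \<tau>) * t) * V_coeff r s m a (part \<tau> 0) * U_coeff r s m l (length \<tau>)
     / (real (r + s + part \<tau> 0 + 2 * m - length \<tau>) * real (part \<tau> 0 + length \<tau> - 1))"

lemma hook_contribution:
  assumes h: "h < m" and i: "i \<le> h" and b: "b < n - h"
  shows "ujac_coeff0 r s (staircase m i) (staircase m h)
      * ((LINT u|lborel. u ^ (n + staircase m h) * ujac r s (m + b) u * jacobi_w r s u) / ujac_norm_sq r s (m + b))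
      * hook_factor r s m t i (m + b)
    = (-1) ^ h * hook_term r s m t (n - h) (Suc h) (Suc b # replicate i 1)"
proof -
  define l q e where "l = m - 1 - h" and "q = h - i" and "e = n - h - 1 - b"
  have m: "m = l + q + i + 1" and hq: "h = i + q" and n: "n - h = b + 1 + e" "n + l = m + b + e"
    and st: "staircase m i = l + q" "staircase m h = l"
    using assms by (auto simp: l_def q_def e_def staircase_def)
  have hk: "hook_of m i (m + b) = Suc b # replicate i 1" by (simp add: hook_of_def)
  let ?x = "exp (- real (nu r s m (Suc b # replicate i 1)) * t)"
  let ?R = "ujac_at_ones r s m ((staircase m)(i := m + b)) / ujac_at_ones r s m (staircase m)"
  have hf: "hook_factor r s m t i (m + b) = ?x * ?R"
    by (simp add: hook_factor_def hk)
  have "ujac_coeff0 r s (l + q) l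
      * ((LINT u|lborel. u ^ (m + b + e) * ujac r s (m + b) u * jacobi_w r s u) / ujac_norm_sq r s (m + b)) * ?R
    = (-1) ^ h * (V_coeff r s m (b + 1 + e) (b + 1) * U_coeff r s m (Suc h) (i + 1)
        / (real (r + s + (b + 1) + 2 * m - (i + 1)) * real (b + 1 + (i + 1) - 1)))"
    using hook_term_identity[where l = l and q = q and i = i and b = b and e = e and r = r and s = s]
    by (simp only: m[symmetric] hq Suc_eq_plus1)
  then have "?x * (ujac_coeff0 r s (l + q) l
      * ((LINT u|lborel. u ^ (m + b + e) * ujac r s (m + b) u * jacobi_w r s u) / ujac_norm_sq r s (m + b)) * ?R)
    = (-1) ^ h * hook_term r s m t (n - h) (Suc h) (Suc b # replicate i 1)"
    unfolding n hook_term_def by (simp only:) (simp add: part_def)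
  then show ?thesis unfolding hf st n(2) by (simp only: mult_ac)
qed

text \<open>Subtracting the stationary moment removes the unchanged degrees. The rest is regrouped
  by h, the leg of \<alpha>; i is the leg of \<tau>, and b + 1 its first part.\<close>

theorem moment_difference:
  assumes t: "0 < t"
  shows "(LINT y|lebesgue_pi m. (\<Sum>j<m. y j ^ n) * jacobi_density r s m t y)
      - 1 / jacobi_const r s m * (LINT y|lebesgue_pi m. (\<Sum>j<m. y j ^ n) * jacobi_weight r s m y)
    = (\<Sum>h<m. \<Sum>i\<le>h. \<Sum>b<n - h. (-1) ^ h * hook_term r s m t (n - h) (Suc h) (Suc b # replicate i 1))"
proof -
  let ?C = "\<lambda>i k. ujac_conn r s n (staircase m i) k" and ?f = "hook_factor r s m t"
  let ?g = "\<lambda>i h b. ujac_coeff0 r s (staircase m i) (staircase m h)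
      * ((LINT u|lborel. u ^ (n + staircase m h) * ujac r s (m + b) u * jacobi_w r s u) / ujac_norm_sq r s (m + b))
      * ?f i (m + b)"
  have inner: "(\<Sum>k\<le>n + staircase m i. ?C i k * ?f i k) - ?C i (staircase m i)
      = (\<Sum>h\<in>{i..<m}. \<Sum>b<n - h. (-1) ^ h * hook_term r s m t (n - h) (Suc h) (Suc b # replicate i 1))"
    if i: "i < m" for i
  proof -
    have st: "staircase m i < m" using i by (simp add: staircase_def)
    have "(\<Sum>k\<le>n + staircase m i. ?C i k * ?f i k)
        = (\<Sum>k\<le>n + staircase m i. (if k = staircase m i then ?C i k else 0) + (if m \<le> k then ?C i k * ?f i k else 0))"
      using st by (intro sum.cong refl) (auto simp: hook_factor_def)
    also have "\<dots> = ?C i (staircase m i) + (\<Sum>k\<le>n + staircase m i. if m \<le> k then ?C i k * ?f i k else 0)"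
      by (simp add: sum.distrib)
    also have "(\<Sum>k\<le>n + staircase m i. if m \<le> k then ?C i k * ?f i k else 0) = (\<Sum>k\<in>{k. k \<le> n + staircase m i \<and> m \<le> k}. ?C i k * ?f i k)"
      by (subst sum.inter_filter[symmetric]) (auto intro!: sum.cong)
    also have "\<dots> = (\<Sum>b<n - i. ?C i (m + b) * ?f i (m + b))"
      by (rule sum.reindex_bij_witness[of _ "\<lambda>b. m + b" "\<lambda>k. k - m"]) (use i in \<open>auto simp: staircase_def\<close>)
    also have "\<dots> = (\<Sum>b<n - i. \<Sum>h\<in>{i..<m}. ?g i h b)"
    proof (intro sum.cong refl)
      fix b
      \<comment> \<open>A power of u is written as m - 1 - h. That it is at most m - 1 - i means h
        \<ge> i, the leg condition for \<tau> inside \<alpha>.\<close>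
      have "?C i (m + b) = (\<Sum>h\<in>{i..<m}. ujac_coeff0 r s (staircase m i) (staircase m h)
        * ((LINT u|lborel. u ^ (n + staircase m h) * ujac r s (m + b) u * jacobi_w r s u) / ujac_norm_sq r s (m + b)))"
        unfolding ujac_conn_eq
        by (rule sum.reindex_bij_witness[of _ "staircase m" "staircase m"]) (use i in \<open>auto simp: staircase_def\<close>)
      then show "?C i (m + b) * ?f i (m + b) = (\<Sum>h\<in>{i..<m}. ?g i h b)"
        by (simp only: sum_distrib_right)
    qed
    also have "\<dots> = (\<Sum>h\<in>{i..<m}. \<Sum>b<n - i. ?g i h b)" by (rule sum.swap)
    also have "\<dots> = (\<Sum>h\<in>{i..<m}. \<Sum>b<n - h. (-1) ^ h * hook_term r s m t (n - h) (Suc h) (Suc b # replicate i 1))"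
    proof (rule sum.cong[OF refl])
      fix h assume h: "h \<in> {i..<m}"
      \<comment> \<open>The degree m + b exceeds the exponent n + m - 1 - h, so the moment vanishes:
        this is the arm condition for \<tau> inside \<alpha>.\<close>
      have z: "?g i h b = 0" if "b \<in> {..<n - i} - {..<n - h}" for b
      proof -
        have "n + staircase m h < m + b" using that h i by (auto simp: staircase_def)
        then show ?thesis by (simp add: integral_power_ujac)
      qed
      have "(\<Sum>b<n - i. ?g i h b) = (\<Sum>b<n - h. ?g i h b)"
        by (rule sum.mono_neutral_right) (use h z in auto)
      also have "\<dots> = (\<Sum>b<n - h. (-1) ^ h * hook_term r s m t (n - h) (Suc h) (Suc b # replicate i 1))"
        by (intro sum.cong refl hook_contribution) (use h in auto)
      finally show "(\<Sum>b<n - i. ?g i h b) = \<dots>" .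
    qed
    finally show ?thesis by simp
  qed
  have "(LINT y|lebesgue_pi m. (\<Sum>j<m. y j ^ n) * jacobi_density r s m t y)
      - 1 / jacobi_const r s m * (LINT y|lebesgue_pi m. (\<Sum>j<m. y j ^ n) * jacobi_weight r s m y)
    = (\<Sum>i<m. \<Sum>h\<in>{i..<m}. \<Sum>b<n - h. (-1) ^ h * hook_term r s m t (n - h) (Suc h) (Suc b # replicate i 1))"
    unfolding jacobi_density_moment[OF t] stationary_moment(2) sum_subtractf[symmetric]
    by (intro sum.cong refl) (simp add: inner)
  also have "\<dots> = (\<Sum>h<m. \<Sum>i\<le>h. \<Sum>b<n - h. (-1) ^ h * hook_term r s m t (n - h) (Suc h) (Suc b # replicate i 1))"
    unfolding sum.Sigma[OF finite_lessThan ballI[OF finite_atLeastLessThan]]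
      sum.Sigma[OF finite_lessThan ballI[OF finite_atMost]]
    by (rule sum.reindex_bij_witness[of _ "\<lambda>(h, i). (i, h)" "\<lambda>(i, h). (h, i)"]) auto
  finally show ?thesis .
qed

section \<open>Sums over hooks and their subpartitions\<close>

lemma sum_hooks:
  "(\<Sum>\<alpha>\<in>{\<alpha> \<in> hooks n. 1 \<le> length \<alpha> \<and> length \<alpha> \<le> m}. f \<alpha>)
    = (\<Sum>h\<in>{h. h < n \<and> h < m}. f ((n - h) # replicate h 1))"
  by (rule sum.reindex_bij_witness[of _ "\<lambda>h. (n - h) # replicate h 1" "\<lambda>\<alpha>. length \<alpha> - 1"])
    (auto simp: hooks_def)

text \<open>A nonempty partition inside a hook has only ones after its first part, so it is again a
  hook, with leg i and first part b + 1.\<close>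

lemma subpartitions_hook:
  assumes a: "1 \<le> a"
  shows "{\<tau> \<in> partitions. contained \<tau> (a # replicate h 1) \<and> \<tau> \<noteq> []}
    = (\<lambda>(i, b). Suc b # replicate i 1) ` ({..h} \<times> {..<a})"
proof (intro equalityI subsetI)
  fix \<tau> assume "\<tau> \<in> {\<tau> \<in> partitions. contained \<tau> (a # replicate h 1) \<and> \<tau> \<noteq> []}"
  then have p: "\<tau> \<in> partitions" and c: "\<And>i. part \<tau> i \<le> part (a # replicate h 1) i" and ne: "\<tau> \<noteq> []"
    by (auto simp: contained_def)
  obtain x xs where x: "\<tau> = x # xs" using ne by (cases \<tau>) auto
  have nz: "0 \<notin> set \<tau>" using p by (simp add: partitions_def)
  have x0: "0 < x" using nz x by auto
  have xa: "x \<le> a" using c[of 0] x by (simp add: part_def)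
  have xs1: "y = 1" if y: "y \<in> set xs" for y
  proof -
    obtain j where j: "j < length xs" "xs ! j = y" using y by (auto simp: in_set_conv_nth)
    then have "y \<le> 1" using c[of "Suc j"] x by (auto simp: part_def split: if_splits)
    moreover have "y \<noteq> 0" using nz y x by (metis list.set_intros(2))
    ultimately show ?thesis by simp
  qed
  have len: "length xs \<le> h"
  proof (rule ccontr)
    assume "\<not> length xs \<le> h"
    then have "xs ! h \<in> set xs" "part \<tau> (Suc h) = xs ! h" by (auto simp: x part_def)
    then show False using c[of "Suc h"] xs1[of "xs ! h"] by (simp add: part_def)
  qed
  have "xs = replicate (length xs) 1" by (rule replicate_eqI) (use xs1 in auto)
  then have "\<tau> = (\<lambda>(i, b). Suc b # replicate i 1) (length xs, x - 1)" using x x0 by simp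
  moreover have "(length xs, x - 1) \<in> {..h} \<times> {..<a}" using len xa x0 by auto
  ultimately show "\<tau> \<in> (\<lambda>(i, b). Suc b # replicate i 1) ` ({..h} \<times> {..<a})" by blast
next
  fix \<tau> assume "\<tau> \<in> (\<lambda>(i, b). Suc b # replicate i 1) ` ({..h} \<times> {..<a})"
  then obtain i b where t: "\<tau> = Suc b # replicate i 1" "i \<le> h" "b < a" by auto
  have "\<tau> \<in> partitions" using hook_of_partition[of 0 b i] t by (simp add: hook_of_def)
  moreover have "contained \<tau> (a # replicate h 1)"
    using t by (auto simp: contained_def part_def nth_Cons')
  ultimately show "\<tau> \<in> {\<tau> \<in> partitions. contained \<tau> (a # replicate h 1) \<and> \<tau> \<noteq> []}" using t by simp
qed

lemma sum_subpartitions_hook: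
  assumes a: "1 \<le> a"
  shows "(\<Sum>\<tau>\<in>{\<tau> \<in> partitions. contained \<tau> (a # replicate h 1) \<and> \<tau> \<noteq> []}. f \<tau>)
    = (\<Sum>i\<le>h. \<Sum>b<a. f (Suc b # replicate i 1))"
proof -
  have inj: "inj_on (\<lambda>(i, b). Suc b # replicate i (1::nat)) ({..h} \<times> {..<a})"
    by (rule inj_onI) (auto dest!: arg_cong[of "replicate _ _" _ length])
  show ?thesis
    unfolding subpartitions_hook[OF a] sum.reindex[OF inj] sum.cartesian_product
    by (intro sum.cong) auto
qed

text \<open>For leg h the first part of \<alpha> is n - h, so its sign is (-1)^(n-1) times (-1)^h,
  which restores the coefficient of the logarithm. The sum may run over all h < m because the range
  b < n - h is empty for h \<ge> n.\<close>

lemma hook_double_sum: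
  assumes n: "1 \<le> n"
  shows "(\<Sum>\<alpha>\<in>{\<alpha> \<in> hooks n. 1 \<le> length \<alpha> \<and> length \<alpha> \<le> m}.
      \<Sum>\<tau>\<in>{\<tau> \<in> partitions. contained \<tau> \<alpha> \<and> \<tau> \<noteq> []}.
        (-1) ^ (part \<alpha> 0 - 1) * \<rho> ^ weight \<alpha> / real (weight \<alpha>) * hook_term r s m t (part \<alpha> 0) (length \<alpha>) \<tau>)
    = (-1) ^ (n - 1) * \<rho> ^ n / real n
      * (\<Sum>h<m. \<Sum>i\<le>h. \<Sum>b<n - h. (-1) ^ h * hook_term r s m t (n - h) (Suc h) (Suc b # replicate i 1))"
proof -
  let ?T = "\<lambda>h i b. hook_term r s m t (n - h) (Suc h) (Suc b # replicate i 1)"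
  have "(\<Sum>\<alpha>\<in>{\<alpha> \<in> hooks n. 1 \<le> length \<alpha> \<and> length \<alpha> \<le> m}.
      \<Sum>\<tau>\<in>{\<tau> \<in> partitions. contained \<tau> \<alpha> \<and> \<tau> \<noteq> []}.
        (-1) ^ (part \<alpha> 0 - 1) * \<rho> ^ weight \<alpha> / real (weight \<alpha>) * hook_term r s m t (part \<alpha> 0) (length \<alpha>) \<tau>)
    = (\<Sum>h\<in>{h. h < n \<and> h < m}. (-1) ^ (n - 1) * \<rho> ^ n / real n * (\<Sum>i\<le>h. \<Sum>b<n - h. (-1) ^ h * ?T h i b))"
    unfolding sum_hooks
  proof (rule sum.cong[OF refl])
    fix h assume "h \<in> {h. h < n \<and> h < m}"
    then have h: "1 \<le> n - h" and w: "weight ((n - h) # replicate h 1) = n"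
      by (auto simp: weight_def sum_list_replicate)
    have p: "part ((n - h) # replicate h 1) 0 = n - h" by (simp add: part_def)
    have "n - 1 = (n - h - 1) + h" using h by simp
    then have sg: "(-1) ^ (n - h - 1) = ((-1) ^ (n - 1) * (-1) ^ h :: real)"
      by (simp only: power_add mult.assoc flip: power_mult_distrib) simp
    show "(\<Sum>\<tau>\<in>{\<tau> \<in> partitions. contained \<tau> ((n - h) # replicate h 1) \<and> \<tau> \<noteq> []}.
        (-1) ^ (part ((n - h) # replicate h 1) 0 - 1) * \<rho> ^ weight ((n - h) # replicate h 1) / real (weight ((n - h) # replicate h 1))
          * hook_term r s m t (part ((n - h) # replicate h 1) 0) (length ((n - h) # replicate h 1)) \<tau>)
      = (-1) ^ (n - 1) * \<rho> ^ n / real n * (\<Sum>i\<le>h. \<Sum>b<n - h. (-1) ^ h * ?T h i b)"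
      unfolding sum_subpartitions_hook[OF h] w p sg by (simp add: sum_distrib_left mult_ac)
  qed
  also have "\<dots> = (\<Sum>h<m. (-1) ^ (n - 1) * \<rho> ^ n / real n * (\<Sum>i\<le>h. \<Sum>b<n - h. (-1) ^ h * ?T h i b))"
  proof (rule sum.mono_neutral_left)
    show "\<forall>h\<in>{..<m} - {h. h < n \<and> h < m}.
        (-1) ^ (n - 1) * \<rho> ^ n / real n * (\<Sum>i\<le>h. \<Sum>b<n - h. (-1) ^ h * ?T h i b) = 0"
    proof
      fix h assume "h \<in> {..<m} - {h. h < n \<and> h < m}"
      then have "n - h = 0" by auto
      then show "(-1) ^ (n - 1) * \<rho> ^ n / real n * (\<Sum>i\<le>h. \<Sum>b<n - h. (-1) ^ h * ?T h i b) = 0" by simp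
    qed
  qed auto
  finally show ?thesis by (simp only: sum_distrib_left)
qed

lemma jacobi_weight_eq_0: "j < m \<Longrightarrow> \<not> (0 < y j \<and> y j < 1) \<Longrightarrow> jacobi_weight r s m y = 0"
  using ordered_weight_eq_0[of j m y r s] by (simp add: jacobi_weight_eq)

lemma integrable_power_sum_jacobi_weight:
  "integrable (lebesgue_pi m) (\<lambda>y. (\<Sum>j<m. y j ^ n) * jacobi_weight r s m y)"
  and integrable_jacobi_weight: "integrable (lebesgue_pi m) (jacobi_weight r s m)"
proof -
  have V: "\<bar>(vandermonde m y)\<^sup>2\<bar> \<le> 1" if "\<And>j. j < m \<Longrightarrow> 0 < y j \<and> y j < 1" for y
  proof -
    have "\<bar>vandermonde m y\<bar> \<le> 1" by (rule abs_vandermonde_le) (use that in \<open>auto simp: less_imp_le\<close>)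
    then show ?thesis by (simp add: abs_square_le_1)
  qed
  have "integrable (lebesgue_pi m) (\<lambda>y. ((\<Sum>j<m. y j ^ n) * (vandermonde m y)\<^sup>2) * ordered_weight r s m y)"
  proof (rule integrable_bounded_ordered_weight)
    fix y :: "nat \<Rightarrow> real" assume y: "\<And>j. j < m \<Longrightarrow> 0 < y j \<and> y j < 1"
    show "\<bar>(\<Sum>j<m. y j ^ n) * (vandermonde m y)\<^sup>2\<bar> \<le> real m * 1"
      unfolding abs_mult by (intro mult_mono V abs_power_sum_le y) auto
  qed measurable
  then show "integrable (lebesgue_pi m) (\<lambda>y. (\<Sum>j<m. y j ^ n) * jacobi_weight r s m y)"
    by (simp add: jacobi_weight_eq mult.assoc)
  have "integrable (lebesgue_pi m) (\<lambda>y. (vandermonde m y)\<^sup>2 * ordered_weight r s m y)"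
    by (rule integrable_bounded_ordered_weight[OF _ V]) measurable
  then show "integrable (lebesgue_pi m) (jacobi_weight r s m)"
    by (simp add: jacobi_weight_eq[abs_def])
qed

lemma moment_eq_density_integral:
  assumes M: "prob_space M" and t: "0 < t"
    and J: "\<And>\<omega>. \<omega> \<in> space M \<Longrightarrow> J \<omega> \<in> carrier_mat m m"
    and Y: "\<And>\<omega>. \<omega> \<in> space M \<Longrightarrow> ordered_eigenvalues m (J \<omega>) (Y \<omega>)"
    and D: "distributed M (lebesgue_pi m) Y (\<lambda>y. ennreal (jacobi_density r s m t y))"
  shows "moment M m J n = (LINT y|lebesgue_pi m. (\<Sum>j<m. y j ^ n) * jacobi_density r s m t y)"
proof -
  have "moment M m J n = (LINT \<omega>|M. (\<Sum>j<m. Y \<omega> j ^ n))"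
    unfolding moment_def
    by (rule Bochner_Integration.integral_cong[OF refl])
      (simp only: ordered_eigenvalues_trace_pow[OF J Y] Re_complex_of_real)
  also have "\<dots> = (LINT y|lebesgue_pi m. (\<Sum>j<m. y j ^ n) * jacobi_density r s m t y)"
    by (rule expectation_eq_density_integral[OF M t D measurable_component_power_sum])
  finally show ?thesis .
qed

text \<open>The logarithm of the product is split only after passing to the density, which vanishes
  outside the open cube, where all factors are positive.\<close>

lemma capacity_eq_density_integral:
  assumes M: "prob_space M" and t: "0 < t" and rho: "0 < \<rho>"
    and J: "\<And>\<omega>. \<omega> \<in> space M \<Longrightarrow> J \<omega> \<in> carrier_mat m m"
    and Y: "\<And>\<omega>. \<omega> \<in> space M \<Longrightarrow> ordered_eigenvalues m (J \<omega>) (Y \<omega>)"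
    and D: "distributed M (lebesgue_pi m) Y (\<lambda>y. ennreal (jacobi_density r s m t y))"
  shows "capacity M m J \<rho> = (LINT y|lebesgue_pi m. (\<Sum>j<m. ln (1 + \<rho> * y j)) * jacobi_density r s m t y)"
proof -
  have "capacity M m J \<rho> = (LINT \<omega>|M. ln (\<Prod>j<m. 1 + \<rho> * Y \<omega> j))"
    unfolding capacity_def
    by (rule Bochner_Integration.integral_cong[OF refl])
      (use rho in \<open>simp only: ordered_eigenvalues_det[OF J Y] Re_complex_of_real\<close>)
  also have "\<dots> = (LINT y|lebesgue_pi m. ln (\<Prod>j<m. 1 + \<rho> * y j) * jacobi_density r s m t y)"
    by (rule expectation_eq_density_integral[OF M t D, of "\<lambda>y. ln (\<Prod>j<m. 1 + \<rho> * y j)"])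
      (intro borel_measurable_ln borel_measurable_prod borel_measurable_add borel_measurable_times
        borel_measurable_const measurable_component_singleton, auto)
  also have "\<dots> = (LINT y|lebesgue_pi m. (\<Sum>j<m. ln (1 + \<rho> * y j)) * jacobi_density r s m t y)"
  proof (rule Bochner_Integration.integral_cong[OF refl])
    fix y
    show "ln (\<Prod>j<m. 1 + \<rho> * y j) * jacobi_density r s m t y = (\<Sum>j<m. ln (1 + \<rho> * y j)) * jacobi_density r s m t y"
    proof (cases "\<forall>j<m. 0 < y j \<and> y j < 1")
      case True
      have "0 < 1 + \<rho> * y j" if "j < m" for j using True that rho by (simp add: add_pos_pos)
      then have "1 + \<rho> * y j \<noteq> 0" if "j \<in> {..<m}" for j using that by fastforce
      then have "ln (\<Prod>j<m. 1 + \<rho> * y j) = (\<Sum>j<m. ln (1 + \<rho> * y j))"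
        by (intro ln_prod) auto
      then show ?thesis by simp
    next
      case False
      then show ?thesis using jacobi_density_eq_0 by fastforce
    qed
  qed
  finally show ?thesis .
qed

theorem mainTheorem3:
  fixes m p d r s :: nat and t \<rho> :: real
    and M :: "'a measure" and J :: "'a \<Rightarrow> complex mat"
  assumes "m \<ge> 1" "p \<ge> 1" "d \<ge> 1"
    and "m \<le> p" "p + m \<le> d"
    and "r = p - m" "s = d - p - m"
    and "t > 0" "0 < \<rho>" "\<rho> \<le> 1"
    and "prob_space M"
    and "hermitian_jacobi M m p d t J"
  shows "(\<lambda>k. let n = Suc k in (-1) ^ (n - 1) * \<rho> ^ n / real n * moment M m J n)
           sums capacity M m J \<rho>
       \<and> (\<lambda>k. let n = Suc k in
            \<Sum>\<alpha>\<in>{\<alpha> \<in> hooks n. 1 \<le> length \<alpha> \<and> length \<alpha> \<le> m}.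
            \<Sum>\<tau>\<in>{\<tau> \<in> partitions. contained \<tau> \<alpha> \<and> \<tau> \<noteq> []}.
              (-1) ^ (part \<alpha> 0 - 1) * \<rho> ^ weight \<alpha> / real (weight \<alpha>)
              * (exp (- real (nu r s m \<tau>) * t) * V_coeff r s m (part \<alpha> 0) (part \<tau> 0)
                   * U_coeff r s m (length \<alpha>) (length \<tau>)
                 / (real (r + s + part \<tau> 0 + 2 * m - length \<tau>)
                    * real (part \<tau> 0 + length \<tau> - 1))))
           sums (capacity M m J \<rho> - capacity_infinity m p d \<rho>)"
proof -
  have rs: "p - m = r" "d - p - m = s" using assms(6,7) by auto
  obtain Y where Y: "\<And>\<omega>. \<omega> \<in> space M \<Longrightarrow> ordered_eigenvalues m (J \<omega>) (Y \<omega>)"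
    and D: "distributed M (lebesgue_pi m) Y (\<lambda>y. ennreal (jacobi_density r s m t y))"
    and J: "\<And>\<omega>. \<omega> \<in> space M \<Longrightarrow> J \<omega> \<in> carrier_mat m m"
    using assms(12) unfolding hermitian_jacobi_def rs by blast
  let ?N = "lebesgue_pi m" and ?G = "jacobi_density r s m t" and ?W = "jacobi_weight r s m"
  let ?c = "\<lambda>k. (-1) ^ k * \<rho> ^ Suc k / real (Suc k)"
  have mom: "moment M m J n = (LINT y|?N. (\<Sum>j<m. y j ^ n) * ?G y)" for n
    by (rule moment_eq_density_integral[OF \<open>prob_space M\<close> \<open>t > 0\<close> J Y D])
  have cap: "capacity M m J \<rho> = (LINT y|?N. (\<Sum>j<m. ln (1 + \<rho> * y j)) * ?G y)"
    by (rule capacity_eq_density_integral[OF \<open>prob_space M\<close> \<open>t > 0\<close> \<open>0 < \<rho>\<close> J Y D])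
  have A: "(\<lambda>k. ?c k * moment M m J (Suc k)) sums capacity M m J \<rho>"
    unfolding mom cap
    by (rule log_series_integral[OF jacobi_density_total(1)[OF \<open>t > 0\<close>] jacobi_density_eq_0 \<open>0 < \<rho>\<close> \<open>\<rho> \<le> 1\<close>
        jacobi_density_integral(1)[OF \<open>t > 0\<close> measurable_component_power_sum abs_power_sum_le]])
  have B: "(\<lambda>k. ?c k * (LINT y|?N. (\<Sum>j<m. y j ^ Suc k) * ?W y)) sums (LINT y|?N. (\<Sum>j<m. ln (1 + \<rho> * y j)) * ?W y)"
    by (rule log_series_integral[OF integrable_jacobi_weight jacobi_weight_eq_0 \<open>0 < \<rho>\<close> \<open>\<rho> \<le> 1\<close>
        integrable_power_sum_jacobi_weight])
  \<comment> \<open>The time-dependent and the stationary series have the same logarithm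
    coefficients, so they are subtracted termwise and each difference of moments is a finite hook
    sum.\<close>
  have "(\<lambda>k. ?c k * moment M m J (Suc k) - 1 / jacobi_const r s m * (?c k * (LINT y|?N. (\<Sum>j<m. y j ^ Suc k) * ?W y)))
      sums (capacity M m J \<rho> - capacity_infinity m p d \<rho>)"
    using sums_diff[OF A sums_mult[OF B, of "1 / jacobi_const r s m"]]
    by (simp only: capacity_infinity_def Let_def rs)
  also have "(\<lambda>k. ?c k * moment M m J (Suc k) - 1 / jacobi_const r s m * (?c k * (LINT y|?N. (\<Sum>j<m. y j ^ Suc k) * ?W y)))
    = (\<lambda>k. \<Sum>\<alpha>\<in>{\<alpha> \<in> hooks (Suc k). 1 \<le> length \<alpha> \<and> length \<alpha> \<le> m}.
        \<Sum>\<tau>\<in>{\<tau> \<in> partitions. contained \<tau> \<alpha> \<and> \<tau> \<noteq> []}.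
          (-1) ^ (part \<alpha> 0 - 1) * \<rho> ^ weight \<alpha> / real (weight \<alpha>) * hook_term r s m t (part \<alpha> 0) (length \<alpha>) \<tau>)"
  proof (rule ext)
    fix k
    have "?c k * moment M m J (Suc k) - 1 / jacobi_const r s m * (?c k * (LINT y|?N. (\<Sum>j<m. y j ^ Suc k) * ?W y))
        = ?c k * (moment M m J (Suc k) - 1 / jacobi_const r s m * (LINT y|?N. (\<Sum>j<m. y j ^ Suc k) * ?W y))"
      by (simp only: right_diff_distrib mult.left_commute)
    also have "\<dots> = (\<Sum>\<alpha>\<in>{\<alpha> \<in> hooks (Suc k). 1 \<le> length \<alpha> \<and> length \<alpha> \<le> m}.
        \<Sum>\<tau>\<in>{\<tau> \<in> partitions. contained \<tau> \<alpha> \<and> \<tau> \<noteq> []}.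
          (-1) ^ (part \<alpha> 0 - 1) * \<rho> ^ weight \<alpha> / real (weight \<alpha>) * hook_term r s m t (part \<alpha> 0) (length \<alpha>) \<tau>)"
      unfolding mom moment_difference[OF \<open>t > 0\<close>] by (subst hook_double_sum) (simp_all only: diff_Suc_1 le_add1 Suc_eq_plus1 add_diff_cancel_right' le_add2)
    finally show "?c k * moment M m J (Suc k) - 1 / jacobi_const r s m * (?c k * (LINT y|?N. (\<Sum>j<m. y j ^ Suc k) * ?W y)) = \<dots>" .
  qed
  finally show ?thesis
    using A unfolding hook_term_def Let_def by (simp only: diff_Suc_1)
qed

end
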